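(* Let $X=\{X_t;\ t\in\mathbf{R}_+^N\}$ be a multiparameter Gaussian random field in $\mathbf{R}^d$, with i.i.d. coordinate processes $X^{(1)},\dots,X^{(d)}$. For $t\in\mathbf{R}_+^N$ let $\widetilde{\alpha}_{X^{(i)}}(t)$ be the deterministic local Hölder exponent and $\underline{\alpha}_{X^{(i)}}(t)$ the deterministic local sub-exponent of $X^{(i)}$ at $t$ (both independent of $1\le i\le d$). Set $\mathcal{A}=\{t\in\mathbf{R}_+^N:\ \liminf_{u\to t}\widetilde{\alpha}_{X^{(i)}}(u)>0\}$, and for $t_0\in\mathbf{R}_+^N$ write $\widetilde{a}(t_0)=\liminf_{u\to t_0}\widetilde{\alpha}_{X^{(i)}}(u)$ and $\underline{a}(t_0)=\liminf_{u\to t_0}\underline{\alpha}_{X^{(i)}}(u)$. Then, with probability one, for all $t_0\in\mathcal{A}$: (1) if $N\le d\,\underline{a}(t_0)$, then $$\frac{N}{\underline{a}(t_0)}\le \lim_{\rho\to0}\dim_{\mathcal H}(\mathrm{Gr}_X(B(t_0,\rho)))\le \min\left\{\frac{N}{\widetilde{a}(t_0)}\,;\ N+d(1-\widetilde{a}(t_0))\right\}$$ and $$\frac{N}{\underline{a}(t_0)}\le \lim_{\rho\to0}\dim_{\mathcal H}(\mathrm{Rg}_X(B(t_0,\rho)))\le \min\left\{\frac{N}{\widetilde{a}(t_0)}\,;\ d\right\};$$ (2) if $N> d\,\underline{a}(t_0)$, then $$N+d(1-\underline{a}(t_0))\le \lim_{\rho\to0}\dim_{\mathcal H}(\mathrm{Gr}_X(B(t_0,\rho)))\le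 \min\left\{\frac{N}{\widetilde{a}(t_0)}\,;\ N+d(1-\widetilde{a}(t_0))\right\}$$ and $$\lim_{\rho\to0}\dim_{\mathcal H}(\mathrm{Rg}_X(B(t_0,\rho)))=d.$$
   Context: $\mathbf{R}_+=[0,\infty)$ and $\|\cdot\|$ is the Euclidean norm. A multiparameter Gaussian random field in $\mathbf{R}^d$ is a stochastic process $X=\{X_t;\ t\in\mathbf{R}_+^N\}$ with $X_t=(X^{(1)}_t,\dots,X^{(d)}_t)\in\mathbf{R}^d$, whose coordinate processes $X^{(i)}=\{X^{(i)}_t;\ t\in\mathbf{R}_+^N\}$ are independent real-valued Gaussian processes with the same law. $B(t_0,\rho)$ is the ball of $\mathbf{R}_+^N$ with center $t_0$ and radius $\rho$. For a real-valued Gaussian process $Y=\{Y_t;\ t\in\mathbf{R}_+^N\}$ and $t_0\in\mathbf{R}_+^N$, the deterministic local Hölder exponent is $$\widetilde{\alpha}_Y(t_0)=\sup\Big\{\alpha>0:\ \lim_{\rho\to0}\sup_{s,t\in B(t_0,\rho)}\frac{\mathbf{E}[|Y_t-Y_s|^2]}{\|t-s\|^{2\alpha}}<+\infty\Big\}$$ and the deterministic local sub-exponent is $$\underline{\alpha}_Y(t_0)=\inf\Big\{\alpha>0:\ \lim_{\rho\to0}\inf_{s,t\in B(t_0,\rho)}\frac{\mathbf{E}[|Y_t-Y_s|^2]}{\|t-s\|^{2\alpha}}=+\infty\Big\}$$ (sup and inf over $s\ne t$; $\inf\emptyset=+\infty$, $N/(+\infty)=0$). $\mathrm{Rg}_X(A)=\{X_t;\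 t\in A\}$ and $\mathrm{Gr}_X(A)=\{(t,X_t);\ t\in A\}$ are the range and the graph of $X$ over $A\subset\mathbf{R}_+^N$, and $\dim_{\mathcal H}$ is Hausdorff dimension. "With probability one, for all $t_0$" means that there is a single event of probability one on which the assertion holds simultaneously for all $t_0$.
   Formalization: The field X is assumed to have almost surely continuous paths on the set where the deterministic local Hölder exponent is positive; the upper bound for the graph in case (1) is claimed only when ã(t0) is finite, as it fails for ã(t0)=+∞. *)

theory Defs
  imports "HOL-Probability.Probability"
begin

section \<open>Hausdorff dimension\<close>

definition hausdorff_pre_measure :: "real \<Rightarrow> real \<Rightarrow> 'a::metric_space set \<Rightarrow> ennreal" where
  "hausdorff_pre_measure s \<delta> E =
     (INF U \<in> {U :: nat \<Rightarrow> 'a set. E \<subseteq> (\<Union>i. U i) \<and> (\<forall>i. bounded (U i) \<and> diameter (U i) \<le> \<delta>)}.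
        (\<Sum>i. ennreal (diameter (U i) powr s)))"

definition hausdorff_outer_measure :: "real \<Rightarrow> 'a::metric_space set \<Rightarrow> ennreal" where
  "hausdorff_outer_measure s E = (SUP \<delta> \<in> {0<..}. hausdorff_pre_measure s \<delta> E)"

text \<open>The infimum is restricted to \<open>s > 0\<close> because \<open>0 powr 0 = 0\<close>, so that \<open>s = 0\<close> would not give
  the counting measure. This does not change the dimension (singletons and the empty set have
  dimension \<open>0\<close>).\<close>

definition hausdorff_dim :: "'a::metric_space set \<Rightarrow> ereal" where
  "hausdorff_dim E = Inf {ereal s |s. 0 < s \<and> hausdorff_outer_measure s E = 0}"

section \<open>Gaussian processes and fields\<close>

definition orthant :: "(real ^ 'n) set" where
  "orthant = {t. \<forall>k. 0 \<le> t $ k}"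

definition oball :: "real ^ 'n \<Rightarrow> real \<Rightarrow> (real ^ 'n) set" where
  "oball t0 \<rho> = ball t0 \<rho> \<inter> orthant"

text \<open>Degenerate (almost surely constant) variables count as Gaussian; \<open>normal_density\<close> only covers
  positive variance. Processes are not assumed to be centred.\<close>

definition gaussian_rv :: "'w measure \<Rightarrow> ('w \<Rightarrow> real) \<Rightarrow> bool" where
  "gaussian_rv M Z \<longleftrightarrow> Z \<in> borel_measurable M \<and>
     (\<exists>\<mu>. (AE \<omega> in M. Z \<omega> = \<mu>) \<or> (\<exists>\<sigma>>0. distributed M lborel Z (normal_density \<mu> \<sigma>)))"

definition gaussian_process :: "'w measure \<Rightarrow> 't set \<Rightarrow> ('t \<Rightarrow> 'w \<Rightarrow> real) \<Rightarrow> bool" where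
  "gaussian_process M T Y \<longleftrightarrow>
     (\<forall>F c. finite F \<and> F \<subseteq> T \<longrightarrow> gaussian_rv M (\<lambda>\<omega>. \<Sum>t\<in>F. c t * Y t \<omega>))"

text \<open>Independence and equality in law of the coordinates are those of whole processes, i.e. of random
  elements of the product space \<open>PiM orthant (\<lambda>_. borel)\<close>.\<close>

definition gaussian_field :: "'w measure \<Rightarrow> (real ^ 'n \<Rightarrow> 'w \<Rightarrow> real ^ 'd) \<Rightarrow> bool" where
  "gaussian_field M X \<longleftrightarrow>
     (\<forall>i. gaussian_process M orthant (\<lambda>t \<omega>. X t \<omega> $ i)) \<and>
     prob_space.indep_vars M (\<lambda>_. PiM orthant (\<lambda>_. borel)) (\<lambda>i \<omega>. \<lambda>t\<in>orthant. X t \<omega> $ i) UNIV \<and>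
     (\<forall>i j. distr M (PiM orthant (\<lambda>_. borel)) (\<lambda>\<omega>. \<lambda>t\<in>orthant. X t \<omega> $ i) =
            distr M (PiM orthant (\<lambda>_. borel)) (\<lambda>\<omega>. \<lambda>t\<in>orthant. X t \<omega> $ j))"

section \<open>Deterministic local exponents\<close>

definition offdiag :: "'t set \<Rightarrow> ('t \<times> 't) set" where
  "offdiag B = {(s, t). s \<in> B \<and> t \<in> B \<and> s \<noteq> t}"

definition incr_ratio :: "'w measure \<Rightarrow> (real ^ 'n \<Rightarrow> 'w \<Rightarrow> real) \<Rightarrow> real \<Rightarrow>
    (real ^ 'n) \<times> (real ^ 'n) \<Rightarrow> ereal" where
  "incr_ratio M Y \<alpha> = (\<lambda>(s, t).
     ereal (prob_space.expectation M (\<lambda>\<omega>. \<bar>Y t \<omega> - Y s \<omega>\<bar>\<^sup>2) / norm (t - s) powr (2 * \<alpha>)))"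

text \<open>\<open>max 0\<close> only encodes that the supremum over the empty set of positive exponents is \<open>0\<close>.\<close>

definition local_holder_exponent ::
    "'w measure \<Rightarrow> (real ^ 'n \<Rightarrow> 'w \<Rightarrow> real) \<Rightarrow> real ^ 'n \<Rightarrow> ereal" where
  "local_holder_exponent M Y t0 = max 0 (Sup {ereal \<alpha> |\<alpha>. 0 < \<alpha> \<and>
     (\<exists>L. ((\<lambda>\<rho>. SUP p \<in> offdiag (oball t0 \<rho>). incr_ratio M Y \<alpha> p) \<longlongrightarrow> L) (at_right 0) \<and> L < \<infinity>)})"

definition local_sub_exponent ::
    "'w measure \<Rightarrow> (real ^ 'n \<Rightarrow> 'w \<Rightarrow> real) \<Rightarrow> real ^ 'n \<Rightarrow> ereal" where
  "local_sub_exponent M Y t0 = Inf {ereal \<alpha> |\<alpha>. 0 < \<alpha> \<and>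
     ((\<lambda>\<rho>. INF p \<in> offdiag (oball t0 \<rho>). incr_ratio M Y \<alpha> p) \<longlongrightarrow> \<infinity>) (at_right 0)}"

definition liminf_holder ::
    "'w measure \<Rightarrow> (real ^ 'n \<Rightarrow> 'w \<Rightarrow> real) \<Rightarrow> real ^ 'n \<Rightarrow> ereal" where
  "liminf_holder M Y t0 = Liminf (at t0 within orthant) (local_holder_exponent M Y)"

definition liminf_sub ::
    "'w measure \<Rightarrow> (real ^ 'n \<Rightarrow> 'w \<Rightarrow> real) \<Rightarrow> real ^ 'n \<Rightarrow> ereal" where
  "liminf_sub M Y t0 = Liminf (at t0 within orthant) (local_sub_exponent M Y)"

section \<open>Range and graph\<close>

definition range_over :: "('t \<Rightarrow> 'w \<Rightarrow> 'e) \<Rightarrow> 'w \<Rightarrow> 't set \<Rightarrow> 'e set" where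
  "range_over X \<omega> A = (\<lambda>t. X t \<omega>) ` A"

definition graph_over :: "('t \<Rightarrow> 'w \<Rightarrow> 'e) \<Rightarrow> 'w \<Rightarrow> 't set \<Rightarrow> ('t \<times> 'e) set" where
  "graph_over X \<omega> A = (\<lambda>t. (t, X t \<omega>)) ` A"

text \<open>\<open>has_local_dim D t0 L\<close>: the limit of the dimensions of \<open>D\<close> over shrinking balls exists and is
  \<open>L\<close>; \<open>D\<close> is the range or the graph of one sample path.\<close>

definition has_local_dim ::
    "((real ^ 'n) set \<Rightarrow> 'e::metric_space set) \<Rightarrow> real ^ 'n \<Rightarrow> ereal \<Rightarrow> bool" where
  "has_local_dim D t0 L \<longleftrightarrow> ((\<lambda>\<rho>. hausdorff_dim (D (oball t0 \<rho>))) \<longlongrightarrow> L) (at_right 0)"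

text \<open>A Gaussian field is only determined up to modification, whereas range and graph depend on the
  sample paths. On the relatively open set where the deterministic local exponent is positive,
  Kolmogorov's criterion provides a continuous modification, and it is this version of the field
  whose sample paths are considered. Nothing is required of the paths elsewhere.\<close>

definition continuous_version :: "'w measure \<Rightarrow> (real ^ 'n \<Rightarrow> 'w \<Rightarrow> real ^ 'd) \<Rightarrow> bool" where
  "continuous_version M X \<longleftrightarrow> (AE \<omega> in M.
     continuous_on {t \<in> orthant. \<forall>i. 0 < local_holder_exponent M (\<lambda>t \<omega>. X t \<omega> $ i) t} (\<lambda>t. X t \<omega>))"

end

theory Submission
  imports Defs
begin

text \<open>Everything is reduced to dyadic cubes. On a cube where the second moment of the increments is
  at most \<open>C * h powr (2 * \<beta>)\<close>, moments of high order, the Borel-Cantelli lemma and chaining make the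
  continuous paths Hoelder of every order \<open>\<gamma> < \<beta>\<close>, and coverings by dyadic cubes give the upper
  bounds. On a cube where that moment is at least \<open>h powr (2 * \<beta>)\<close>, the independence of the
  coordinates bounds the probability that \<open>X t - X u\<close> has norm at most \<open>r\<close> by a multiple of
  \<open>(r / h powr \<beta>) ^ d\<close>; hence the expected energy of Lebesgue measure transported to the range or
  the graph is finite, which gives the lower bounds. There are countably many cubes and rational
  exponents, so one null set serves all \<open>t0\<close>: a punctured neighbourhood of \<open>t0\<close> is a union of cubes
  of the first kind for every \<open>\<beta>\<close> below the lower limit of the Hoelder exponents, and every
  neighbourhood of \<open>t0\<close> contains a cube of the second kind for every \<open>\<beta>\<close> above the lower limit of the
  sub-exponents. Exponents in \<open>(1, \<infinity>)\<close> do not occur: an increment bound of order above \<open>1\<close> makes the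
  process locally constant.\<close>

section \<open>Hausdorff null sets\<close>

text \<open>Almost sure statements are available only for countably many objects fixed in advance,
  while \<open>t0\<close> and the exponents vary continuously; strict inequalities leave room for
  rationals, and the loss disappears by density. Four obstacles shape the details. Means are not
  assumed to vanish, so moment and small-ball bounds must hold however the second moment splits into
  variance and squared mean. Paths are continuous only where the Hoelder exponent is positive, and
  \<open>t0\<close> itself need not be such a point; it is left out of all cubes and contributes a
  single point to range and graph. Joint measurability in time and \<omega>, which Tonelli's theorem
  requires, is not part of the data and is recovered from continuity. Finally, the moment of order
  \<open>- d\<close> of a d-dimensional Gaussian increment diverges, so the order \<open>e\<close>
  charged to space stays strictly below \<open>d\<close> and tends to it only in the limit. In case
  (1) the lower bound for the graph comes from the range, its contraction under \<open>snd\<close>;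
  the energy of the graph itself matters in case (2).\<close>

definition hnull :: "real \<Rightarrow> 'a::metric_space set \<Rightarrow> bool" where
  "hnull s E \<longleftrightarrow> (\<forall>\<epsilon>>0. \<exists>U :: nat \<Rightarrow> 'a set. E \<subseteq> (\<Union>i. U i) \<and> (\<forall>i. bounded (U i)) \<and>
     (\<Sum>i. ennreal (diameter (U i) powr s)) \<le> ennreal \<epsilon>)"

lemma ennreal_le_suminf: "f i \<le> (\<Sum>i. f i :: ennreal)"
proof -
  have "sum f {i} \<le> suminf f" by (intro sum_le_suminf) auto
  then show ?thesis by simp
qed

text \<open>A small total forces small pieces: if the sum is at most \<open>\<delta> powr s\<close>,
  then every diameter is at most \<delta>, because \<open>s > 0\<close>. Hence \<open>hnull\<close>
  can do without a bound on the mesh, and a single scale decides whether the measure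
  vanishes.\<close>

lemma hausdorff_outer_measure_eq_0_iff:
  assumes s: "s > 0"
  shows "hausdorff_outer_measure s E = 0 \<longleftrightarrow> hnull s E"
proof
  assume "hausdorff_outer_measure s E = 0"
  moreover have "hausdorff_pre_measure s 1 E \<le> hausdorff_outer_measure s E"
    unfolding hausdorff_outer_measure_def by (intro SUP_upper) simp
  ultimately have 0: "hausdorff_pre_measure s 1 E = 0" by simp
  show "hnull s E"
    unfolding hnull_def
  proof (intro allI impI)
    fix \<epsilon> :: real assume "\<epsilon> > 0"
    then have "hausdorff_pre_measure s 1 E < ennreal \<epsilon>"
      unfolding 0 by (rule ennreal_less_zero_iff[THEN iffD2])
    then obtain U :: "nat \<Rightarrow> 'a set" where "E \<subseteq> (\<Union>i. U i)" "\<And>i. bounded (U i)"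
      "(\<Sum>i. ennreal (diameter (U i) powr s)) < ennreal \<epsilon>"
      unfolding hausdorff_pre_measure_def INF_less_iff by (elim bexE) (simp, blast)
    then show "\<exists>U :: nat \<Rightarrow> 'a set. E \<subseteq> (\<Union>i. U i) \<and> (\<forall>i. bounded (U i)) \<and>
        (\<Sum>i. ennreal (diameter (U i) powr s)) \<le> ennreal \<epsilon>"
      by (intro exI[of _ U]) (simp add: less_imp_le)
  qed
next
  assume n: "hnull s E"
  have "hausdorff_pre_measure s \<delta> E \<le> 0" if \<delta>: "\<delta> > 0" for \<delta>
  proof (rule ennreal_le_epsilon)
    fix \<epsilon> :: real assume "\<epsilon> > 0"
    then have "min \<epsilon> (\<delta> powr s) > 0" using \<delta> by simp
    then obtain U :: "nat \<Rightarrow> 'a set" where U: "E \<subseteq> (\<Union>i. U i)" "\<And>i. bounded (U i)"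
      and le: "(\<Sum>i. ennreal (diameter (U i) powr s)) \<le> ennreal (min \<epsilon> (\<delta> powr s))"
      using n unfolding hnull_def by metis
    have "diameter (U i) \<le> \<delta>" for i
    proof (rule ccontr)
      assume "\<not> diameter (U i) \<le> \<delta>"
      then have "\<delta> powr s < diameter (U i) powr s"
        using powr_less_mono2[OF s, of \<delta> "diameter (U i)"] \<delta> by linarith
      moreover have "ennreal (diameter (U i) powr s) \<le> (\<Sum>i. ennreal (diameter (U i) powr s))"
        by (rule ennreal_le_suminf)
      then have le':  "ennreal (diameter (U i) powr s) \<le> ennreal (\<delta> powr s)"
        using le by (meson ennreal_leI min.cobounded2 order_trans)
      ultimately show False using ennreal_le_iff[of "\<delta> powr s"] by (metis not_less powr_ge_zero)
    qed
    then have "hausdorff_pre_measure s \<delta> E \<le> (\<Sum>i. ennreal (diameter (U i) powr s))"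
      unfolding hausdorff_pre_measure_def using U by (intro INF_lower) auto
    also have "\<dots> \<le> ennreal \<epsilon>" using le by (meson ennreal_leI min.cobounded1 order_trans)
    finally show "hausdorff_pre_measure s \<delta> E \<le> 0 + ennreal \<epsilon>" by simp
  qed
  then have "hausdorff_outer_measure s E \<le> 0"
    unfolding hausdorff_outer_measure_def by (intro SUP_least) simp
  then show "hausdorff_outer_measure s E = 0" by simp
qed

lemma hausdorff_dim_le:
  assumes "s > 0" "hnull s E"
  shows "hausdorff_dim E \<le> ereal s"
  unfolding hausdorff_dim_def using assms
  by (intro Inf_lower) (auto simp: hausdorff_outer_measure_eq_0_iff)

lemma hausdorff_dim_ge:
  assumes "\<And>s. 0 < s \<Longrightarrow> ereal s < x \<Longrightarrow> \<not> hnull s E"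
  shows "x \<le> hausdorff_dim E"
  unfolding hausdorff_dim_def
proof (rule Inf_greatest)
  fix y assume "y \<in> {ereal s |s. 0 < s \<and> hausdorff_outer_measure s E = 0}"
  then obtain s where "y = ereal s" "0 < s" "hnull s E"
    by (auto simp: hausdorff_outer_measure_eq_0_iff)
  then show "x \<le> y" using assms[of s] by force
qed

lemma hausdorff_dim_nonneg: "0 \<le> hausdorff_dim E"
  by (rule hausdorff_dim_ge) auto

lemma hnull_subset: "hnull s F \<Longrightarrow> E \<subseteq> F \<Longrightarrow> hnull s E"
  unfolding hnull_def by (meson subset_trans)

lemma hausdorff_dim_mono: "E \<subseteq> F \<Longrightarrow> hausdorff_dim E \<le> hausdorff_dim F"
  unfolding hausdorff_dim_def
  by (intro Inf_superset_mono) (auto simp: hausdorff_outer_measure_eq_0_iff intro: hnull_subset)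

lemma hnull_UN:
  fixes E :: "nat \<Rightarrow> 'a::metric_space set"
  assumes "\<And>n. hnull s (E n)"
  shows "hnull s (\<Union>n. E n)"
  unfolding hnull_def
proof (intro allI impI)
  fix \<epsilon> :: real assume \<epsilon>: "\<epsilon> > 0"
  have "\<forall>n. \<exists>U :: nat \<Rightarrow> 'a set. E n \<subseteq> (\<Union>i. U i) \<and> (\<forall>i. bounded (U i)) \<and>
     (\<Sum>i. ennreal (diameter (U i) powr s)) \<le> ennreal (\<epsilon> * (1/2) ^ Suc n)"
    using assms \<epsilon> unfolding hnull_def by simp
  then obtain U :: "nat \<Rightarrow> nat \<Rightarrow> 'a set" where U: "\<And>n. E n \<subseteq> (\<Union>i. U n i)" "\<And>n i. bounded (U n i)"
    and le: "\<And>n. (\<Sum>i. ennreal (diameter (U n i) powr s)) \<le> ennreal (\<epsilon> * (1/2) ^ Suc n)"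
    by metis
  define V where "V m = (case prod_decode m of (n, i) \<Rightarrow> U n i)" for m
  have V: "V (prod_encode (n, i)) = U n i" for n i
    by (simp add: V_def)
  have "(\<Sum>m. ennreal (diameter (V m) powr s)) = (\<Sum>n. \<Sum>i. ennreal (diameter (U n i) powr s))"
    using suminf_ennreal_2dimen[of "\<lambda>n. (\<Sum>i. ennreal (diameter (U n i) powr s))"
      "\<lambda>(n, i). ennreal (diameter (U n i) powr s)"]
    unfolding V_def case_prod_beta by (simp only: fst_conv snd_conv)
  also have "\<dots> \<le> (\<Sum>n. ennreal (\<epsilon> * (1/2) ^ Suc n))"
    by (intro suminf_le le) auto
  also have "\<dots> = ennreal (\<Sum>n. \<epsilon> * (1/2) ^ Suc n)"
    using \<epsilon> by (intro suminf_ennreal2) (auto intro!: summable_mult summable_mult2 simp: summable_geometric)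
  also have "(\<Sum>n. \<epsilon> * (1/2) ^ Suc n) = \<epsilon>"
    using sums_unique[OF sums_mult[OF power_half_series, of \<epsilon>]] by (simp only: mult_1_right)
  finally have "(\<Sum>m. ennreal (diameter (V m) powr s)) \<le> ennreal \<epsilon>" .
  moreover have "(\<Union>n. E n) \<subseteq> (\<Union>m. V m)"
  proof
    fix x assume "x \<in> (\<Union>n. E n)"
    then obtain n i where "x \<in> U n i" using U(1) by blast
    then show "x \<in> (\<Union>m. V m)" unfolding V[symmetric] by blast
  qed
  moreover have "\<forall>m. bounded (V m)"
    using U(2) by (simp add: V_def split: prod.splits)
  ultimately show "\<exists>U. (\<Union>n. E n) \<subseteq> (\<Union>i. U i) \<and> (\<forall>i. bounded (U i)) \<and>
     (\<Sum>i. ennreal (diameter (U i) powr s)) \<le> ennreal \<epsilon>"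
    by blast
qed

lemma hnull_singleton [simp]: "hnull s {x}"
  unfolding hnull_def by (intro allI impI exI[of _ "\<lambda>_. {x}"]) auto

lemma hnull_countable_UN:
  assumes "countable I" "\<And>i. i \<in> I \<Longrightarrow> hnull s (E i)"
  shows "hnull s (\<Union>i\<in>I. E i)"
proof (cases "I = {}")
  case True
  then show ?thesis using hnull_subset[OF hnull_singleton, of "{}"] by simp
next
  case False
  then have "I = range (from_nat_into I)"
    using assms(1) by (simp add: range_from_nat_into)
  then have "(\<Union>i\<in>I. E i) = (\<Union>n. E (from_nat_into I n))"
    by (metis image_image)
  moreover have "hnull s (E (from_nat_into I n))" for n
    using False assms(2) by (simp add: from_nat_into)
  ultimately show ?thesis using hnull_UN by metis
qed

lemma hnull_image_contraction:
  assumes n: "hnull s E" and s: "s > 0"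
    and g: "\<And>x y. x \<in> E \<Longrightarrow> y \<in> E \<Longrightarrow> dist (g x) (g y) \<le> dist x y"
  shows "hnull s (g ` E)"
  unfolding hnull_def
proof (intro allI impI)
  fix \<epsilon> :: real assume \<epsilon>: "\<epsilon> > 0"
  then obtain U :: "nat \<Rightarrow> 'a set" where U: "E \<subseteq> (\<Union>i. U i)" "\<And>i. bounded (U i)"
      and le: "(\<Sum>i. ennreal (diameter (U i) powr s)) \<le> ennreal \<epsilon>"
    using n unfolding hnull_def by metis
  \<comment> \<open>The map contracts distances only on \<open>E\<close>, so each piece is cut down
    to \<open>E\<close> before it is mapped.\<close>
  define V where "V i = g ` (U i \<inter> E)" for i
  have d: "dist x y \<le> diameter (U i)" if "x \<in> V i" "y \<in> V i" for x y i
    using that g diameter_bounded_bound[OF U(2)] unfolding V_def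
    by (smt (verit) IntE imageE)
  have bd: "bounded (V i)" for i
    using d unfolding bounded_any_center bounded_def by blast
  have dV: "diameter (V i) \<le> diameter (U i)" for i
    unfolding diameter_def[of "V i"] using d diameter_ge_0[OF U(2)]
    by (auto intro!: cSUP_least)
  have "(\<Sum>i. ennreal (diameter (V i) powr s)) \<le> (\<Sum>i. ennreal (diameter (U i) powr s))"
    using dV s diameter_ge_0[OF bd] by (intro suminf_le ennreal_leI powr_mono2) auto
  moreover have "g ` E \<subseteq> (\<Union>i. V i)" using U(1) by (force simp: V_def)
  ultimately show "\<exists>U. g ` E \<subseteq> (\<Union>i. U i) \<and> (\<forall>i. bounded (U i)) \<and>
     (\<Sum>i. ennreal (diameter (U i) powr s)) \<le> ennreal \<epsilon>"
    using bd le by (meson order_trans)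
qed

text \<open>Serves coverings estimated by number of pieces times a power of a common diameter. The
  index type is free so that pieces can be labelled by integer vectors or pairs of them; padding
  with empty sets costs nothing since \<open>0 powr s = 0\<close>.\<close>

lemma hnull_finite_covers:
  fixes E :: "'a::metric_space set"
  assumes s: "s > 0"
    and cov: "\<And>\<epsilon>. \<epsilon> > 0 \<Longrightarrow> \<exists>(V :: 'b \<Rightarrow> 'a set) I r. finite I \<and> E \<subseteq> (\<Union>i\<in>I. V i) \<and> 0 \<le> r \<and>
      (\<forall>i\<in>I. \<forall>x\<in>V i. \<forall>y\<in>V i. dist x y \<le> r) \<and> real (card I) * r powr s \<le> \<epsilon>"
  shows "hnull s E"
  unfolding hnull_def
proof (intro allI impI)
  fix \<epsilon> :: real assume "\<epsilon> > 0"
  then obtain V :: "'b \<Rightarrow> 'a set" and I r where I: "finite I" "E \<subseteq> (\<Union>i\<in>I. V i)" "0 \<le> r"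
    and d: "\<And>i x y. i \<in> I \<Longrightarrow> x \<in> V i \<Longrightarrow> y \<in> V i \<Longrightarrow> dist x y \<le> r"
    and le: "real (card I) * r powr s \<le> \<epsilon>"
    using cov by metis
  obtain h where h: "bij_betw h {..<card I} I"
    using I(1) bij_betw_from_nat_into_finite by blast
  have hI: "h i \<in> I" if "i < card I" for i using h that by (auto simp: bij_betw_def)
  define U where "U i = (if i < card I then V (h i) else {})" for i
  have bd: "bounded (U i)" for i
    unfolding U_def using d hI by (auto simp: bounded_def) blast
  have dU: "diameter (U i) \<le> r" for i
    unfolding diameter_def U_def using d hI I(3) by (auto intro!: cSUP_least)
  have "(\<Sum>i. ennreal (diameter (U i) powr s)) = (\<Sum>i<card I. ennreal (diameter (U i) powr s))"
    using s by (intro suminf_finite) (auto simp: U_def)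
  also have "\<dots> \<le> (\<Sum>i<card I. ennreal (r powr s))"
    using dU s diameter_ge_0[OF bd] by (intro sum_mono ennreal_leI powr_mono2) auto
  also have "\<dots> = ennreal (real (card I) * r powr s)"
    by (simp add: ennreal_mult ennreal_of_nat_eq_real_of_nat)
  also have "\<dots> \<le> ennreal \<epsilon>" using le by (rule ennreal_leI)
  finally have "(\<Sum>i. ennreal (diameter (U i) powr s)) \<le> ennreal \<epsilon>" .
  moreover have "E \<subseteq> (\<Union>i. U i)"
  proof
    fix x assume "x \<in> E"
    then obtain j where "j \<in> I" "x \<in> V j" using I(2) by auto
    moreover obtain i where "i < card I" "h i = j"
      using h \<open>j \<in> I\<close> unfolding bij_betw_def by (metis imageE lessThan_iff)
    ultimately show "x \<in> (\<Union>i. U i)" by (auto simp: U_def)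
  qed
  ultimately show "\<exists>U. E \<subseteq> (\<Union>i. U i) \<and> (\<forall>i. bounded (U i)) \<and>
     (\<Sum>i. ennreal (diameter (U i) powr s)) \<le> ennreal \<epsilon>"
    using bd by blast
qed

text \<open>The infimum in \<open>hausdorff_dim\<close> also sees exponents below \<open>s\<close>,
  which must be excluded: a covering with total at most 1 has all diameters at most 1, and there a
  larger exponent gives a smaller power.\<close>

lemma le_hausdorff_dim:
  assumes "\<not> hnull s E" "0 < s"
  shows "ereal s \<le> hausdorff_dim E"
proof (rule hausdorff_dim_ge)
  fix r assume r: "0 < r" "ereal r < ereal s"
  show "\<not> hnull r E"
  proof
    assume h: "hnull r E"
    have "hnull s E"
      unfolding hnull_def
    proof (intro allI impI)
      fix \<epsilon> :: real assume "0 < \<epsilon>"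
      then have "0 < min \<epsilon> 1" by simp
      then obtain U :: "nat \<Rightarrow> 'a set" where U: "E \<subseteq> (\<Union>i. U i)" "\<And>i. bounded (U i)"
        and le: "(\<Sum>i. ennreal (diameter (U i) powr r)) \<le> ennreal (min \<epsilon> 1)"
        using h unfolding hnull_def by metis
      have "diameter (U i) powr s \<le> diameter (U i) powr r" for i
      proof (rule powr_mono')
        show "diameter (U i) \<le> 1"
        proof (rule ccontr)
          assume "\<not> diameter (U i) \<le> 1"
          then have "1 < diameter (U i) powr r" using r(1) by (intro gr_one_powr) auto
          moreover have "ennreal (diameter (U i) powr r) \<le> ennreal 1"
            using ennreal_le_suminf[of "\<lambda>i. ennreal (diameter (U i) powr r)" i] le
            by (meson ennreal_leI min.cobounded2 order_trans)
          then have "diameter (U i) powr r \<le> 1" by (subst (asm) ennreal_le_iff) auto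
          ultimately show False by simp
        qed
      qed (use r U diameter_ge_0 in auto)
      then have "(\<Sum>i. ennreal (diameter (U i) powr s)) \<le> (\<Sum>i. ennreal (diameter (U i) powr r))"
        by (intro suminf_le ennreal_leI) auto
      also have "\<dots> \<le> ennreal \<epsilon>" using le by (meson ennreal_leI min.cobounded1 order_trans)
      finally show "\<exists>U :: nat \<Rightarrow> 'a set. E \<subseteq> (\<Union>i. U i) \<and> (\<forall>i. bounded (U i)) \<and>
          (\<Sum>i. ennreal (diameter (U i) powr s)) \<le> ennreal \<epsilon>"
        using U by (intro exI[of _ U]) simp
    qed
    then show False using assms(1) by simp
  qed
qed

lemma hausdorff_dim_image_contraction:
  assumes "\<And>x y. x \<in> E \<Longrightarrow> y \<in> E \<Longrightarrow> dist (g x) (g y) \<le> dist x y"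
  shows "hausdorff_dim (g ` E) \<le> hausdorff_dim E"
  unfolding hausdorff_dim_def
  by (intro Inf_superset_mono)
    (use hnull_image_contraction[OF _ _ assms] in \<open>auto simp: hausdorff_outer_measure_eq_0_iff\<close>)

section \<open>Dyadic cubes\<close>

text \<open>Half-open cubes partition the space at each level, and the lower corner
  \<open>dyadic_floor m t\<close> belongs to its cube and to every coarser cube around
  \<open>t\<close>. Chains of corners therefore never leave the cube on which increments are
  controlled.\<close>

definition dyadic_index :: "nat \<Rightarrow> real ^ 'n \<Rightarrow> int ^ 'n" where
  "dyadic_index m t = (\<chi> i. \<lfloor>2 ^ m * t $ i\<rfloor>)"

definition dyadic_floor :: "nat \<Rightarrow> real ^ 'n \<Rightarrow> real ^ 'n" where
  "dyadic_floor m t = (\<chi> i. of_int \<lfloor>2 ^ m * t $ i\<rfloor> / 2 ^ m)"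

definition dyadic_cube :: "nat \<Rightarrow> int ^ 'n \<Rightarrow> (real ^ 'n) set" where
  "dyadic_cube m k = {t. dyadic_index m t = k}"

lemma mem_dyadic_cube: "t \<in> dyadic_cube m (dyadic_index m t)"
  by (simp add: dyadic_cube_def)

lemma dyadic_floor_cong: "dyadic_index m s = dyadic_index m t \<Longrightarrow> dyadic_floor m s = dyadic_floor m t"
  by (simp add: dyadic_index_def dyadic_floor_def vec_eq_iff)

lemma dyadic_floor_nth_bounds:
  shows "dyadic_floor m t $ i \<le> t $ i" "t $ i < dyadic_floor m t $ i + 1 / 2 ^ m"
proof -
  have "of_int \<lfloor>2 ^ m * t $ i\<rfloor> \<le> 2 ^ m * t $ i" "2 ^ m * t $ i < of_int \<lfloor>2 ^ m * t $ i\<rfloor> + 1"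
    by linarith+
  then show "dyadic_floor m t $ i \<le> t $ i" "t $ i < dyadic_floor m t $ i + 1 / 2 ^ m"
    by (auto simp: dyadic_floor_def field_simps)
qed

lemma norm_dyadic_cube_le:
  fixes s t :: "real ^ 'n"
  assumes "dyadic_index m s = dyadic_index m t"
  shows "norm (s - t) \<le> real CARD('n) / 2 ^ m"
proof -
  have "\<bar>(s - t) $ i\<bar> \<le> 1 / 2 ^ m" for i
    using dyadic_floor_nth_bounds[where m=m and t=s and i=i] dyadic_floor_nth_bounds[where m=m and t=t and i=i] dyadic_floor_cong[OF assms]
    by (simp add: abs_le_iff)
  then have "(\<Sum>i\<in>UNIV. \<bar>(s - t) $ i\<bar>) \<le> (\<Sum>i\<in>(UNIV :: 'n set). 1 / 2 ^ m)"
    by (intro sum_mono)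
  then show ?thesis using norm_le_l1_cart[of "s - t"] by simp
qed

text \<open>Nested floors collapse: taking the integer part before dividing by \<open>2 ^ j\<close>
  does not change the integer part of the quotient.\<close>

lemma dyadic_index_dyadic_floor:
  assumes "n \<le> m"
  shows "dyadic_index n (dyadic_floor m t) = dyadic_index n t"
proof -
  have "\<lfloor>2 ^ n * (real_of_int \<lfloor>2 ^ m * x\<rfloor> / 2 ^ m)\<rfloor> = \<lfloor>2 ^ n * x\<rfloor>" for x :: real
  proof -
    define j where "j = m - n"
    then have m: "m = n + j" using assms by simp
    have "2 ^ n * (of_int \<lfloor>2 ^ m * x\<rfloor> / 2 ^ m :: real) = of_int \<lfloor>2 ^ m * x\<rfloor> / of_int (2 ^ j)"
      by (simp add: m power_add)
    also have "\<lfloor>of_int \<lfloor>2 ^ m * x\<rfloor> / of_int (2 ^ j) :: real\<rfloor> = \<lfloor>2 ^ m * x\<rfloor> div 2 ^ j"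
      by (rule floor_divide_of_int_eq)
    also have "\<dots> = \<lfloor>2 ^ m * x / of_int (2 ^ j)\<rfloor>"
      by (rule floor_divide_real_eq_div[symmetric]) simp
    also have "2 ^ m * x / of_int (2 ^ j) = 2 ^ n * x"
      by (simp add: m power_add)
    finally show ?thesis .
  qed
  then show ?thesis by (simp add: dyadic_index_def dyadic_floor_def)
qed

lemma dyadic_index_coarsen:
  assumes "n \<le> m" "dyadic_index m s = dyadic_index m t"
  shows "dyadic_index n s = dyadic_index n t"
  using dyadic_index_dyadic_floor[OF assms(1)] dyadic_floor_cong[OF assms(2)] by metis

lemma dyadic_floor_in_dyadic_cube:
  "n \<le> m \<Longrightarrow> t \<in> dyadic_cube n k \<Longrightarrow> dyadic_floor m t \<in> dyadic_cube n k"
  by (simp add: dyadic_cube_def dyadic_index_dyadic_floor)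

lemma norm_dyadic_floor_le:
  fixes t :: "real ^ 'n"
  shows "norm (dyadic_floor m t - t) \<le> real CARD('n) / 2 ^ m"
  by (intro norm_dyadic_cube_le dyadic_index_dyadic_floor order_refl)

lemma dyadic_floor_tendsto: "(\<lambda>m. dyadic_floor m t) \<longlonglongrightarrow> (t :: real ^ 'n)"
proof -
  have "(\<lambda>m. real CARD('n) / 2 ^ m) \<longlonglongrightarrow> 0"
    by (rule LIMSEQ_divide_realpow_zero) simp
  then have "(\<lambda>m. dyadic_floor m t - t) \<longlonglongrightarrow> 0"
    by (rule Lim_null_comparison[rotated]) (simp add: norm_dyadic_floor_le)
  then show ?thesis by (simp add: LIM_zero_iff)
qed

lemma card_int_vec_box_le:
  fixes S :: "(int ^ 'n) set"
  assumes "\<And>v i. v \<in> S \<Longrightarrow> v $ i \<in> A i"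
    and fin: "\<And>i. finite (A i)" and card: "\<And>i. card (A i) \<le> K"
  shows "finite S" "card S \<le> K ^ CARD('n)"
proof -
  have sub: "($) ` S \<subseteq> PiE UNIV A" using assms(1) by auto
  have finP: "finite (PiE UNIV A)" using fin by (intro finite_PiE) auto
  have inj: "inj_on ($) S" by (auto simp: inj_on_def vec_eq_iff)
  show "finite S" using finite_subset[OF sub finP] inj by (rule finite_imageD)
  have "card S \<le> card (PiE UNIV A)"
    using card_mono[OF finP sub] card_image[OF inj] by simp
  also have "\<dots> \<le> (\<Prod>i\<in>(UNIV :: 'n set). K)"
    using card by (simp only: card_PiE finite) (intro prod_mono, auto)
  finally show "card S \<le> K ^ CARD('n)" by simp
qed

text \<open>The true count per coordinate is \<open>2 ^ (m - n)\<close>. The cruder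
  \<open>2 ^ m\<close> costs a factor independent of \<open>m\<close>, which the exponential gains
  absorb.\<close>

lemma card_dyadic_index_cube:
  fixes k :: "int ^ 'n"
  assumes "n \<le> m"
  shows "finite (dyadic_index m ` dyadic_cube n k)"
    and "card (dyadic_index m ` dyadic_cube n k) \<le> (2 ^ m) ^ CARD('n)"
proof -
  define j where "j = m - n"
  then have m: "m = n + j" using assms by simp
  define A where "A = (\<lambda>i. {k $ i * 2 ^ j ..< (k $ i + 1) * 2 ^ j})"
  have mem: "\<lfloor>2 ^ m * t $ i\<rfloor> \<in> A i" if "t \<in> dyadic_cube n k" for t i
  proof -
    have "k $ i = \<lfloor>2 ^ n * t $ i\<rfloor>"
      using that by (auto simp: dyadic_cube_def dyadic_index_def)
    then have "of_int (k $ i) \<le> 2 ^ n * t $ i" "2 ^ n * t $ i < of_int (k $ i) + 1"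
      by linarith+
    then have "of_int (k $ i) * 2 ^ j \<le> 2 ^ n * t $ i * 2 ^ j"
      "2 ^ n * t $ i * 2 ^ j < (of_int (k $ i) + 1) * 2 ^ j"
      by (auto intro: mult_right_mono)
    then have "of_int (k $ i * 2 ^ j) \<le> 2 ^ m * t $ i" "2 ^ m * t $ i < of_int ((k $ i + 1) * 2 ^ j)"
      by (auto simp: m power_add algebra_simps)
    then show ?thesis unfolding A_def by (simp only: atLeastLessThan_iff le_floor_iff floor_less_iff)
  qed
  have A: "v $ i \<in> A i" if "v \<in> dyadic_index m ` dyadic_cube n k" for v i
    using that mem by (auto simp: dyadic_index_def)
  have fin: "finite (A i)" and card: "card (A i) \<le> 2 ^ m" for i
    by (simp_all add: A_def algebra_simps nat_power_eq m)
  show "finite (dyadic_index m ` dyadic_cube n k)"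
    using A fin card by (rule card_int_vec_box_le(1))
  show "card (dyadic_index m ` dyadic_cube n k) \<le> (2 ^ m) ^ CARD('n)"
    using A fin card by (rule card_int_vec_box_le(2))
qed

lemma dyadic_index_measurable [measurable]: "dyadic_index m \<in> borel \<rightarrow>\<^sub>M count_space UNIV"
proof (subst measurable_count_space_eq2_countable, safe)
  fix k :: "int ^ 'n"
  have "dyadic_index m -` {k} \<inter> space borel = {t. \<forall>i. \<lfloor>2 ^ m * t $ i\<rfloor> = k $ i}"
    by (auto simp: dyadic_index_def vec_eq_iff)
  also have "\<dots> \<in> sets borel" by measurable
  finally show "dyadic_index m -` {k} \<inter> space borel \<in> sets borel" .
qed auto

lemma dyadic_cube_measurable [measurable]: "dyadic_cube m k \<in> sets borel"
proof -
  have "dyadic_cube m k = dyadic_index m -` {k} \<inter> space borel"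
    by (auto simp: dyadic_cube_def)
  then show ?thesis using measurable_sets[OF dyadic_index_measurable, of "{k}" m] by simp
qed

lemma dyadic_cube_subset_cbox:
  fixes k :: "int ^ 'n" and m :: nat
  defines "a \<equiv> (\<chi> i. of_int (k $ i) / 2 ^ m) :: real ^ 'n"
    and "b \<equiv> (\<chi> i. (of_int (k $ i) + 1) / 2 ^ m) :: real ^ 'n"
  shows "dyadic_cube m k \<subseteq> cbox a b" "box a b \<subseteq> dyadic_cube m k"
proof -
  have "real_of_int (k $ i) \<le> 2 ^ m * t $ i \<and> 2 ^ m * t $ i < of_int (k $ i) + 1"
    if "t \<in> dyadic_cube m k" for t i
  proof -
    have "k $ i = \<lfloor>2 ^ m * t $ i\<rfloor>" using that by (auto simp: dyadic_cube_def dyadic_index_def)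
    then show ?thesis by linarith
  qed
  then show "dyadic_cube m k \<subseteq> cbox a b"
    unfolding a_def b_def by (simp add: mem_box_cart field_simps subset_eq less_imp_le)
  show "box a b \<subseteq> dyadic_cube m k"
    unfolding a_def b_def
    by (auto simp: mem_box_cart dyadic_cube_def dyadic_index_def vec_eq_iff field_simps floor_eq_iff less_imp_le)
qed

lemma emeasure_dyadic_cube:
  fixes k :: "int ^ 'n"
  shows "0 < emeasure lborel (dyadic_cube m k)" "emeasure lborel (dyadic_cube m k) < \<infinity>"
proof -
  define a where "a = ((\<chi> i. of_int (k $ i) / 2 ^ m) :: real ^ 'n)"
  define b where "b = ((\<chi> i. (of_int (k $ i) + 1) / 2 ^ m) :: real ^ 'n)"
  note sub = dyadic_cube_subset_cbox[where m=m and k=k, folded a_def b_def]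
  have "emeasure lborel (dyadic_cube m k) \<le> emeasure lborel (cbox a b)"
    by (intro emeasure_mono sub) auto
  then show "emeasure lborel (dyadic_cube m k) < \<infinity>"
    using emeasure_lborel_cbox_finite[of a b] by (rule le_less_trans)
  have lt: "a $ i < b $ i" for i by (simp add: a_def b_def divide_strict_right_mono)
  have "0 < (\<Prod>x\<in>Basis. (b - a) \<bullet> x)"
    using lt by (intro prod_pos) (auto simp: Basis_vec_def inner_axis)
  moreover have "emeasure lborel (box a b) = (\<Prod>x\<in>Basis. (b - a) \<bullet> x)"
    using lt by (intro emeasure_lborel_box) (auto simp: Basis_vec_def inner_axis less_imp_le)
  moreover have "emeasure lborel (box a b) \<le> emeasure lborel (dyadic_cube m k)"
    by (intro emeasure_mono sub) auto
  ultimately show "0 < emeasure lborel (dyadic_cube m k)"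
    by (metis ennreal_less_zero_iff less_le_trans)
qed

text \<open>The faces of the orthant lie on the dyadic grid, so the half-open cube of a point of the
  orthant stays in the orthant even when the point is on the boundary.\<close>

lemma exists_dyadic_cube:
  fixes u :: "real ^ 'n"
  assumes "u \<in> orthant" "\<rho> > 0"
  obtains m k where "u \<in> dyadic_cube m k" "dyadic_cube m k \<subseteq> oball u \<rho>"
proof -
  have "(\<lambda>m. real CARD('n) / 2 ^ m) \<longlonglongrightarrow> 0"
    by (rule LIMSEQ_divide_realpow_zero) simp
  then have "\<forall>\<^sub>F m in sequentially. real CARD('n) / 2 ^ m < \<rho>"
    using assms(2) by (rule order_tendstoD)
  then obtain m where m: "real CARD('n) / 2 ^ m < \<rho>"
    by (auto simp: eventually_sequentially)
  have "t \<in> oball u \<rho>" if "t \<in> dyadic_cube m (dyadic_index m u)" for t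
  proof -
    have eq: "dyadic_index m u = dyadic_index m t" using that by (simp add: dyadic_cube_def)
    have "0 \<le> t $ i" for i
    proof -
      have "0 \<le> dyadic_floor m u $ i" using assms(1) by (simp add: dyadic_floor_def orthant_def)
      then show ?thesis
        using dyadic_floor_nth_bounds(1)[of m t i] dyadic_floor_cong[OF eq] by simp
    qed
    then show ?thesis
      using norm_dyadic_cube_le[OF eq] m by (auto simp: oball_def orthant_def dist_norm)
  qed
  then show ?thesis using that[OF mem_dyadic_cube] by blast
qed

section \<open>Gaussian increments\<close>

lemma gaussian_rv_cases:
  assumes "gaussian_rv M Z"
  obtains (const) \<mu> where "Z \<in> borel_measurable M" "AE \<omega> in M. Z \<omega> = \<mu>"
  | (normal) \<mu> \<sigma> where "Z \<in> borel_measurable M" "\<sigma> > 0" "distributed M lborel Z (normal_density \<mu> \<sigma>)"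
  using assms unfolding gaussian_rv_def by blast

context prob_space
begin

lemma normal_central_moment:
  assumes "\<sigma> > 0" "distributed M lborel Z (normal_density \<mu> \<sigma>)"
  shows "integrable M (\<lambda>\<omega>. (Z \<omega> - \<mu>) ^ k)"
    and "expectation (\<lambda>\<omega>. (Z \<omega> - \<mu>) ^ k) = (\<integral>x. normal_density \<mu> \<sigma> x * (x - \<mu>) ^ k \<partial>lborel)"
proof -
  have "integrable lborel (\<lambda>x. normal_density \<mu> \<sigma> x * (x - \<mu>) ^ k)"
    using assms(1) by (rule integrable_normal_moment)
  then show "integrable M (\<lambda>\<omega>. (Z \<omega> - \<mu>) ^ k)"
    using distributed_integrable[OF assms(2), of "\<lambda>x. (x - \<mu>) ^ k"] by simp
  show "expectation (\<lambda>\<omega>. (Z \<omega> - \<mu>) ^ k) = (\<integral>x. normal_density \<mu> \<sigma> x * (x - \<mu>) ^ k \<partial>lborel)"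
    using distributed_integral[OF assms(2), of "\<lambda>x. (x - \<mu>) ^ k"] by simp
qed

lemma normal_second_moment:
  assumes "\<sigma> > 0" "distributed M lborel Z (normal_density \<mu> \<sigma>)"
  shows "expectation (\<lambda>\<omega>. (Z \<omega>)\<^sup>2) = \<sigma>\<^sup>2 + \<mu>\<^sup>2"
proof -
  note i = normal_central_moment(1)[OF assms] and e = normal_central_moment(2)[OF assms]
  have 1: "expectation (\<lambda>\<omega>. Z \<omega> - \<mu>) = 0"
    using e[of 1] integral_normal_moment_odd[OF assms(1), of \<mu> 0] by simp
  have 2: "expectation (\<lambda>\<omega>. (Z \<omega> - \<mu>)\<^sup>2) = \<sigma>\<^sup>2"
    using e[of 2] integral_normal_moment_even[OF assms(1), of \<mu> 1] assms(1) by simp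
  have "(\<lambda>\<omega>. (Z \<omega>)\<^sup>2) = (\<lambda>\<omega>. (Z \<omega> - \<mu>)\<^sup>2 + (2 * \<mu> * (Z \<omega> - \<mu>) + \<mu>\<^sup>2))"
    by (simp add: fun_eq_iff power2_eq_square algebra_simps)
  moreover have "expectation (\<lambda>\<omega>. (Z \<omega> - \<mu>)\<^sup>2 + (2 * \<mu> * (Z \<omega> - \<mu>) + \<mu>\<^sup>2)) = \<sigma>\<^sup>2 + (2 * \<mu> * 0 + \<mu>\<^sup>2)"
    using i[of 1] i[of 2] 1 2 by (simp add: prob_space)
  ultimately show ?thesis by simp
qed

text \<open>The quotient of factorials is the moment of order \<open>2 * k\<close> of a standard
  normal variable, the summand 1 accounts for the mean, and \<open>4 ^ k\<close> comes from
  splitting \<open>Z\<close> into its mean and its centred part: \<open>Z^2\<close> is at most 4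
  times the larger of the two squares.\<close>

lemma gaussian_rv_even_moment:
  assumes "gaussian_rv M Z"
  shows "integrable M (\<lambda>\<omega>. Z \<omega> ^ (2 * k))"
    and "expectation (\<lambda>\<omega>. Z \<omega> ^ (2 * k)) \<le>
      4 ^ k * (fact (2 * k) / (2 ^ k * fact k) + 1) * (expectation (\<lambda>\<omega>. (Z \<omega>)\<^sup>2)) ^ k"
    (is "?E \<le> 4 ^ k * (?c + 1) * ?v ^ k")
proof -
  have "integrable M (\<lambda>\<omega>. Z \<omega> ^ (2 * k)) \<and> ?E \<le> 4 ^ k * (?c + 1) * ?v ^ k"
    using assms
  proof (cases rule: gaussian_rv_cases)
    case (const \<mu>)
    note [measurable] = const(1)
    have e: "expectation (\<lambda>\<omega>. Z \<omega> ^ (2 * j)) = \<mu> ^ (2 * j)" for j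
    proof -
      have "expectation (\<lambda>\<omega>. Z \<omega> ^ (2 * j)) = expectation (\<lambda>\<omega>. \<mu> ^ (2 * j))"
        using const by (intro integral_cong_AE) auto
      then show ?thesis by (simp add: prob_space)
    qed
    have "integrable M (\<lambda>\<omega>. Z \<omega> ^ (2 * k)) \<longleftrightarrow> integrable M (\<lambda>\<omega>. \<mu> ^ (2 * k))"
      using const by (intro integrable_cong_AE) auto
    moreover have "1 * ?v ^ k \<le> 4 ^ k * (?c + 1) * ?v ^ k"
      using mult_mono[of 1 "4 ^ k :: real" 1 "?c + 1"] by (intro mult_right_mono) auto
    ultimately show ?thesis using e[of k] e[of 1] by (simp add: power_mult)
  next
    case (normal \<mu> \<sigma>)
    note [measurable] = normal(1) and i = normal_central_moment(1)[OF normal(2,3)]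
    have v: "?v = \<sigma>\<^sup>2 + \<mu>\<^sup>2" using normal by (intro normal_second_moment)
    have le: "Z \<omega> ^ (2 * k) \<le> 4 ^ k * ((Z \<omega> - \<mu>) ^ (2 * k) + \<mu> ^ (2 * k))" for \<omega>
    proof -
      define w where "w = Z \<omega> - \<mu>"
      have "(Z \<omega>)\<^sup>2 \<le> 2 * w\<^sup>2 + 2 * \<mu>\<^sup>2"
        using zero_le_power2[of "w - \<mu>"] by (simp add: w_def power2_eq_square algebra_simps)
      then have "(Z \<omega>)\<^sup>2 \<le> 4 * max (w\<^sup>2) (\<mu>\<^sup>2)" by linarith
      then have "(Z \<omega>)\<^sup>2 ^ k \<le> (4 * max (w\<^sup>2) (\<mu>\<^sup>2)) ^ k" by (intro power_mono) auto
      also have "\<dots> = 4 ^ k * (max (w\<^sup>2) (\<mu>\<^sup>2)) ^ k" by (simp add: power_mult_distrib)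
      also have "(max (w\<^sup>2) (\<mu>\<^sup>2)) ^ k \<le> (w\<^sup>2) ^ k + (\<mu>\<^sup>2) ^ k" by (simp add: max_def)
      finally show ?thesis by (simp add: w_def power_mult)
    qed
    have i': "integrable M (\<lambda>\<omega>. 4 ^ k * ((Z \<omega> - \<mu>) ^ (2 * k) + \<mu> ^ (2 * k)))"
      using i by simp
    have int: "integrable M (\<lambda>\<omega>. Z \<omega> ^ (2 * k))"
      using le by (intro Bochner_Integration.integrable_bound[OF i']) auto
    have "?E \<le> expectation (\<lambda>\<omega>. 4 ^ k * ((Z \<omega> - \<mu>) ^ (2 * k) + \<mu> ^ (2 * k)))"
      using int i' le by (intro integral_mono)
    also have "\<dots> = 4 ^ k * (expectation (\<lambda>\<omega>. (Z \<omega> - \<mu>) ^ (2 * k)) + \<mu> ^ (2 * k))"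
      using i[of "2 * k"] by (simp add: prob_space)
    also have "\<dots> = 4 ^ k * (?c * (\<sigma>\<^sup>2) ^ k + (\<mu>\<^sup>2) ^ k)"
      using normal_central_moment(2)[OF normal(2,3), of "2 * k"]
        integral_normal_moment_even[OF normal(2), of \<mu> k] normal(2)
      by (simp add: power_mult power_divide)
    also have "\<dots> \<le> 4 ^ k * ((?c + 1) * (\<sigma>\<^sup>2 + \<mu>\<^sup>2) ^ k)"
    proof -
      have "?c * (\<sigma>\<^sup>2) ^ k + 1 * (\<mu>\<^sup>2) ^ k \<le> ?c * (\<sigma>\<^sup>2 + \<mu>\<^sup>2) ^ k + 1 * (\<sigma>\<^sup>2 + \<mu>\<^sup>2) ^ k"
        by (intro add_mono mult_left_mono power_mono) auto
      then show ?thesis unfolding distrib_right by (intro mult_left_mono) auto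
    qed
    finally show ?thesis using int v by (simp add: mult.assoc)
  qed
  then show "integrable M (\<lambda>\<omega>. Z \<omega> ^ (2 * k))" "?E \<le> 4 ^ k * (?c + 1) * ?v ^ k"
    by blast+
qed

lemma gaussian_rv_tail:
  assumes Z: "gaussian_rv M Z" and r: "r > 0"
  shows "prob {\<omega> \<in> space M. \<bar>Z \<omega>\<bar> \<ge> r} \<le>
    4 ^ k * (fact (2 * k) / (2 ^ k * fact k) + 1) * (expectation (\<lambda>\<omega>. (Z \<omega>)\<^sup>2)) ^ k / r ^ (2 * k)"
proof -
  have [measurable]: "Z \<in> borel_measurable M" using Z by (simp add: gaussian_rv_def)
  have "prob {\<omega> \<in> space M. \<bar>Z \<omega>\<bar> \<ge> r} \<le> prob {\<omega> \<in> space M. Z \<omega> ^ (2 * k) \<ge> r ^ (2 * k)}"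
  proof (intro finite_measure_mono subsetI)
    fix \<omega> assume "\<omega> \<in> {\<omega> \<in> space M. \<bar>Z \<omega>\<bar> \<ge> r}"
    then have "r ^ (2 * k) \<le> \<bar>Z \<omega>\<bar> ^ (2 * k)" "\<omega> \<in> space M" using r by (auto intro: power_mono)
    then show "\<omega> \<in> {\<omega> \<in> space M. Z \<omega> ^ (2 * k) \<ge> r ^ (2 * k)}" by (simp add: power_even_abs)
  qed measurable
  also have "\<dots> \<le> expectation (\<lambda>\<omega>. Z \<omega> ^ (2 * k)) / r ^ (2 * k)"
    using r gaussian_rv_even_moment(1)[OF Z]
    by (intro integral_Markov_inequality_measure[where A = "{}"]) auto
  also have "\<dots> \<le> 4 ^ k * (fact (2 * k) / (2 ^ k * fact k) + 1) *
      (expectation (\<lambda>\<omega>. (Z \<omega>)\<^sup>2)) ^ k / r ^ (2 * k)"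
    using gaussian_rv_even_moment(2)[OF Z] r by (intro divide_right_mono) auto
  finally show ?thesis .
qed

text \<open>The bound does not depend on how the second moment splits into variance and squared mean:
  when the mean dominates the standard deviation, a neighbourhood of 0 lies in the Gaussian tail.\<close>

lemma gaussian_rv_small_ball:
  assumes Z: "gaussian_rv M Z" and r: "r \<ge> 0"
  shows "prob {\<omega> \<in> space M. \<bar>Z \<omega>\<bar> \<le> r} * sqrt (expectation (\<lambda>\<omega>. (Z \<omega>)\<^sup>2)) \<le> 10 * r"
    (is "?P * ?v \<le> _")
  using Z
proof (cases rule: gaussian_rv_cases)
  case (const \<mu>)
  note [measurable] = const(1)
  have "expectation (\<lambda>\<omega>. (Z \<omega>)\<^sup>2) = expectation (\<lambda>\<omega>. \<mu>\<^sup>2)"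
    using const by (intro integral_cong_AE) auto
  then have v: "?v = \<bar>\<mu>\<bar>" by (simp add: prob_space)
  show ?thesis
  proof (cases "\<bar>\<mu>\<bar> \<le> r")
    case True
    then show ?thesis using v r mult_mono[OF prob_le_1, of "\<bar>\<mu>\<bar>" r] by (smt (verit) abs_ge_zero)
  next
    case False
    then have "AE \<omega> in M. \<not> \<bar>Z \<omega>\<bar> \<le> r" using const(2) by auto
    then have "?P = 0" by (subst prob_eq_0) auto
    then show ?thesis using r by simp
  qed
next
  case (normal \<mu> \<sigma>)
  note [measurable] = normal(1)
  have v: "?v = sqrt (\<sigma>\<^sup>2 + \<mu>\<^sup>2)" using normal_second_moment[OF normal(2,3)] by simp
  have P: "?P \<le> 2 * r * D" if D: "\<And>x. \<bar>x\<bar> \<le> r \<Longrightarrow> normal_density \<mu> \<sigma> x \<le> D" for D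
  proof -
    have D0: "0 \<le> D" using D[of 0] r normal_density_nonneg[of \<mu> \<sigma> 0] by (simp del: normal_density_nonneg)
    have "Z -` {-r..r} \<inter> space M = {\<omega> \<in> space M. \<bar>Z \<omega>\<bar> \<le> r}"
      by (auto simp: abs_le_iff)
    then have "ennreal ?P = (\<integral>\<^sup>+x. ennreal (normal_density \<mu> \<sigma> x) * indicator {-r..r} x \<partial>lborel)"
      using distributed_emeasure[OF normal(3), of "{-r..r}"] by (simp add: emeasure_eq_measure)
    also have "\<dots> \<le> (\<integral>\<^sup>+x. ennreal D * indicator {-r..r} x \<partial>lborel)"
      using D by (intro nn_integral_mono) (auto simp: indicator_def intro!: ennreal_leI)
    also have "\<dots> = ennreal (2 * r * D)"
      using r D0 by (simp add: nn_integral_cmult_indicator ennreal_mult[symmetric] mult.commute)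
    finally show ?thesis using r D0 by (simp add: ennreal_le_iff)
  qed
  have s2: "2 \<le> sqrt (2 * pi)"
    using pi_gt3 by (intro real_le_rsqrt) auto
  have nd: "normal_density \<mu> \<sigma> x \<le> 1 / (2 * \<sigma>) * exp (-(x - \<mu>)\<^sup>2 / (2 * \<sigma>\<^sup>2))" for x
  proof -
    have "sqrt (2 * pi * \<sigma>\<^sup>2) = sqrt (2 * pi) * \<sigma>" using normal(2) by (simp add: real_sqrt_mult)
    then have "1 / sqrt (2 * pi * \<sigma>\<^sup>2) \<le> 1 / (2 * \<sigma>)"
      using s2 normal(2) by (simp add: frac_le mult_right_mono)
    then show ?thesis unfolding normal_density_def by (intro mult_right_mono) auto
  qed
  \<comment> \<open>The regimes below yield the factors 3 (mean at most twice the deviation), 4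
    (large \<open>r\<close>) and 8 (Gaussian tail), and a constant variable yields 1; 10 is a round
    upper bound for all of them.\<close>
  show ?thesis
  proof (cases "\<bar>\<mu>\<bar> \<le> 2 * \<sigma>")
    case True
    then have "\<mu>\<^sup>2 \<le> (2 * \<sigma>)\<^sup>2"
      using normal(2) abs_le_square_iff[of \<mu> "2 * \<sigma>"] by (simp del: power_mult_distrib)
    then have "\<sigma>\<^sup>2 + \<mu>\<^sup>2 \<le> (3 * \<sigma>)\<^sup>2"
      by (simp add: power_mult_distrib) (use zero_le_power2[of \<sigma>] in linarith)
    then have "?v \<le> sqrt ((3 * \<sigma>)\<^sup>2)" unfolding v by (intro real_sqrt_le_mono)
    then have v3: "?v \<le> 3 * \<sigma>"
      using normal(2) by (simp only: real_sqrt_abs)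
    have "?P \<le> 2 * r * (1 / (2 * \<sigma>))"
    proof (rule P)
      fix x :: real
      have "1 / (2 * \<sigma>) * exp (-(x - \<mu>)\<^sup>2 / (2 * \<sigma>\<^sup>2)) \<le> 1 / (2 * \<sigma>) * 1"
        using normal(2) by (intro mult_left_mono) auto
      then show "normal_density \<mu> \<sigma> x \<le> 1 / (2 * \<sigma>)" using nd[of x] by simp
    qed
    then have "?P * ?v \<le> 2 * r * (1 / (2 * \<sigma>)) * (3 * \<sigma>)"
      using v3 v r normal(2) by (intro mult_mono) auto
    then show ?thesis using normal(2) r by simp
  next
    case False
    then have m: "\<bar>\<mu>\<bar> > 0" "\<sigma> < \<bar>\<mu>\<bar> / 2" using normal(2) by auto
    have "\<sigma>\<^sup>2 \<le> \<mu>\<^sup>2" using m normal(2) by (simp add: abs_le_square_iff[symmetric])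
    then have "\<sigma>\<^sup>2 + \<mu>\<^sup>2 \<le> (2 * \<mu>)\<^sup>2"
      by (simp add: power_mult_distrib) (use zero_le_power2[of \<mu>] in linarith)
    then have "?v \<le> sqrt ((2 * \<mu>)\<^sup>2)" unfolding v by (intro real_sqrt_le_mono)
    then have v2: "?v \<le> 2 * \<bar>\<mu>\<bar>" by (simp only: real_sqrt_abs abs_mult)
    show ?thesis
    proof (cases "r \<ge> \<bar>\<mu>\<bar> / 2")
      case True
      have "?P * ?v \<le> 1 * (2 * \<bar>\<mu>\<bar>)" using v2 v by (intro mult_mono) auto
      then show ?thesis using True r by simp
    next
      case False
      have "?P \<le> 2 * r * (2 / \<bar>\<mu>\<bar>)"
      proof (rule P)
        fix x assume "\<bar>x\<bar> \<le> r"
        then have "\<bar>\<mu> / 2\<bar> \<le> \<bar>x - \<mu>\<bar>" using False by linarith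
        then have "(\<mu> / 2)\<^sup>2 \<le> (x - \<mu>)\<^sup>2" by (rule abs_le_square_iff[THEN iffD1])
        define y where "y = (x - \<mu>)\<^sup>2 / (2 * \<sigma>\<^sup>2)"
        have y: "\<mu>\<^sup>2 / (8 * \<sigma>\<^sup>2) \<le> y"
          using \<open>(\<mu> / 2)\<^sup>2 \<le> (x - \<mu>)\<^sup>2\<close> normal(2) by (simp add: y_def field_simps power2_eq_square)
        \<comment> \<open>Decay of order \<open>1 / y\<close> is enough: it is what turns the
          density bound of order \<open>1 / \<sigma>\<close> into one of order
          \<open>1 / \<bar>\<mu>\<bar>\<close>, since \<sigma> is less than half of
          \<open>\<bar>\<mu>\<bar>\<close>.\<close>
        have "exp (- y) \<le> 1 / (1 + y)"
        proof -
          have "1 + y \<le> exp y" by (rule exp_ge_add_one_self)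
          moreover have "0 \<le> y" by (simp add: y_def)
          ultimately show ?thesis by (simp add: exp_minus field_simps)
        qed
        also have "\<dots> \<le> 1 / (\<mu>\<^sup>2 / (8 * \<sigma>\<^sup>2))"
        proof -
          have "0 < \<mu>\<^sup>2 / (8 * \<sigma>\<^sup>2)" using m normal(2) by simp
          moreover from this have "0 < 1 + y" using y by linarith
          ultimately show ?thesis using y by (intro divide_left_mono mult_pos_pos) linarith+
        qed
        finally have "1 / (2 * \<sigma>) * exp (- y) \<le> 1 / (2 * \<sigma>) * (1 / (\<mu>\<^sup>2 / (8 * \<sigma>\<^sup>2)))"
          using normal(2) by (intro mult_left_mono) auto
        also have "\<dots> = 4 * \<sigma> / \<mu>\<^sup>2" using normal(2) by (simp add: field_simps power2_eq_square)
        also have "\<dots> \<le> 4 * (\<bar>\<mu>\<bar> / 2) / \<mu>\<^sup>2" using m by (intro divide_right_mono) auto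
        also have "\<dots> = 2 / \<bar>\<mu>\<bar>" using m by (simp add: field_simps power2_eq_square flip: abs_mult)
        finally show "normal_density \<mu> \<sigma> x \<le> 2 / \<bar>\<mu>\<bar>" using nd[of x] by (simp add: y_def)
      qed
      then have "?P * ?v \<le> 2 * r * (2 / \<bar>\<mu>\<bar>) * (2 * \<bar>\<mu>\<bar>)"
        using v2 v r m by (intro mult_mono) auto
      then show ?thesis using m r by simp
    qed
  qed
qed

end

section \<open>Increments of the field and their small balls\<close>

locale gaussian_field_space = prob_space M
  for M :: "'w measure" +
  fixes X :: "real ^ 'n \<Rightarrow> 'w \<Rightarrow> real ^ 'd"
  assumes gaussian_field: "gaussian_field M X"
begin

text \<open>The coordinates have the same law, so the choice of the coordinate \<open>undefined\<close> is immaterial.\<close>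

definition incr_msq :: "real ^ 'n \<Rightarrow> real ^ 'n \<Rightarrow> real" where
  "incr_msq s t = expectation (\<lambda>\<omega>. (X t \<omega> $ undefined - X s \<omega> $ undefined)\<^sup>2)"

lemma gaussian_rv_coordinate_sum:
  assumes "finite F" "F \<subseteq> orthant"
  shows "gaussian_rv M (\<lambda>\<omega>. \<Sum>t\<in>F. c t * X t \<omega> $ i)"
proof -
  have "gaussian_process M orthant (\<lambda>t \<omega>. X t \<omega> $ i)"
    using gaussian_field by (simp add: gaussian_field_def)
  from this[unfolded gaussian_process_def, rule_format, of F c] assms show ?thesis by simp
qed

lemma gaussian_rv_increment:
  assumes "s \<in> orthant" "t \<in> orthant"
  shows "gaussian_rv M (\<lambda>\<omega>. X t \<omega> $ i - X s \<omega> $ i)"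
proof (cases "s = t")
  case True
  then show ?thesis by (auto simp: gaussian_rv_def)
next
  case False
  have "gaussian_rv M (\<lambda>\<omega>. \<Sum>u\<in>{s, t}. (if u = t then 1 else -1) * X u \<omega> $ i)"
    using assms by (intro gaussian_rv_coordinate_sum) auto
  then show ?thesis using False by simp
qed

lemma coordinate_measurable:
  assumes "t \<in> orthant"
  shows "(\<lambda>\<omega>. X t \<omega> $ i) \<in> borel_measurable M"
  using gaussian_rv_coordinate_sum[of "{t}" "\<lambda>_. 1" i] assms by (simp add: gaussian_rv_def)

lemma field_measurable:
  assumes "t \<in> orthant"
  shows "X t \<in> borel_measurable M"
proof (subst borel_measurable_euclidean_space, safe)
  fix b :: "real ^ 'd" assume "b \<in> Basis"
  then obtain i where "b = axis i 1" by (auto simp: Basis_vec_def)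
  then show "(\<lambda>\<omega>. X t \<omega> \<bullet> b) \<in> borel_measurable M"
    using coordinate_measurable[OF assms] by (simp add: inner_axis)
qed

lemma path_measurable: "(\<lambda>\<omega>. \<lambda>t\<in>orthant. X t \<omega> $ i) \<in> M \<rightarrow>\<^sub>M PiM orthant (\<lambda>_. borel)"
  by (intro measurable_restrict coordinate_measurable)

text \<open>The second moment of an increment is the integral of a measurable functional against the
  law of the path, so it is the same for all coordinates.\<close>

lemma incr_msq:
  assumes "s \<in> orthant" "t \<in> orthant"
  shows "expectation (\<lambda>\<omega>. (X t \<omega> $ i - X s \<omega> $ i)\<^sup>2) = incr_msq s t"
proof -
  define g where "g p = (p t - p s)\<^sup>2" for p :: "real ^ 'n \<Rightarrow> real"
  have g: "g \<in> borel_measurable (PiM orthant (\<lambda>_. borel))"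
    unfolding g_def using assms by measurable
  have "expectation (\<lambda>\<omega>. (X t \<omega> $ j - X s \<omega> $ j)\<^sup>2) =
      integral\<^sup>L (distr M (PiM orthant (\<lambda>_. borel)) (\<lambda>\<omega>. \<lambda>t\<in>orthant. X t \<omega> $ j)) g" for j
    using assms by (subst integral_distr[OF path_measurable g]) (simp add: g_def)
  note this[of i] this[of undefined]
  moreover have "distr M (PiM orthant (\<lambda>_. borel)) (\<lambda>\<omega>. \<lambda>t\<in>orthant. X t \<omega> $ i) =
      distr M (PiM orthant (\<lambda>_. borel)) (\<lambda>\<omega>. \<lambda>t\<in>orthant. X t \<omega> $ undefined)"
    by (rule gaussian_field[unfolded gaussian_field_def, THEN conjunct2, THEN conjunct2, rule_format])
  ultimately show ?thesis unfolding incr_msq_def by (simp only:)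
qed

text \<open>A Euclidean ball lies in a cube of the same radius, and independence of the coordinate
  paths passes to their increments; the one-dimensional bound is thus multiplied once per
  coordinate.\<close>

lemma field_small_ball:
  assumes "s \<in> orthant" "t \<in> orthant" and v: "incr_msq s t > 0" and r: "r > 0"
  shows "prob {\<omega> \<in> space M. norm (X t \<omega> - X s \<omega>) \<le> r} \<le> (10 * r / sqrt (incr_msq s t)) ^ CARD('d)"
proof -
  note [measurable] = coordinate_measurable[OF assms(1)] coordinate_measurable[OF assms(2)]
    field_measurable[OF assms(1)] field_measurable[OF assms(2)]
  have ind: "indep_vars (\<lambda>_. borel) (\<lambda>i \<omega>. X t \<omega> $ i - X s \<omega> $ i) UNIV"
  proof -
    have "indep_vars (\<lambda>_. borel) (\<lambda>i \<omega>. (\<lambda>p. p t - p s) (\<lambda>t\<in>orthant. X t \<omega> $ i)) UNIV"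
      using gaussian_field[unfolded gaussian_field_def, THEN conjunct2, THEN conjunct1]
    proof (rule indep_vars_compose2)
      show "(\<lambda>p :: real ^ 'n \<Rightarrow> real. p t - p s) \<in> borel_measurable (PiM orthant (\<lambda>_. borel))"
        using measurable_component_singleton[OF assms(1), of "\<lambda>_. borel :: real measure"]
          measurable_component_singleton[OF assms(2), of "\<lambda>_. borel :: real measure"]
        by (rule borel_measurable_diff[rotated])
    qed
    then show ?thesis using assms by simp
  qed
  have "prob {\<omega> \<in> space M. norm (X t \<omega> - X s \<omega>) \<le> r} \<le>
      prob (\<Inter>i\<in>UNIV. (\<lambda>\<omega>. X t \<omega> $ i - X s \<omega> $ i) -` {-r..r} \<inter> space M)"
  proof (intro finite_measure_mono)
    have "X t \<omega> $ i - X s \<omega> $ i \<in> {-r..r}" if "norm (X t \<omega> - X s \<omega>) \<le> r" for \<omega> i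
      using component_le_norm_cart[of "X t \<omega> - X s \<omega>" i] that by (simp add: abs_le_iff)
    then show "{\<omega> \<in> space M. norm (X t \<omega> - X s \<omega>) \<le> r} \<subseteq>
        (\<Inter>i\<in>UNIV. (\<lambda>\<omega>. X t \<omega> $ i - X s \<omega> $ i) -` {-r..r} \<inter> space M)"
      by blast
    show "(\<Inter>i\<in>UNIV. (\<lambda>\<omega>. X t \<omega> $ i - X s \<omega> $ i) -` {-r..r} \<inter> space M) \<in> events"
      by (intro sets.finite_INT) (auto intro!: measurable_sets)
  qed
  also have "\<dots> = (\<Prod>i\<in>UNIV. prob ((\<lambda>\<omega>. X t \<omega> $ i - X s \<omega> $ i) -` {-r..r} \<inter> space M))"
    by (intro indep_varsD[OF ind]) auto
  also have "\<dots> \<le> (\<Prod>i\<in>(UNIV :: 'd set). 10 * r / sqrt (incr_msq s t))"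
  proof (intro prod_mono conjI measure_nonneg)
    fix i :: 'd
    have "(\<lambda>\<omega>. X t \<omega> $ i - X s \<omega> $ i) -` {-r..r} \<inter> space M =
        {\<omega> \<in> space M. \<bar>X t \<omega> $ i - X s \<omega> $ i\<bar> \<le> r}"
      by (auto simp: abs_le_iff)
    then show "prob ((\<lambda>\<omega>. X t \<omega> $ i - X s \<omega> $ i) -` {-r..r} \<inter> space M) \<le> 10 * r / sqrt (incr_msq s t)"
      using gaussian_rv_small_ball[OF gaussian_rv_increment[OF assms(1,2)], of r i] r v
      by (simp add: incr_msq[OF assms(1,2)] field_simps)
  qed
  also have "\<dots> = (10 * r / sqrt (incr_msq s t)) ^ CARD('d)" by simp
  finally show ?thesis .
qed

end

section \<open>Coverings of ranges and graphs\<close>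

text \<open>Weaker than a Hoelder condition: close points separated by a dyadic hyperplane are not
  compared. Coverings by dyadic cubes need only the oscillation within each cube.\<close>

definition dyadic_holder_on :: "(real ^ 'n) set \<Rightarrow> real \<Rightarrow> (real ^ 'n \<Rightarrow> 'e::metric_space) \<Rightarrow> bool" where
  "dyadic_holder_on Q \<gamma> f \<longleftrightarrow> (\<exists>A m0. 0 \<le> A \<and> (\<forall>m\<ge>m0. \<forall>s\<in>Q. \<forall>t\<in>Q.
     dyadic_index m s = dyadic_index m t \<longrightarrow> dist (f s) (f t) \<le> A * 2 powr (- \<gamma> * real m)))"

lemma powr_times_nat_tendsto_0:
  assumes "a < 0"
  shows "(\<lambda>m. C * 2 powr (a * real m)) \<longlonglongrightarrow> 0"
proof -
  have "2 powr (a * real m) = (2 powr a) ^ m" for m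
    by (simp add: powr_power mult.commute)
  moreover have "(\<lambda>m. C * (2 powr a) ^ m) \<longlonglongrightarrow> C * 0"
    using assms by (intro tendsto_mult_left LIMSEQ_power_zero) (simp add: powr_less_one)
  ultimately show ?thesis by simp
qed

lemma two_power_powr: "((2::real) ^ m) ^ k = 2 powr (real k * real m)"
  by (simp add: powr_powr mult.commute flip: powr_realpow)

text \<open>At level \<open>m\<close> there are at most \<open>2 ^ (m * N)\<close> pieces of
  diameter of order \<open>2 powr (- \<gamma> * m)\<close>, so the total decays as soon as
  \<open>\<gamma> * s > N\<close>.\<close>

lemma hnull_dyadic_holder_image:
  fixes f :: "real ^ 'n \<Rightarrow> 'e::metric_space" and k :: "int ^ 'n"
  assumes f: "dyadic_holder_on (dyadic_cube n k) \<gamma> f" and s: "s > 0" "\<gamma> * s > real CARD('n)"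
  shows "hnull s (f ` dyadic_cube n k)"
proof (rule hnull_finite_covers[OF s(1)])
  fix \<epsilon> :: real assume "\<epsilon> > 0"
  obtain A m0 where A: "0 \<le> A" and osc: "\<And>m s t. m \<ge> m0 \<Longrightarrow> s \<in> dyadic_cube n k \<Longrightarrow> t \<in> dyadic_cube n k \<Longrightarrow>
      dyadic_index m s = dyadic_index m t \<Longrightarrow> dist (f s) (f t) \<le> A * 2 powr (- \<gamma> * real m)"
    using f unfolding dyadic_holder_on_def by metis
  have "(\<lambda>m. A powr s * 2 powr ((real CARD('n) - \<gamma> * s) * real m)) \<longlonglongrightarrow> 0"
    using s by (intro powr_times_nat_tendsto_0) simp
  then have "\<forall>\<^sub>F m in sequentially. A powr s * 2 powr ((real CARD('n) - \<gamma> * s) * real m) < \<epsilon>"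
    using \<open>\<epsilon> > 0\<close> by (rule order_tendstoD)
  then have "\<forall>\<^sub>F m in sequentially. A powr s * 2 powr ((real CARD('n) - \<gamma> * s) * real m) < \<epsilon> \<and> n \<le> m \<and> m0 \<le> m"
    by (intro eventually_conj eventually_ge_at_top)
  then obtain m where m: "A powr s * 2 powr ((real CARD('n) - \<gamma> * s) * real m) < \<epsilon>" "n \<le> m" "m0 \<le> m"
    using eventually_happens'[OF sequentially_bot] by blast
  define r where "r = A * 2 powr (- \<gamma> * real m)"
  define I where "I = dyadic_index m ` dyadic_cube n k"
  define V where "V j = f ` {t \<in> dyadic_cube n k. dyadic_index m t = j}" for j
  have "real (card I) \<le> (2 ^ m) ^ CARD('n)"
    using card_dyadic_index_cube(2)[OF m(2), of k] unfolding I_def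
    by (metis of_nat_le_iff of_nat_numeral of_nat_power)
  then have "real (card I) * r powr s \<le> 2 powr (real CARD('n) * real m) * r powr s"
    unfolding two_power_powr by (intro mult_right_mono) auto
  also have "\<dots> = A powr s * 2 powr ((real CARD('n) - \<gamma> * s) * real m)"
    using A by (simp add: r_def powr_mult powr_powr powr_add[symmetric] algebra_simps)
  finally have "real (card I) * r powr s \<le> \<epsilon>" using m by simp
  moreover have "finite I" using card_dyadic_index_cube(1)[OF m(2)] by (simp add: I_def)
  moreover have "f ` dyadic_cube n k \<subseteq> (\<Union>j\<in>I. V j)" by (auto simp: I_def V_def)
  moreover have "0 \<le> r" using A by (simp add: r_def)
  moreover have "\<forall>j\<in>I. \<forall>x\<in>V j. \<forall>y\<in>V j. dist x y \<le> r"
    using osc[OF m(3)] by (auto simp: V_def r_def)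
  ultimately show "\<exists>(V :: int ^ 'n \<Rightarrow> 'e set) I r. finite I \<and> f ` dyadic_cube n k \<subseteq> (\<Union>i\<in>I. V i) \<and> 0 \<le> r \<and>
      (\<forall>i\<in>I. \<forall>x\<in>V i. \<forall>y\<in>V i. dist x y \<le> r) \<and> real (card I) * r powr s \<le> \<epsilon>"
    by (intro exI[of _ V] exI[of _ I] exI[of _ r] conjI)
qed

lemma dist_Pair_le: "dist (a, b) (c, d) \<le> dist a c + dist b d"
  by (simp add: dist_prod_def sqrt_sum_squares_le_sum)

text \<open>Since \<open>\<gamma> \<le> 1\<close>, the side \<open>2 ^ -m\<close> of a time cube is
  dominated by \<open>2 powr (- \<gamma> * m)\<close>. The graph thus inherits the covering bound of
  the range, of order \<open>N / \<gamma>\<close>.\<close>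

lemma dyadic_holder_on_graph:
  fixes f :: "real ^ 'n \<Rightarrow> 'e::metric_space"
  assumes f: "dyadic_holder_on Q \<gamma> f" and \<gamma>: "\<gamma> \<le> 1"
  shows "dyadic_holder_on Q \<gamma> (\<lambda>t. (t, f t))"
proof -
  obtain A m0 where A: "0 \<le> A" and osc: "\<And>m s t. m \<ge> m0 \<Longrightarrow> s \<in> Q \<Longrightarrow> t \<in> Q \<Longrightarrow>
      dyadic_index m s = dyadic_index m t \<Longrightarrow> dist (f s) (f t) \<le> A * 2 powr (- \<gamma> * real m)"
    using f unfolding dyadic_holder_on_def by metis
  have "dist (s, f s) (t, f t) \<le> (real CARD('n) + A) * 2 powr (- \<gamma> * real m)"
    if "m \<ge> m0" "s \<in> Q" "t \<in> Q" and eq: "dyadic_index m s = dyadic_index m t" for m s t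
  proof -
    have "1 / 2 ^ m = 2 powr (- real m)" by (simp add: powr_minus_divide powr_realpow)
    also have "\<dots> \<le> 2 powr (- \<gamma> * real m)"
      using \<gamma> mult_right_mono[of \<gamma> 1 "real m"] by simp
    finally have "real CARD('n) * (1 / 2 ^ m) \<le> real CARD('n) * 2 powr (- \<gamma> * real m)"
      by (intro mult_left_mono) auto
    moreover have "dist s t \<le> real CARD('n) * (1 / 2 ^ m)"
      using norm_dyadic_cube_le[OF eq] by (simp add: dist_norm)
    ultimately show ?thesis
      using dist_Pair_le[of s "f s" t "f t"] osc[OF that] by (simp add: algebra_simps)
  qed
  then show ?thesis unfolding dyadic_holder_on_def
    using A by (intro exI[of _ "real CARD('n) + A"] exI[of _ m0]) simp
qed

text \<open>The values of \<open>f\<close> over one cube of side \<open>2 ^ -m\<close> are covered by about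
  \<open>2 ^ (m * (1 - \<gamma>) * d)\<close> cubes of the same side.\<close>

lemma hnull_dyadic_holder_graph:
  fixes f :: "real ^ 'n \<Rightarrow> real ^ 'd" and k :: "int ^ 'n"
  assumes f: "dyadic_holder_on (dyadic_cube n k) \<gamma> f" and \<gamma>: "\<gamma> \<le> 1"
    and s: "s > real CARD('n) + real CARD('d) * (1 - \<gamma>)"
  shows "hnull s ((\<lambda>t. (t, f t)) ` dyadic_cube n k)"
proof -
  define Q where "Q = dyadic_cube n k"
  have s0: "s > 0" using s \<gamma> by (smt (verit) mult_nonneg_nonneg of_nat_0_le_iff zero_less_card_finite of_nat_0_less_iff)
  obtain A m0 where A: "0 \<le> A" and osc: "\<And>m s t. m \<ge> m0 \<Longrightarrow> s \<in> Q \<Longrightarrow> t \<in> Q \<Longrightarrow>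
      dyadic_index m s = dyadic_index m t \<Longrightarrow> dist (f s) (f t) \<le> A * 2 powr (- \<gamma> * real m)"
    using f unfolding dyadic_holder_on_def Q_def by metis
  \<comment> \<open>The first factor comes from the number of boxes stacked over a time cube, the
    second from the diameter of a product of a time cube and a space cube.\<close>
  define C where "C = (2 * A + 5) ^ CARD('d) * (real CARD('n) + real CARD('d)) powr s"
  show ?thesis
  proof (rule hnull_finite_covers[OF s0])
    fix \<epsilon> :: real assume "\<epsilon> > 0"
    have "(\<lambda>m. C * 2 powr ((real CARD('n) + real CARD('d) * (1 - \<gamma>) - s) * real m)) \<longlonglongrightarrow> 0"
      using s by (intro powr_times_nat_tendsto_0) simp
    then have "\<forall>\<^sub>F m in sequentially. C * 2 powr ((real CARD('n) + real CARD('d) * (1 - \<gamma>) - s) * real m) < \<epsilon>"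
      using \<open>\<epsilon> > 0\<close> by (rule order_tendstoD)
    then have "\<forall>\<^sub>F m in sequentially. C * 2 powr ((real CARD('n) + real CARD('d) * (1 - \<gamma>) - s) * real m) < \<epsilon>
        \<and> n \<le> m \<and> m0 \<le> m"
      by (intro eventually_conj eventually_ge_at_top)
    then obtain m where m: "C * 2 powr ((real CARD('n) + real CARD('d) * (1 - \<gamma>) - s) * real m) < \<epsilon>"
        "n \<le> m" "m0 \<le> m"
      using eventually_happens'[OF sequentially_bot] by blast
    define r where "r = (real CARD('n) + real CARD('d)) * 2 powr (- real m)"
    define J where "J = dyadic_index m ` Q"
    define L where "L j = (\<lambda>t. dyadic_index m (f t)) ` {t \<in> Q. dyadic_index m t = j}" for j
    define I where "I = Sigma J L"
    define V where "V = (\<lambda>(j, l). (\<lambda>t. (t, f t)) ` {t \<in> Q. dyadic_index m t = j \<and> dyadic_index m (f t) = l})"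
    have J: "finite J" "real (card J) \<le> (2 ^ m) ^ CARD('n)"
      using card_dyadic_index_cube[OF m(2), of k] unfolding J_def Q_def
      by (simp, metis of_nat_le_iff of_nat_numeral of_nat_power)
    have L: "finite (L j) \<and> real (card (L j)) \<le> ((2 * A + 5) * 2 powr ((1 - \<gamma>) * real m)) ^ CARD('d)"
      if "j \<in> J" for j
    proof -
      obtain t0 where t0: "t0 \<in> Q" "dyadic_index m t0 = j" using \<open>j \<in> J\<close> by (auto simp: J_def)
      define x where "x = A * 2 powr ((1 - \<gamma>) * real m)"
      \<comment> \<open>Here \<open>x\<close> is the oscillation in units of the side
        \<open>2 ^ -m\<close>. Rounding up costs less than 1 and passing to integer parts at most 1
        more, so \<open>2 * B + 1\<close> is at most \<open>2 * x + 5\<close>; this is the origin of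
        the 5.\<close>
      define B where "B = \<lceil>x\<rceil> + 1"
      have x0: "0 \<le> x" using A by (simp add: x_def)
      have B0: "0 \<le> B" using x0 unfolding B_def by linarith
      define D where "D i = {dyadic_index m (f t0) $ i - B .. dyadic_index m (f t0) $ i + B}" for i
      have mem: "v $ i \<in> D i" if "v \<in> L j" for v i
      proof -
        obtain t where t: "t \<in> Q" "dyadic_index m t = j" "v = dyadic_index m (f t)"
          using \<open>v \<in> L j\<close> by (auto simp: L_def)
        have "\<bar>f t $ i - f t0 $ i\<bar> \<le> dist (f t) (f t0)"
          using component_le_norm_cart[of "f t - f t0" i] by (simp add: dist_norm)
        also have "\<dots> \<le> A * 2 powr (- \<gamma> * real m)"
          using osc[OF m(3) t(1) t0(1)] t(2) t0(2) by simp
        finally have "2 ^ m * \<bar>f t $ i - f t0 $ i\<bar> \<le> 2 ^ m * (A * 2 powr (- \<gamma> * real m))"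
          by (rule mult_left_mono) simp
        also have "\<dots> = x"
          by (simp add: x_def powr_add[symmetric] algebra_simps flip: powr_realpow)
        also have "\<dots> \<le> real_of_int (B - 1)"
          by (simp add: B_def)
        finally have "\<bar>2 ^ m * f t $ i - 2 ^ m * f t0 $ i\<bar> \<le> real_of_int (B - 1)"
          by (simp add: abs_mult right_diff_distrib[symmetric])
        then have "\<bar>\<lfloor>2 ^ m * f t $ i\<rfloor> - \<lfloor>2 ^ m * f t0 $ i\<rfloor>\<bar> \<le> B" by linarith
        then show ?thesis by (auto simp: D_def t(3) dyadic_index_def)
      qed
      have finD: "finite (D i)" and cardD: "card (D i) \<le> nat (2 * B + 1)" for i
        using B0 by (auto simp: D_def)
      have "finite (L j)" using mem finD cardD by (rule card_int_vec_box_le(1))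
      moreover have "card (L j) \<le> nat (2 * B + 1) ^ CARD('d)"
        using mem finD cardD by (rule card_int_vec_box_le(2))
      then have "real (card (L j)) \<le> real (nat (2 * B + 1)) ^ CARD('d)"
        by (metis of_nat_le_iff of_nat_power)
      moreover have "real (nat (2 * B + 1)) \<le> (2 * A + 5) * 2 powr ((1 - \<gamma>) * real m)"
      proof -
        have Bx: "real_of_int B \<le> x + 2"
          unfolding B_def of_int_add of_int_1 by (rule order_trans[OF add_right_mono[OF of_int_ceiling_le_add_one]]) simp
        have "real (nat (2 * B + 1)) = 2 * real_of_int B + 1" using B0 by simp
        also have "\<dots> \<le> 2 * x + 5 * 1"
          using Bx by simp
        also have "\<dots> \<le> 2 * x + 5 * 2 powr ((1 - \<gamma>) * real m)"
          using \<gamma> by (intro add_left_mono mult_left_mono ge_one_powr_ge_zero) auto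
        finally show ?thesis by (simp add: x_def algebra_simps)
      qed
      ultimately show ?thesis by (meson order_trans power_mono of_nat_0_le_iff)
    qed
    have "real (card I) = (\<Sum>j\<in>J. real (card (L j)))"
      unfolding I_def using J L by (subst card_SigmaI) auto
    also have "\<dots> \<le> (\<Sum>j\<in>J. ((2 * A + 5) * 2 powr ((1 - \<gamma>) * real m)) ^ CARD('d))"
      using L by (intro sum_mono) auto
    also have "\<dots> \<le> (2 ^ m) ^ CARD('n) * ((2 * A + 5) * 2 powr ((1 - \<gamma>) * real m)) ^ CARD('d)"
      using J A by (simp add: mult_right_mono)
    finally have "real (card I) * r powr s \<le>
        (2 ^ m) ^ CARD('n) * ((2 * A + 5) * 2 powr ((1 - \<gamma>) * real m)) ^ CARD('d) * r powr s"
      by (intro mult_right_mono) auto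
    also have "\<dots> = C * 2 powr ((real CARD('n) + real CARD('d) * (1 - \<gamma>) - s) * real m)"
    proof -
      have "((2 * A + 5) * 2 powr ((1 - \<gamma>) * real m)) ^ CARD('d) =
          (2 * A + 5) ^ CARD('d) * 2 powr (real CARD('d) * ((1 - \<gamma>) * real m))"
        using powr_power[of 2 "(1 - \<gamma>) * real m" "CARD('d)"] by (simp only: power_mult_distrib)
      moreover have "r powr s = (real CARD('n) + real CARD('d)) powr s * 2 powr (- real m * s)"
        by (simp only: r_def powr_mult powr_powr)
      moreover have "2 powr ((real CARD('n) + real CARD('d) * (1 - \<gamma>) - s) * real m) =
          2 powr (real CARD('n) * real m) * 2 powr (real CARD('d) * ((1 - \<gamma>) * real m)) * 2 powr (- real m * s)"
        by (simp add: powr_add[symmetric] algebra_simps)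
      ultimately show ?thesis unfolding two_power_powr C_def by (simp only: mult_ac)
    qed
    finally have "real (card I) * r powr s \<le> \<epsilon>" using m by simp
    moreover have "finite I" unfolding I_def using J L by auto
    moreover have "(\<lambda>t. (t, f t)) ` Q \<subseteq> (\<Union>i\<in>I. V i)"
      by (force simp: I_def J_def L_def V_def)
    moreover have "0 \<le> r" by (simp add: r_def)
    moreover have "\<forall>i\<in>I. \<forall>x\<in>V i. \<forall>y\<in>V i. dist x y \<le> r"
    proof (safe, goal_cases)
      case (1 j l a b c d)
      then have ac: "dyadic_index m a = dyadic_index m c" and bd: "dyadic_index m b = dyadic_index m d"
        by (auto simp: V_def)
      have "dist (a, b) (c, d) \<le> dist a c + dist b d" by (rule dist_Pair_le)
      also have "\<dots> \<le> real CARD('n) / 2 ^ m + real CARD('d) / 2 ^ m"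
        using norm_dyadic_cube_le[OF ac] norm_dyadic_cube_le[OF bd] by (simp add: dist_norm)
      also have "\<dots> = r"
        by (simp add: r_def powr_minus_divide powr_realpow add_divide_distrib)
      finally show ?case .
    qed
    ultimately show "\<exists>(V :: (int ^ 'n) \<times> (int ^ 'd) \<Rightarrow> _) I r. finite I \<and> (\<lambda>t. (t, f t)) ` dyadic_cube n k \<subseteq> (\<Union>i\<in>I. V i) \<and> 0 \<le> r \<and>
        (\<forall>i\<in>I. \<forall>x\<in>V i. \<forall>y\<in>V i. dist x y \<le> r) \<and> real (card I) * r powr s \<le> \<epsilon>"
      unfolding Q_def by (intro exI[of _ V] exI[of _ I] exI[of _ r] conjI)
  qed
qed

text \<open>A unit cube is the projection of the graph of a constant map over it, so the covering
  bound with \<open>\<gamma> = 1\<close> applies; countably many unit cubes fill the space.\<close>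

lemma hausdorff_dim_le_DIM:
  fixes E :: "(real ^ 'd) set"
  shows "hausdorff_dim E \<le> ereal (real CARD('d))"
proof (rule ereal_le_epsilon2)
  fix e :: real assume e: "e > 0"
  have "hnull (real CARD('d) + e) (dyadic_cube 0 k)" for k :: "int ^ 'd"
  proof -
    have "dyadic_holder_on (dyadic_cube 0 k) 1 (\<lambda>_. 0 :: real ^ 'd)"
      unfolding dyadic_holder_on_def by (intro exI[of _ 0]) simp
    then have "dyadic_holder_on (dyadic_cube 0 k) 1 (\<lambda>t. (t, 0 :: real ^ 'd))"
      by (rule dyadic_holder_on_graph) simp
    then have "hnull (real CARD('d) + e) ((\<lambda>t. (t, 0 :: real ^ 'd)) ` dyadic_cube 0 k)"
      using e by (intro hnull_dyadic_holder_image) auto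
    then have "hnull (real CARD('d) + e) (fst ` (\<lambda>t. (t, 0 :: real ^ 'd)) ` dyadic_cube 0 k)"
      using e by (intro hnull_image_contraction[where g = fst]) (auto simp: dist_fst_le)
    then show ?thesis by (simp add: image_image)
  qed
  then have "hnull (real CARD('d) + e) (\<Union>k. dyadic_cube 0 k :: (real ^ 'd) set)"
    by (intro hnull_countable_UN) auto
  then have "hnull (real CARD('d) + e) E"
    by (rule hnull_subset) (use mem_dyadic_cube in blast)
  then have "hausdorff_dim E \<le> ereal (real CARD('d) + e)"
    using e by (intro hausdorff_dim_le) auto
  then show "hausdorff_dim E \<le> ereal (real CARD('d)) + ereal e" by simp
qed

section \<open>Chaining\<close>

lemma dyadic_chaining:
  fixes f :: "real ^ 'n \<Rightarrow> 'b::real_normed_vector"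
  assumes q: "0 < q" "q < 1" and B: "0 \<le> B"
    and step: "\<And>m. n \<le> m \<Longrightarrow> norm (f (dyadic_floor (Suc m) t) - f (dyadic_floor m t)) \<le> B * q ^ m"
    and lim: "(\<lambda>m. f (dyadic_floor m t)) \<longlonglongrightarrow> f t"
  shows "norm (f t - f (dyadic_floor n t)) \<le> B / (1 - q) * q ^ n"
proof -
  \<comment> \<open>The factor \<open>1 - q ^ j\<close> is the exact partial geometric sum; without
    it the induction would not close.\<close>
  have *: "norm (f (dyadic_floor (n + j) t) - f (dyadic_floor n t)) \<le> B / (1 - q) * q ^ n * (1 - q ^ j)" for j
  proof (induction j)
    case (Suc j)
    have "norm (f (dyadic_floor (n + Suc j) t) - f (dyadic_floor n t)) \<le>
      norm (f (dyadic_floor (Suc (n + j)) t) - f (dyadic_floor (n + j) t)) +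
      norm (f (dyadic_floor (n + j) t) - f (dyadic_floor n t))"
      using norm_triangle_ineq[of "f (dyadic_floor (Suc (n + j)) t) - f (dyadic_floor (n + j) t)"
        "f (dyadic_floor (n + j) t) - f (dyadic_floor n t)"] by simp
    also have "\<dots> \<le> B * q ^ (n + j) + B / (1 - q) * q ^ n * (1 - q ^ j)"
      using step[of "n + j"] Suc by simp
    also have "\<dots> = B / (1 - q) * q ^ n * (1 - q ^ Suc j)"
      using q by (simp add: field_simps power_add)
    finally show ?case .
  qed simp
  have "norm (f (dyadic_floor (n + j) t) - f (dyadic_floor n t)) \<le> B / (1 - q) * q ^ n" for j
    using *[of j] mult_left_mono[of "1 - q ^ j" 1 "B / (1 - q) * q ^ n"] q B by simp
  moreover have "(\<lambda>j. norm (f (dyadic_floor (n + j) t) - f (dyadic_floor n t))) \<longlonglongrightarrow>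
      norm (f t - f (dyadic_floor n t))"
    using LIMSEQ_ignore_initial_segment[OF lim, of n]
    by (intro tendsto_intros) (simp add: add.commute)
  ultimately show ?thesis by (intro LIMSEQ_le_const2) auto
qed

context gaussian_field_space
begin

text \<open>Markov's inequality for a moment of order \<open>2 * k\<close> beats the number \<open>2 ^ (m * N)\<close> of dyadic
  increments of level \<open>m\<close> once \<open>2 * k * (\<beta> - \<gamma>) > N\<close>.\<close>

lemma AE_dyadic_increments:
  fixes n :: nat and k :: "int ^ 'n"
  defines "Q \<equiv> dyadic_cube n k"
  assumes Q: "Q \<subseteq> orthant" and C: "0 \<le> C"
    and msq: "\<And>s t. s \<in> Q \<Longrightarrow> t \<in> Q \<Longrightarrow> incr_msq s t \<le> C * norm (t - s) powr (2 * \<beta>)"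
    and \<gamma>: "0 < \<gamma>" "\<gamma> < \<beta>"
  shows "AE \<omega> in M. \<forall>\<^sub>F m in sequentially. \<forall>t\<in>Q.
    \<bar>X (dyadic_floor (Suc m) t) \<omega> $ i - X (dyadic_floor m t) \<omega> $ i\<bar> \<le> 2 powr (- \<gamma> * real m)"
proof -
  define N where "N = real CARD('n)"
  have "\<exists>p::nat. N / (2 * (\<beta> - \<gamma>)) < real p" by (rule reals_Archimedean2)
  then obtain p :: nat where p: "N < 2 * real p * (\<beta> - \<gamma>)"
    using \<gamma> by (auto simp: field_simps)
  define K where "K = 4 ^ p * (fact (2 * p) / (2 ^ p * fact p) + 1 :: real)"
  have K: "0 \<le> K" by (simp add: K_def)
  define q where "q m = (2::real) powr (- \<gamma> * real m)" for m :: nat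
  define P where "P m = (\<lambda>t. (dyadic_floor m t, dyadic_floor (Suc m) t)) ` Q" for m
  define E where "E = (\<lambda>m (u, v). {\<omega> \<in> space M. \<bar>X v \<omega> $ i - X u \<omega> $ i\<bar> \<ge> q m})"
  define A where "A m = (\<Union>z\<in>P m. E m z)" for m
  have PQ: "u \<in> Q" "v \<in> Q" "norm (v - u) \<le> N / 2 ^ m" if uv: "(u, v) \<in> P m" "n \<le> m" for u v m
  proof -
    obtain t where t: "t \<in> Q" "u = dyadic_floor m t" "v = dyadic_floor (Suc m) t"
      using uv(1) by (auto simp: P_def)
    then show "u \<in> Q" "v \<in> Q"
      using that(2) dyadic_floor_in_dyadic_cube[of n _ t k] by (auto simp: Q_def)
    have "dyadic_index m v = dyadic_index m u"
      unfolding t by (simp add: dyadic_index_dyadic_floor)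
    then show "norm (v - u) \<le> N / 2 ^ m" unfolding N_def by (rule norm_dyadic_cube_le)
  qed
  have cardP: "finite (P m) \<and> real (card (P m)) \<le> (2 ^ Suc m) ^ CARD('n)" if "n \<le> m" for m
  proof -
    have le: "n \<le> Suc m" using that by simp
    \<comment> \<open>The finer index determines both corners. So the pairs are an image of the
      finite set of indices at level \<open>Suc m\<close>, obtained by evaluating at an arbitrary
      representative.\<close>
    define h where "h j = (let t = (SOME t. t \<in> Q \<and> dyadic_index (Suc m) t = j)
      in (dyadic_floor m t, dyadic_floor (Suc m) t))" for j
    have "(dyadic_floor m t, dyadic_floor (Suc m) t) = h (dyadic_index (Suc m) t)" if "t \<in> Q" for t
    proof -
      define t' where "t' = (SOME t'. t' \<in> Q \<and> dyadic_index (Suc m) t' = dyadic_index (Suc m) t)"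
      have "t' \<in> Q \<and> dyadic_index (Suc m) t' = dyadic_index (Suc m) t"
        unfolding t'_def using that
          someI[of "\<lambda>t'. t' \<in> Q \<and> dyadic_index (Suc m) t' = dyadic_index (Suc m) t" t] by simp
      then have "dyadic_floor m t' = dyadic_floor m t" "dyadic_floor (Suc m) t' = dyadic_floor (Suc m) t"
        using dyadic_index_coarsen[of m "Suc m" t' t] by (auto intro!: dyadic_floor_cong)
      then show ?thesis by (simp add: h_def Let_def t'_def)
    qed
    then have "P m = h ` dyadic_index (Suc m) ` Q"
      unfolding P_def by (auto simp: image_image)
    then show ?thesis
      using card_dyadic_index_cube[OF le, of k] card_image_le[of "dyadic_index (Suc m) ` Q" h]
      unfolding Q_def by (simp, metis (mono_tags, lifting) of_nat_le_iff of_nat_mult of_nat_numeral of_nat_power order_trans power_Suc)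
  qed
  have E_sets: "E m z \<in> events" if "z \<in> P m" "n \<le> m" for m z
  proof -
    obtain u v where z: "z = (u, v)" by (cases z)
    then have "u \<in> orthant" "v \<in> orthant" using PQ that Q by blast+
    note [measurable] = this[THEN coordinate_measurable]
    show ?thesis unfolding E_def z by simp
  qed
  have prob_E: "prob (E m z) \<le> K * (C * (N / 2 ^ m) powr (2 * \<beta>)) ^ p / q m ^ (2 * p)"
    if z: "z \<in> P m" "n \<le> m" for m z
  proof -
    obtain u v where uv: "z = (u, v)" by (cases z)
    note uvQ = PQ[OF z(1)[unfolded uv] z(2)]
    then have o: "u \<in> orthant" "v \<in> orthant" using Q by blast+
    have "prob (E m z) \<le> K * incr_msq u v ^ p / q m ^ (2 * p)"
      using gaussian_rv_tail[OF gaussian_rv_increment[OF o], of "q m" i p]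
      by (simp add: uv E_def K_def q_def incr_msq[OF o])
    also have "\<dots> \<le> K * (C * (N / 2 ^ m) powr (2 * \<beta>)) ^ p / q m ^ (2 * p)"
    proof (intro divide_right_mono mult_left_mono power_mono K)
      have "incr_msq u v \<le> C * norm (v - u) powr (2 * \<beta>)" by (rule msq[OF uvQ(1,2)])
      also have "\<dots> \<le> C * (N / 2 ^ m) powr (2 * \<beta>)"
        using uvQ(3) \<gamma> C by (intro mult_left_mono powr_mono2) auto
      finally show "incr_msq u v \<le> C * (N / 2 ^ m) powr (2 * \<beta>)" .
    qed (auto simp: q_def incr_msq_def)
    finally show ?thesis .
  qed
  \<comment> \<open>Each level multiplies the number of increments by \<open>2 powr N\<close>, the
    moment bound by \<open>2 powr (- 2 * p * \<beta>)\<close> and the inverse of the threshold power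
    by \<open>2 powr (2 * p * \<gamma>)\<close>.\<close>
  define R where "R = (2::real) powr (N - 2 * real p * (\<beta> - \<gamma>))"
  have R: "0 < R" "R < 1" using p by (auto simp: R_def powr_less_one)
  define D where "D = 2 powr N * (K * (C * N powr (2 * \<beta>)) ^ p)"
  have A_sets: "A m \<in> events" if "n \<le> m" for m
    unfolding A_def using cardP[OF that] E_sets[OF _ that] by (intro sets.finite_UN) auto
  have prob_A: "prob (A m) \<le> D * R ^ m" if "n \<le> m" for m
  proof -
    have "prob (A m) \<le> (\<Sum>z\<in>P m. prob (E m z))"
      unfolding A_def using cardP[OF that] E_sets[OF _ that]
      by (intro finite_measure_subadditive_finite) auto
    also have "\<dots> \<le> (\<Sum>z\<in>P m. K * (C * (N / 2 ^ m) powr (2 * \<beta>)) ^ p / q m ^ (2 * p))"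
      using prob_E that by (intro sum_mono) auto
    also have "\<dots> \<le> (2 ^ Suc m) ^ CARD('n) * (K * (C * (N / 2 ^ m) powr (2 * \<beta>)) ^ p / q m ^ (2 * p))"
      using cardP[OF that] K C by (simp only: sum_constant) (intro mult_right_mono, auto simp: q_def)
    also have "\<dots> = D * R ^ m"
    proof -
      have "((2::real) ^ Suc m) ^ CARD('n) = 2 powr N * 2 powr (N * real m)"
        unfolding two_power_powr N_def by (simp add: powr_add[symmetric] algebra_simps)
      moreover have "(C * (N / 2 ^ m) powr (2 * \<beta>)) ^ p =
          (C * N powr (2 * \<beta>)) ^ p * 2 powr (- 2 * \<beta> * real m * real p)"
      proof -
        have "(N / 2 ^ m) powr (2 * \<beta>) = N powr (2 * \<beta>) * 2 powr (- 2 * \<beta> * real m)"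
          by (simp add: powr_divide powr_powr powr_minus_divide mult_ac flip: powr_realpow)
        then show ?thesis by (simp add: power_mult_distrib powr_power mult_ac)
      qed
      moreover have "q m ^ (2 * p) = 2 powr (- 2 * \<gamma> * real m * real p)"
        unfolding q_def by (simp add: powr_power mult_ac)
      moreover have "R ^ m = 2 powr (N * real m) * 2 powr (- 2 * \<beta> * real m * real p) /
          2 powr (- 2 * \<gamma> * real m * real p)"
        unfolding R_def by (simp add: powr_power powr_add[symmetric] powr_diff[symmetric] algebra_simps)
      ultimately show ?thesis by (simp add: D_def)
    qed
    finally show ?thesis .
  qed
  \<comment> \<open>The shift by \<open>n\<close> is needed because only corners of level at least
    \<open>n\<close> are known to stay in \<open>Q\<close>, where the field is measurable and the
    moment bound holds.\<close>
  have "AE \<omega> in M. \<forall>\<^sub>F m in sequentially. \<omega> \<in> space M - A (m + n)"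
  proof (rule borel_cantelli_AE1)
    show "summable (\<lambda>m. prob (A (m + n)))"
    proof (rule summable_comparison_test)
      show "\<exists>N. \<forall>m\<ge>N. norm (prob (A (m + n))) \<le> D * R ^ n * R ^ m"
        using prob_A[of "_ + n"] by (intro exI[of _ 0] allI impI) (simp add: power_add mult_ac)
      show "summable (\<lambda>m. D * R ^ n * R ^ m)"
        using R by (intro summable_mult summable_geometric) auto
    qed
  qed (auto intro: A_sets simp: less_top[symmetric])
  then show ?thesis
  proof eventually_elim
    case (elim \<omega>)
    then have "\<forall>\<^sub>F m in sequentially. \<omega> \<in> space M - A m"
      by (subst (asm) eventually_sequentially_seg)
    then show ?case
    proof eventually_elim
      case (elim m)
      show ?case
      proof
        fix t assume "t \<in> Q"
        then have "\<omega> \<notin> E m (dyadic_floor m t, dyadic_floor (Suc m) t)"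
          using elim by (auto simp: A_def P_def)
        then show "\<bar>X (dyadic_floor (Suc m) t) \<omega> $ i - X (dyadic_floor m t) \<omega> $ i\<bar> \<le> 2 powr (- \<gamma> * real m)"
          using elim by (simp add: E_def q_def)
      qed
    qed
  qed
qed

text \<open>Two points in one cube of level \<open>m\<close> share its lower corner, and each is
  chained to it, whence the factor 2. Continuity identifies the limit of the values along the
  corners with the value of the path.\<close>

lemma AE_dyadic_holder_on:
  fixes n :: nat and k :: "int ^ 'n"
  defines "Q \<equiv> dyadic_cube n k"
  assumes Q: "Q \<subseteq> orthant" and C: "0 \<le> C"
    and msq: "\<And>s t. s \<in> Q \<Longrightarrow> t \<in> Q \<Longrightarrow> incr_msq s t \<le> C * norm (t - s) powr (2 * \<beta>)"
    and \<gamma>: "0 < \<gamma>" "\<gamma> < \<beta>"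
    and cont: "AE \<omega> in M. continuous_on Q (\<lambda>t. X t \<omega>)"
  shows "AE \<omega> in M. dyadic_holder_on Q \<gamma> (\<lambda>t. X t \<omega>)"
proof -
  define q where "q = (2::real) powr (- \<gamma>)"
  have q: "0 < q" "q < 1" using \<gamma> by (auto simp: q_def powr_less_one)
  have qm: "2 powr (- \<gamma> * real m) = q ^ m" for m
    by (simp add: q_def powr_power mult_ac)
  define B where "B = real CARD('d) / (1 - q)"
  have "AE \<omega> in M. \<forall>i. \<forall>\<^sub>F m in sequentially. \<forall>t\<in>Q.
    \<bar>X (dyadic_floor (Suc m) t) \<omega> $ i - X (dyadic_floor m t) \<omega> $ i\<bar> \<le> 2 powr (- \<gamma> * real m)"
    unfolding AE_all_countable Q_def
    using Q C msq \<gamma> unfolding Q_def by (intro allI AE_dyadic_increments[where C = C and \<beta> = \<beta>]) auto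
  with cont show ?thesis
  proof eventually_elim
    case (elim \<omega>)
    \<comment> \<open>There are finitely many coordinates, so one starting level serves them
      all.\<close>
    have "\<forall>\<^sub>F m in sequentially. \<forall>i. \<forall>t\<in>Q.
        \<bar>X (dyadic_floor (Suc m) t) \<omega> $ i - X (dyadic_floor m t) \<omega> $ i\<bar> \<le> 2 powr (- \<gamma> * real m)"
      by (rule eventually_all_finite) (use elim(2) in blast)
    then obtain m1 where m1: "\<And>m i t. m \<ge> m1 \<Longrightarrow> t \<in> Q \<Longrightarrow>
        \<bar>X (dyadic_floor (Suc m) t) \<omega> $ i - X (dyadic_floor m t) \<omega> $ i\<bar> \<le> q ^ m"
      unfolding eventually_sequentially qm by blast
    have step: "norm (X (dyadic_floor (Suc m) t) \<omega> - X (dyadic_floor m t) \<omega>) \<le> real CARD('d) * q ^ m"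
      if "m \<ge> m1" "t \<in> Q" for m t
    proof -
      have "norm (X (dyadic_floor (Suc m) t) \<omega> - X (dyadic_floor m t) \<omega>) \<le>
          (\<Sum>i\<in>UNIV. \<bar>(X (dyadic_floor (Suc m) t) \<omega> - X (dyadic_floor m t) \<omega>) $ i\<bar>)"
        by (rule norm_le_l1_cart)
      also have "\<dots> \<le> (\<Sum>i\<in>(UNIV :: 'd set). q ^ m)"
        using m1[OF that] by (intro sum_mono) simp
      finally show ?thesis by simp
    qed
    have lim: "(\<lambda>m. X (dyadic_floor m t) \<omega>) \<longlonglongrightarrow> X t \<omega>" if "t \<in> Q" for t
    proof (rule continuous_on_tendsto_compose[OF elim(1) dyadic_floor_tendsto that])
      show "\<forall>\<^sub>F m in sequentially. dyadic_floor m t \<in> Q"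
        using that dyadic_floor_in_dyadic_cube[of n _ t k] unfolding Q_def
        by (intro eventually_sequentiallyI[of n]) auto
    qed
    have near: "norm (X t \<omega> - X (dyadic_floor m t) \<omega>) \<le> B * q ^ m" if "m \<ge> m1" "t \<in> Q" for m t
      unfolding B_def using q that step lim by (intro dyadic_chaining[where f = "\<lambda>t. X t \<omega>"]) auto
    have "dist (X s \<omega>) (X t \<omega>) \<le> 2 * B * 2 powr (- \<gamma> * real m)"
      if "m \<ge> m1" "s \<in> Q" "t \<in> Q" "dyadic_index m s = dyadic_index m t" for m s t
    proof -
      have "dist (X s \<omega>) (X t \<omega>) \<le> norm (X s \<omega> - X (dyadic_floor m s) \<omega>) + norm (X t \<omega> - X (dyadic_floor m t) \<omega>)"
        using dist_triangle2[of "X s \<omega>" "X t \<omega>" "X (dyadic_floor m s) \<omega>"] dyadic_floor_cong[OF that(4)]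
        by (simp add: dist_norm)
      also have "\<dots> \<le> B * q ^ m + B * q ^ m" using near that by (intro add_mono) auto
      finally show ?thesis unfolding qm by simp
    qed
    moreover have "0 \<le> 2 * B" using q by (simp add: B_def)
    ultimately show "dyadic_holder_on Q \<gamma> (\<lambda>t. X t \<omega>)"
      unfolding dyadic_holder_on_def by blast
  qed
qed

end

section \<open>Energy\<close>

text \<open>Shells: where \<open>v / 2 ^ (k+1) < D \<le> v / 2 ^ k\<close> the integrand is at most
  \<open>v powr (- s) * 2 powr (s * (k+1))\<close>, on a set of measure at most
  \<open>c * 2 powr (- m * k)\<close>. This gives a geometric series of ratio
  \<open>2 powr (s - m)\<close>; the summand 1 is the region \<open>D \<ge> v\<close>. The explicit
  scale \<open>v\<close> lets one bound serve all increments of the field.\<close>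

lemma nn_integral_inverse_powr_le:
  assumes D [measurable]: "D \<in> borel_measurable M" and D0: "\<And>x. x \<in> space M \<Longrightarrow> 0 \<le> D x"
    and s: "0 < s" "s < m" and v: "0 < v" and c: "0 \<le> c"
    and small: "\<And>r. 0 < r \<Longrightarrow> emeasure M {x \<in> space M. D x \<le> r} \<le> ennreal (c * (r / v) powr m)"
    and total: "emeasure M (space M) \<le> ennreal c"
  shows "(\<integral>\<^sup>+x. inverse (ennreal (D x powr s)) \<partial>M) \<le>
    ennreal (c * (1 + 2 powr s / (1 - 2 powr (s - m))) * v powr (- s))"
proof -
  define q where "q = (2::real) powr (s - m)"
  have q: "0 < q" "q < 1" using s by (auto simp: q_def powr_less_one)
  \<comment> \<open>On the zero set of \<open>D\<close> the integrand is infinite, so this set must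
    be null. The radius below makes the bound at most \<open>e\<close>; the denominator
    \<open>c + 1\<close> covers \<open>c = 0\<close>.\<close>
  have null: "emeasure M {x \<in> space M. D x \<le> 0} = 0"
  proof -
    have "emeasure M {x \<in> space M. D x \<le> 0} \<le> 0"
    proof (rule ennreal_le_epsilon)
      fix e :: real assume e: "0 < e"
      define r where "r = v * (e / (c + 1)) powr (1 / m)"
      have r: "0 < r" using v e c by (simp add: r_def)
      have "emeasure M {x \<in> space M. D x \<le> 0} \<le> emeasure M {x \<in> space M. D x \<le> r}"
        using r by (intro emeasure_mono) auto
      also have "\<dots> \<le> ennreal (c * (r / v) powr m)" by (rule small[OF r])
      also have "(r / v) powr m = e / (c + 1)"
        using v e c s by (simp add: r_def powr_powr)
      also have "c * (e / (c + 1)) \<le> e" using c e by (simp add: field_simps)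
      finally show "emeasure M {x \<in> space M. D x \<le> 0} \<le> 0 + ennreal e" by (simp add: ennreal_leI)
    qed
    then show ?thesis by simp
  qed
  have pos: "AE x in M. 0 < D x"
    using null by (intro AE_I[where N = "{x \<in> space M. D x \<le> 0}"]) auto
  define B where "B k = {x \<in> space M. D x \<le> v / 2 ^ k}" for k :: nat
  have [measurable]: "B k \<in> sets M" for k unfolding B_def by measurable
  define a where "a k = ennreal (2 powr (s * (real k + 1)))" for k :: nat
  have pw: "inverse (ennreal (D x powr s)) \<le> ennreal (v powr (- s)) * (1 + (\<Sum>k. a k * indicator (B k) x))"
    if x: "x \<in> space M" "0 < D x" for x
  proof (cases "v \<le> D x")
    case True
    then have "D x powr (- s) \<le> v powr (- s)" using v s by (intro powr_mono2') auto
    then have "inverse (ennreal (D x powr s)) \<le> ennreal (v powr (- s)) * 1"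
      using x by (simp add: inverse_ennreal powr_minus ennreal_leI)
    also have "\<dots> \<le> ennreal (v powr (- s)) * (1 + (\<Sum>k. a k * indicator (B k) x))"
      by (intro mult_left_mono) auto
    finally show ?thesis .
  next
    case False
    \<comment> \<open>The first index where \<open>P\<close> holds locates the shell containing
      \<open>D x\<close>; it is a successor because \<open>P 0\<close> fails.\<close>
    define P where "P n \<longleftrightarrow> (1 / 2) ^ n < D x / v" for n :: nat
    have "\<exists>n. P n" using real_arch_pow_inv[of "D x / v" "1 / 2"] x v by (simp add: P_def)
    moreover have "\<not> P 0" using False v by (simp add: P_def)
    ultimately obtain k where k: "\<not> P k" "P (Suc k)"
      using ex_least_nat_less[of P] by blast
    have "D x \<le> v / 2 ^ k" "v / 2 ^ Suc k < D x"
      using k v by (auto simp: P_def field_simps power_divide)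
    then have xB: "x \<in> B k" using x by (simp add: B_def)
    have "D x powr (- s) \<le> (v / 2 ^ Suc k) powr (- s)"
      using v s \<open>v / 2 ^ Suc k < D x\<close> by (intro powr_mono2') auto
    also have "\<dots> = v powr (- s) * 2 powr (s * (real k + 1))"
    proof -
      have "(2 ^ Suc k :: real) = 2 powr (real k + 1)" by (simp add: powr_add powr_realpow)
      then have "(v / 2 ^ Suc k) powr (- s) = v powr (- s) / (2 powr (real k + 1)) powr (- s)"
        by (simp only: powr_divide)
      also have "(2 powr (real k + 1)) powr (- s) = inverse (2 powr (s * (real k + 1)))"
      proof -
        have *: "(real k + 1) * - s = - (s * (real k + 1))" by (simp add: algebra_simps)
        show ?thesis unfolding powr_powr * by (rule powr_minus)
      qed
      finally show ?thesis by (simp only: divide_inverse inverse_inverse_eq)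
    qed
    finally have "inverse (ennreal (D x powr s)) \<le> ennreal (v powr (- s)) * a k"
      using x by (simp add: inverse_ennreal powr_minus ennreal_leI a_def ennreal_mult[symmetric])
    also have "a k = a k * indicator (B k) x" using xB by simp
    also have "\<dots> \<le> (\<Sum>k. a k * indicator (B k) x)"
      by (rule ennreal_le_suminf)
    also have "\<dots> \<le> 1 + (\<Sum>k. a k * indicator (B k) x)" by simp
    finally show ?thesis by (simp add: mult_left_mono)
  qed
  have "(\<integral>\<^sup>+x. inverse (ennreal (D x powr s)) \<partial>M) \<le>
      (\<integral>\<^sup>+x. ennreal (v powr (- s)) * (1 + (\<Sum>k. a k * indicator (B k) x)) \<partial>M)"
    using pos pw by (intro nn_integral_mono_AE) auto
  also have "\<dots> = ennreal (v powr (- s)) * (emeasure M (space M) + (\<Sum>k. a k * emeasure M (B k)))"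
    by (simp add: nn_integral_cmult nn_integral_add nn_integral_suminf nn_integral_cmult_indicator)
  also have "\<dots> \<le> ennreal (v powr (- s)) * (ennreal c + (\<Sum>k. ennreal (c * 2 powr s * q ^ k)))"
  proof (intro mult_left_mono add_mono total suminf_le)
    fix k
    have "emeasure M (B k) \<le> ennreal (c * (v / 2 ^ k / v) powr m)"
      unfolding B_def using v by (intro small) simp
    then have "a k * emeasure M (B k) \<le> a k * ennreal (c * (v / 2 ^ k / v) powr m)"
      by (intro mult_left_mono) auto
    also have "\<dots> = ennreal (2 powr (s * (real k + 1)) * (c * (v / 2 ^ k / v) powr m))"
      using c by (simp add: a_def ennreal_mult)
    also have "2 powr (s * (real k + 1)) * (c * (v / 2 ^ k / v) powr m) = c * 2 powr s * q ^ k"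
    proof -
      have "(v / 2 ^ k / v) powr m = (2 powr (- real k)) powr m"
        using v by (simp add: powr_minus_divide powr_realpow)
      moreover have "q ^ k = 2 powr (real k * (s - m))" by (simp add: q_def powr_power)
      ultimately show ?thesis
        by (simp add: powr_powr powr_add[symmetric] algebra_simps)
    qed
    finally show "a k * emeasure M (B k) \<le> ennreal (c * 2 powr s * q ^ k)" .
  qed auto
  also have "(\<Sum>k. ennreal (c * 2 powr s * q ^ k)) = ennreal (c * 2 powr s * (1 / (1 - q)))"
    using q c by (intro suminf_ennreal_eq sums_mult geometric_sums) auto
  also have "ennreal (v powr (- s)) * (ennreal c + ennreal (c * 2 powr s * (1 / (1 - q)))) =
      ennreal (c * (1 + 2 powr s / (1 - q)) * v powr (- s))"
  proof -
    have "0 \<le> c * 2 powr s * (1 / (1 - q))" using q c by simp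
    then have "ennreal (v powr (- s)) * (ennreal c + ennreal (c * 2 powr s * (1 / (1 - q)))) =
        ennreal (v powr (- s) * (c + c * 2 powr s * (1 / (1 - q))))"
      using c by (simp only: ennreal_plus[symmetric]) (simp add: ennreal_mult)
    then show ?thesis by (simp add: algebra_simps)
  qed
  finally show ?thesis unfolding q_def .
qed

lemma inverse_ennreal_antimono:
  assumes "a \<le> b"
  shows "inverse (ennreal b) \<le> inverse (ennreal a)"
proof (cases "0 < a")
  case True
  then show ?thesis using assms by (simp add: inverse_ennreal ennreal_leI le_imp_inverse_le)
qed (simp add: ennreal_neg)

text \<open>For \<open>a = 0\<close> the factor \<open>inverse a\<close> is infinite, so a finite
  \<open>K\<close> forces \<open>b = 0\<close>. This is the case of a covering set of diameter
  0.\<close>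

lemma ennreal_le_mult_of_inverse_mult_le:
  fixes a b K :: ennreal
  assumes "inverse a * b \<le> K" "a < top" "K < top"
  shows "b \<le> K * a"
proof (cases "a = 0")
  case True
  then show ?thesis using assms by (auto simp: ennreal_top_mult split: if_splits)
next
  case False
  then have "b = a * inverse a * b"
    using assms(2) by (simp add: ennreal_inverse_positive mult.commute ennreal_divide_self divide_ennreal_def[symmetric])
  also have "\<dots> = inverse a * b * a" by (simp add: mult_ac)
  also have "\<dots> \<le> K * a" using assms(1) by (intro mult_right_mono) auto
  finally show ?thesis .
qed

text \<open>Finite energy forces positive Hausdorff measure: on a set of positive measure the potential
  is bounded by some \<open>K\<close>, so the preimage of a set of diameter \<open>\<delta>\<close> that meets it has measure at
  most \<open>K * \<delta> powr s\<close>. Where \<open>dist (f t) (f u) = 0\<close> the kernel is \<open>inverse 0 = \<infinity>\<close>.\<close>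

lemma not_hnull_of_finite_energy:
  fixes f :: "'a \<Rightarrow> 'e::metric_space"
  assumes \<mu>: "sigma_finite_measure \<mu>" and pos: "emeasure \<mu> (space \<mu>) > 0"
    and f [measurable]: "f \<in> borel_measurable \<mu>" and s: "s > 0"
    and ker: "(\<lambda>(t, u). inverse (ennreal (dist (f t) (f u) powr s))) \<in> borel_measurable (\<mu> \<Otimes>\<^sub>M \<mu>)"
    and fin: "(\<integral>\<^sup>+(t, u). inverse (ennreal (dist (f t) (f u) powr s)) \<partial>(\<mu> \<Otimes>\<^sub>M \<mu>)) < \<infinity>"
  shows "\<not> hnull s (f ` space \<mu>)"
proof
  assume hn: "hnull s (f ` space \<mu>)"
  interpret sigma_finite_measure \<mu> by fact
  define \<phi> where "\<phi> t = (\<integral>\<^sup>+u. inverse (ennreal (dist (f t) (f u) powr s)) \<partial>\<mu>)" for t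
  have \<phi> [measurable]: "\<phi> \<in> borel_measurable \<mu>"
    using borel_measurable_nn_integral_fst[OF ker] by (simp add: \<phi>_def[abs_def])
  have "(\<integral>\<^sup>+t. \<phi> t \<partial>\<mu>) < \<infinity>"
    using fin nn_integral_fst[OF ker] by (simp add: \<phi>_def)
  then have AE_fin: "AE t in \<mu>. \<phi> t \<noteq> \<infinity>"
    by (intro nn_integral_PInf_AE) auto
  define A where "A n = {t \<in> space \<mu>. \<phi> t \<le> of_nat n}" for n :: nat
  have [measurable]: "A n \<in> sets \<mu>" for n unfolding A_def by measurable
  \<comment> \<open>The potential is finite almost everywhere, so the sets \<open>A n\<close>
    exhaust the space up to a null set; as the total mass is positive, one of them is not
    null.\<close>
  have "\<exists>n. emeasure \<mu> (A n) \<noteq> 0"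
  proof (rule ccontr)
    assume "\<not> ?thesis"
    then have "(\<Union>n. A n) \<in> null_sets \<mu>" by (intro null_sets_UN) auto
    then have "AE t in \<mu>. t \<notin> (\<Union>n. A n)" by (rule AE_not_in)
    with AE_fin AE_space have "AE t in \<mu>. False"
    proof eventually_elim
      case (elim t)
      then obtain n where "\<phi> t < of_nat n"
        using ennreal_Ex_less_of_nat[of "\<phi> t"] by (auto simp: less_top)
      then show ?case using elim by (auto simp: A_def dest: less_imp_le)
    qed
    then show False using pos by (simp add: AE_iff_null null_sets_def)
  qed
  then obtain n where n: "emeasure \<mu> (A n) \<noteq> 0" by blast
  \<comment> \<open>Covering sets are arbitrary and their preimages may fail to be measurable; the
    closure is Borel and has the same diameter.\<close>
  have meas_le: "emeasure \<mu> (A n \<inter> {t \<in> space \<mu>. f t \<in> closure U}) \<le> of_nat n * ennreal (diameter U powr s)"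
    if U: "bounded U" for U
  proof (cases "A n \<inter> {t \<in> space \<mu>. f t \<in> closure U} = {}")
    case False
    then obtain t where t: "t \<in> A n" "f t \<in> closure U" by blast
    define V where "V = {t \<in> space \<mu>. f t \<in> closure U}"
    have "V = f -` closure U \<inter> space \<mu>" by (auto simp: V_def)
    then have [measurable]: "V \<in> sets \<mu>" by simp
    have "inverse (ennreal (diameter U powr s)) * emeasure \<mu> V =
        (\<integral>\<^sup>+u. inverse (ennreal (diameter U powr s)) * indicator V u \<partial>\<mu>)"
      by (simp add: nn_integral_cmult_indicator)
    also have "\<dots> \<le> \<phi> t" unfolding \<phi>_def
    proof (intro nn_integral_mono)
      fix u assume "u \<in> space \<mu>"
      show "inverse (ennreal (diameter U powr s)) * indicator V u \<le> inverse (ennreal (dist (f t) (f u) powr s))"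
      proof (cases "u \<in> V")
        case True
        then have "dist (f t) (f u) \<le> diameter (closure U)"
          using t U by (intro diameter_bounded_bound) (auto simp: V_def)
        then have "dist (f t) (f u) powr s \<le> diameter U powr s"
          using s U by (intro powr_mono2) (auto simp: diameter_closure)
        then show ?thesis using True by (simp add: inverse_ennreal_antimono)
      qed simp
    qed
    also have "\<dots> \<le> of_nat n" using t by (simp add: A_def)
    finally have "emeasure \<mu> V \<le> of_nat n * ennreal (diameter U powr s)"
      by (rule ennreal_le_mult_of_inverse_mult_le) (auto simp: of_nat_less_top)
    moreover have "emeasure \<mu> (A n \<inter> V) \<le> emeasure \<mu> V" by (intro emeasure_mono) auto
    ultimately show ?thesis unfolding V_def by (rule order_trans[rotated])
  qed simp
  have "emeasure \<mu> (A n) \<le> 0"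
  proof (rule ennreal_le_epsilon)
    fix e :: real assume e: "0 < e"
    then have "0 < e / (real n + 1)" by simp
    then obtain U :: "nat \<Rightarrow> 'e set" where U: "f ` space \<mu> \<subseteq> (\<Union>i. U i)" "\<And>i. bounded (U i)"
      and le: "(\<Sum>i. ennreal (diameter (U i) powr s)) \<le> ennreal (e / (real n + 1))"
      using hn unfolding hnull_def by metis
    define V where "V i = A n \<inter> {t \<in> space \<mu>. f t \<in> closure (U i)}" for i
    have V: "V i \<in> sets \<mu>" for i
    proof -
      have "V i = A n \<inter> (f -` closure (U i) \<inter> space \<mu>)" by (auto simp: V_def)
      then show ?thesis by simp
    qed
    have "A n \<subseteq> (\<Union>i. V i)"
    proof
      fix t assume t: "t \<in> A n"
      then have "t \<in> space \<mu>" by (simp add: A_def)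
      then obtain i where "f t \<in> U i" using U(1) by blast
      then show "t \<in> (\<Union>i. V i)"
        using t \<open>t \<in> space \<mu>\<close> closure_subset[of "U i"] unfolding V_def by blast
    qed
    then have "emeasure \<mu> (A n) \<le> emeasure \<mu> (\<Union>i. V i)" using V by (intro emeasure_mono) auto
    also have "\<dots> \<le> (\<Sum>i. emeasure \<mu> (V i))" using V by (intro emeasure_subadditive_countably) auto
    also have "\<dots> \<le> (\<Sum>i. of_nat n * ennreal (diameter (U i) powr s))"
      unfolding V_def using meas_le U(2) by (intro suminf_le) auto
    also have "\<dots> = of_nat n * (\<Sum>i. ennreal (diameter (U i) powr s))"
      by (rule ennreal_suminf_cmult)
    also have "\<dots> \<le> of_nat n * ennreal (e / (real n + 1))" using le by (intro mult_left_mono) auto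
    also have "\<dots> = ennreal (real n * (e / (real n + 1)))"
      using e unfolding ennreal_of_nat_eq_real_of_nat by (intro ennreal_mult[symmetric]) auto
    also have "\<dots> \<le> ennreal e" using e by (intro ennreal_leI) (simp add: field_simps)
    finally show "emeasure \<mu> (A n) \<le> 0 + ennreal e" by simp
  qed
  then show False using n by simp
qed

text \<open>The volume of a ball has order \<open>r ^ N\<close>, so a singularity of order below
  \<open>N\<close> is integrable. Uniformity in \<open>t\<close> is what bounds the double integral
  over the cube.\<close>

lemma nn_integral_inverse_norm_powr_le:
  fixes n :: nat and k :: "int ^ 'n"
  defines "\<mu> \<equiv> restrict_space lborel (dyadic_cube n k)"
  assumes p: "0 < p" "p < real CARD('n)"
  obtains K where "0 \<le> K" "\<And>t :: real ^ 'n. (\<integral>\<^sup>+u. inverse (ennreal (norm (t - u) powr p)) \<partial>\<mu>) \<le> ennreal K"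
proof -
  define L where "L = measure lborel (dyadic_cube n k)"
  have L: "emeasure lborel (dyadic_cube n k) = ennreal L"
    unfolding L_def using emeasure_dyadic_cube(2)[of n k] by (intro emeasure_eq_ennreal_measure) auto
  \<comment> \<open>One constant for both requirements: the total mass, and the volume
    \<open>(2 * r) ^ N\<close> of a box around a ball.\<close>
  define c where "c = max L (2 ^ CARD('n))"
  have sp: "space \<mu> = dyadic_cube n k" by (simp add: \<mu>_def space_restrict_space)
  have small: "emeasure \<mu> {u \<in> space \<mu>. norm (t - u) \<le> r} \<le> ennreal (c * (r / 1) powr real CARD('n))"
    if r: "0 < r" for r and t :: "real ^ 'n"
  proof -
    define a where "a = ((\<chi> i. r) :: real ^ 'n)"
    have sub: "{u \<in> space \<mu>. norm (t - u) \<le> r} \<subseteq> cbox (t - a) (t + a)"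
    proof safe
      fix u assume "norm (t - u) \<le> r"
      then have "\<bar>(t - u) $ i\<bar> \<le> r" for i using component_le_norm_cart[of "t - u" i] by linarith
      then show "u \<in> cbox (t - a) (t + a)"
        by (auto simp: mem_box_cart a_def abs_le_iff algebra_simps)
    qed
    have "emeasure \<mu> {u \<in> space \<mu>. norm (t - u) \<le> r} = emeasure lborel {u \<in> space \<mu>. norm (t - u) \<le> r}"
      unfolding \<mu>_def by (intro emeasure_restrict_space) (auto simp: space_restrict_space)
    also have "\<dots> \<le> emeasure lborel (cbox (t - a) (t + a))"
      using sub by (intro emeasure_mono) auto
    also have "\<dots> = (\<Prod>b\<in>Basis. ((t + a) - (t - a)) \<bullet> b)"
      using r by (intro emeasure_lborel_cbox) (auto simp: a_def Basis_vec_def inner_axis)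
    also have "(\<Prod>b\<in>Basis. ((t + a) - (t - a)) \<bullet> b) = (\<Prod>b\<in>(Basis :: (real ^ 'n) set). 2 * r)"
      by (intro prod.cong) (auto simp: a_def Basis_vec_def inner_axis)
    also have "\<dots> = 2 ^ CARD('n) * r powr real CARD('n)"
      using r by (simp add: power_mult_distrib powr_realpow)
    also have "ennreal \<dots> \<le> ennreal (c * (r / 1) powr real CARD('n))"
      by (intro ennreal_leI) (simp add: c_def mult_right_mono)
    finally show ?thesis .
  qed
  define K where "K = c * (1 + 2 powr p / (1 - 2 powr (p - real CARD('n)))) * 1 powr (- p)"
  have "2 powr (p - real CARD('n)) < 1" using p by (simp add: powr_less_one)
  then have "0 \<le> K" by (simp add: K_def c_def le_max_iff_disj)
  moreover have "(\<integral>\<^sup>+u. inverse (ennreal (norm (t - u) powr p)) \<partial>\<mu>) \<le> ennreal K" for t :: "real ^ 'n"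
    unfolding K_def
  proof (rule nn_integral_inverse_powr_le[OF _ _ p _ _ small])
    show "(\<lambda>u. norm (t - u)) \<in> borel_measurable \<mu>"
      unfolding \<mu>_def by (intro measurable_restrict_space1) simp
    have "emeasure \<mu> (space \<mu>) = ennreal L"
      unfolding sp L[symmetric] unfolding \<mu>_def by (intro emeasure_restrict_space) auto
    then show "emeasure \<mu> (space \<mu>) \<le> ennreal c" by (simp add: c_def ennreal_leI)
  qed (auto simp: c_def le_max_iff_disj)
  ultimately show thesis by (rule that)
qed

section \<open>Expected energy of range and graph over a cube\<close>

context gaussian_field_space
begin

text \<open>The small-ball exponent is \<open>d\<close>, so orders below \<open>d\<close> are
  integrable; at \<open>d\<close> the geometric series would have ratio 1. The constant is the same
  for all pairs of times, which enter only through the scale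
  \<open>sqrt (incr_msq u t)\<close>.\<close>

lemma field_negative_moment:
  assumes s: "0 < s" "s < real CARD('d)"
  obtains K where "0 < K"
    "\<And>t u. t \<in> orthant \<Longrightarrow> u \<in> orthant \<Longrightarrow> 0 < incr_msq u t \<Longrightarrow>
      (\<integral>\<^sup>+\<omega>. inverse (ennreal (norm (X t \<omega> - X u \<omega>) powr s)) \<partial>M) \<le> ennreal (K * sqrt (incr_msq u t) powr (- s))"
proof
  define c where "c = (10::real) ^ CARD('d)"
  have c: "1 \<le> c" by (simp add: c_def)
  define K where "K = c * (1 + 2 powr s / (1 - 2 powr (s - real CARD('d))))"
  have "2 powr (s - real CARD('d)) < 1" using s by (simp add: powr_less_one)
  then show "0 < K" using c unfolding K_def by (intro mult_pos_pos add_pos_nonneg) auto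
  fix t u assume tu: "t \<in> orthant" "u \<in> orthant" "0 < incr_msq u t"
  note [measurable] = field_measurable[OF tu(1)] field_measurable[OF tu(2)]
  show "(\<integral>\<^sup>+\<omega>. inverse (ennreal (norm (X t \<omega> - X u \<omega>) powr s)) \<partial>M) \<le> ennreal (K * sqrt (incr_msq u t) powr (- s))"
    unfolding K_def
  proof (rule nn_integral_inverse_powr_le[OF _ _ s])
    fix r :: real assume r: "0 < r"
    have "emeasure M {\<omega> \<in> space M. norm (X t \<omega> - X u \<omega>) \<le> r} =
        ennreal (prob {\<omega> \<in> space M. norm (X t \<omega> - X u \<omega>) \<le> r})"
      by (simp add: emeasure_eq_measure)
    also have "\<dots> \<le> ennreal ((10 * r / sqrt (incr_msq u t)) ^ CARD('d))"
      by (intro ennreal_leI field_small_ball tu r)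
    also have "(10 * r / sqrt (incr_msq u t)) ^ CARD('d) = c * (r / sqrt (incr_msq u t)) powr real CARD('d)"
      using r tu by (simp add: c_def powr_realpow power_mult_distrib power_divide)
    finally show "emeasure M {\<omega> \<in> space M. norm (X t \<omega> - X u \<omega>) \<le> r} \<le>
      ennreal (c * (r / sqrt (incr_msq u t)) powr real CARD('d))" .
  qed (use tu c in \<open>auto simp: emeasure_space_1 ennreal_1[symmetric] simp del: ennreal_1 intro!: ennreal_leI\<close>)
qed

text \<open>\<open>G\<close> will be the identity (for the graph) or the projection \<open>snd\<close> (for the range). Splitting the
  kernel of order \<open>s\<close> into orders \<open>e < d\<close> in space and \<open>s - e\<close> in time keeps the negative
  moment of the Gaussian increment finite.\<close>

lemma AE_not_hnull_image:
  fixes n :: nat and k :: "int ^ 'n" and G :: "(real ^ 'n) \<times> (real ^ 'd) \<Rightarrow> 'e::{metric_space, second_countable_topology}"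
  defines "Q \<equiv> dyadic_cube n k"
  assumes Q: "Q \<subseteq> orthant" and \<beta>: "0 < \<beta>"
    and msq: "\<And>s t. s \<in> Q \<Longrightarrow> t \<in> Q \<Longrightarrow> s \<noteq> t \<Longrightarrow> norm (t - s) powr (2 * \<beta>) \<le> incr_msq s t"
    and cont: "AE \<omega> in M. continuous_on Q (\<lambda>t. X t \<omega>)"
    and e: "0 < e" "e < real CARD('d)" "e \<le> s" "s - e * (1 - \<beta>) < real CARD('n)"
    and G: "G \<in> borel_measurable borel"
    and dG: "\<And>t u x y. norm (x - y) powr e * norm (t - u) powr (s - e) \<le> dist (G (t, x)) (G (u, y)) powr s"
  shows "AE \<omega> in M. \<not> hnull s ((\<lambda>t. G (t, X t \<omega>)) ` Q)"
proof -
  \<comment> \<open>The order of the kernel left in time after taking expectations: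
    \<open>s - e\<close> was kept there, and the moment of order \<open>- e\<close> of an increment
    over distance \<open>h\<close> is at most of order \<open>h powr (- \<beta> * e)\<close>. The
    hypothesis on \<open>s\<close> says \<open>p < N\<close>.\<close>
  define p where "p = s - e + \<beta> * e"
  have "0 < \<beta> * e" using e \<beta> by simp
  then have p: "0 < p" "p < real CARD('n)" using e by (auto simp: p_def algebra_simps)
  define \<mu> where "\<mu> = restrict_space lborel Q"
  have sp: "space \<mu> = Q" by (simp add: \<mu>_def space_restrict_space)
  have fin\<mu>: "emeasure \<mu> (space \<mu>) < \<infinity>" and pos\<mu>: "0 < emeasure \<mu> (space \<mu>)"
  proof -
    have "emeasure \<mu> (space \<mu>) = emeasure lborel Q"
      unfolding sp unfolding \<mu>_def Q_def by (intro emeasure_restrict_space) auto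
    then show "emeasure \<mu> (space \<mu>) < \<infinity>" "0 < emeasure \<mu> (space \<mu>)"
      unfolding Q_def using emeasure_dyadic_cube[of n k] by auto
  qed
  interpret \<mu>: finite_measure \<mu> using fin\<mu> by (intro finite_measureI) auto
  interpret \<mu>\<mu>: pair_sigma_finite \<mu> \<mu> by standard
  have idm: "(\<lambda>t. t) \<in> \<mu> \<rightarrow>\<^sub>M borel" unfolding \<mu>_def by (intro measurable_restrict_space1) simp
  obtain Z where Z: "Z \<in> null_sets M" and contZ: "\<And>\<omega>. \<omega> \<in> space M - Z \<Longrightarrow> continuous_on Q (\<lambda>t. X t \<omega>)"
    using cont by (auto elim!: AE_E3)
  then have [measurable]: "Z \<in> sets M" by auto
  have AE_Z: "AE \<omega> in M. \<omega> \<notin> Z" using Z by (rule AE_not_in)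
  define Y where "Y t \<omega> = (if \<omega> \<in> Z then 0 else X t \<omega>)" for t \<omega>
  \<comment> \<open>Joint measurability: off the null set \<open>Z\<close> the field is the limit of
    its values at dyadic corners, which as functions of time are constant on cubes.\<close>
  have Y: "(\<lambda>(t, \<omega>). Y t \<omega>) \<in> borel_measurable (\<mu> \<Otimes>\<^sub>M M)"
  proof -
    define pt where "pt m j = ((\<chi> i. of_int (j $ i) / 2 ^ m) :: real ^ 'n)" for m and j :: "int ^ 'n"
    have pt: "pt m (dyadic_index m t) = dyadic_floor m t" for m t
      by (simp add: pt_def dyadic_index_def dyadic_floor_def)
    \<comment> \<open>Measurability is needed for every integer vector \<open>j\<close>, also when
      its corner lies outside the orthant, where nothing is known about \<open>X\<close>; hence the
      default 0.\<close>
    define g where "g m j \<omega> = (if \<omega> \<in> Z \<or> pt m j \<notin> orthant then 0 else X (pt m j) \<omega>)" for m j \<omega>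
    have g: "g m j \<in> borel_measurable M" for m j
      using field_measurable[of "pt m j"] unfolding g_def[abs_def] by (cases "pt m j \<in> orthant") auto
    have "(\<lambda>z. g m (dyadic_index m (fst z)) (snd z)) \<in> borel_measurable (\<mu> \<Otimes>\<^sub>M M)" for m
    proof (rule measurable_compose_countable)
      show "(\<lambda>z. g m j (snd z)) \<in> borel_measurable (\<mu> \<Otimes>\<^sub>M M)" for j
        by (rule measurable_compose[OF measurable_snd g])
      show "(\<lambda>z. dyadic_index m (fst z)) \<in> \<mu> \<Otimes>\<^sub>M M \<rightarrow>\<^sub>M count_space UNIV"
        by (rule measurable_compose[OF measurable_compose[OF measurable_fst idm] dyadic_index_measurable])
    qed
    then show ?thesis
    proof (rule borel_measurable_LIMSEQ_metric)
      fix z assume "z \<in> space (\<mu> \<Otimes>\<^sub>M M)"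
      then obtain t \<omega> where z: "z = (t, \<omega>)" "t \<in> Q" "\<omega> \<in> space M" by (auto simp: space_pair_measure sp)
      have ev: "\<forall>\<^sub>F m in sequentially. dyadic_floor m t \<in> Q"
        using dyadic_floor_in_dyadic_cube[of n _ t k] z(2) unfolding Q_def
        by (intro eventually_sequentiallyI[of n]) auto
      show "(\<lambda>m. g m (dyadic_index m (fst z)) (snd z)) \<longlonglongrightarrow> (case z of (t, \<omega>) \<Rightarrow> Y t \<omega>)"
      proof (cases "\<omega> \<in> Z")
        case True
        then show ?thesis by (simp add: z g_def Y_def)
      next
        case False
        then have "continuous_on Q (\<lambda>t. X t \<omega>)" using contZ z by simp
        then have "(\<lambda>m. X (dyadic_floor m t) \<omega>) \<longlonglongrightarrow> X t \<omega>"
          by (rule continuous_on_tendsto_compose[OF _ dyadic_floor_tendsto z(2) ev])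
        moreover have "\<forall>\<^sub>F m in sequentially. X (dyadic_floor m t) \<omega> = g m (dyadic_index m (fst z)) (snd z)"
          using ev by eventually_elim (use False Q in \<open>auto simp: z g_def pt\<close>)
        ultimately have "(\<lambda>m. g m (dyadic_index m (fst z)) (snd z)) \<longlonglongrightarrow> X t \<omega>"
          by (rule Lim_transform_eventually)
        then show ?thesis using False by (simp add: z Y_def)
      qed
    qed
  qed
  define H where "H t \<omega> = G (t, Y t \<omega>)" for t \<omega>
  have H: "(\<lambda>z. H (fst z) (snd z)) \<in> borel_measurable (\<mu> \<Otimes>\<^sub>M M)"
  proof -
    have "(\<lambda>z. (fst z, Y (fst z) (snd z))) \<in> \<mu> \<Otimes>\<^sub>M M \<rightarrow>\<^sub>M borel \<Otimes>\<^sub>M borel"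
      using measurable_compose[OF measurable_fst idm] Y by (intro measurable_Pair) (auto simp: case_prod_beta)
    then show ?thesis
      unfolding H_def using G by (simp add: borel_prod measurable_compose[OF _ G])
  qed
  define \<kappa> where "\<kappa> z \<omega> = inverse (ennreal (dist (H (fst z) \<omega>) (H (snd z) \<omega>) powr s))" for z \<omega>
  have \<kappa>: "(\<lambda>(z, \<omega>). \<kappa> z \<omega>) \<in> borel_measurable ((\<mu> \<Otimes>\<^sub>M \<mu>) \<Otimes>\<^sub>M M)"
  proof -
    have "(\<lambda>x. H (fst (fst x)) (snd x)) \<in> borel_measurable ((\<mu> \<Otimes>\<^sub>M \<mu>) \<Otimes>\<^sub>M M)"
      using measurable_compose[OF _ H, of "\<lambda>x. (fst (fst x), snd x)" "(\<mu> \<Otimes>\<^sub>M \<mu>) \<Otimes>\<^sub>M M"] by simp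
    moreover have "(\<lambda>x. H (snd (fst x)) (snd x)) \<in> borel_measurable ((\<mu> \<Otimes>\<^sub>M \<mu>) \<Otimes>\<^sub>M M)"
      using measurable_compose[OF _ H, of "\<lambda>x. (snd (fst x), snd x)" "(\<mu> \<Otimes>\<^sub>M \<mu>) \<Otimes>\<^sub>M M"] by simp
    ultimately show ?thesis unfolding \<kappa>_def case_prod_beta by measurable
  qed
  obtain K1 where K1: "0 < K1" "\<And>t u. t \<in> orthant \<Longrightarrow> u \<in> orthant \<Longrightarrow> 0 < incr_msq u t \<Longrightarrow>
      (\<integral>\<^sup>+\<omega>. inverse (ennreal (norm (X t \<omega> - X u \<omega>) powr e)) \<partial>M) \<le> ennreal (K1 * sqrt (incr_msq u t) powr (- e))"
    using field_negative_moment[OF e(1,2)] by blast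
  have E\<kappa>: "(\<integral>\<^sup>+\<omega>. \<kappa> (t, u) \<omega> \<partial>M) \<le> ennreal K1 * inverse (ennreal (norm (t - u) powr p))"
    if "t \<in> Q" "u \<in> Q" for t u
  proof (cases "t = u")
    \<comment> \<open>On the diagonal the right-hand side is infinite, since the norm vanishes,
      \<open>inverse 0 = \<infinity>\<close> and \<open>K1 > 0\<close>.\<close>
    case True
    then show ?thesis using K1(1) by (simp add: ennreal_mult_top)
  next
    case False
    define h where "h = norm (t - u)"
    have h: "0 < h" using False by (simp add: h_def)
    have o: "t \<in> orthant" "u \<in> orthant" using that Q by auto
    note [measurable] = field_measurable[OF o(1)] field_measurable[OF o(2)]
    have v: "h powr (2 * \<beta>) \<le> incr_msq u t" using msq[of u t] that False by (simp add: h_def)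
    then have v0: "0 < incr_msq u t" using h by (smt (verit) powr_gt_zero)
    have "h powr \<beta> = sqrt (h powr (2 * \<beta>))"
      using h by (simp add: powr_half_sqrt[symmetric] powr_powr)
    then have hv: "h powr \<beta> \<le> sqrt (incr_msq u t)" using v by simp
    have "AE \<omega> in M. \<kappa> (t, u) \<omega> \<le> ennreal (h powr (e - s)) * inverse (ennreal (norm (X t \<omega> - X u \<omega>) powr e))"
      using AE_Z
    proof eventually_elim
      case (elim \<omega>)
      have "\<kappa> (t, u) \<omega> = inverse (ennreal (dist (G (t, X t \<omega>)) (G (u, X u \<omega>)) powr s))"
        using elim by (simp add: \<kappa>_def H_def Y_def)
      also have "\<dots> \<le> inverse (ennreal (norm (X t \<omega> - X u \<omega>) powr e * h powr (s - e)))"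
        unfolding h_def by (intro inverse_ennreal_antimono dG)
      also have "\<dots> = inverse (ennreal (norm (X t \<omega> - X u \<omega>) powr e)) * inverse (ennreal (h powr (s - e)))"
        by (simp add: ennreal_mult ennreal_inverse_mult)
      also have "inverse (ennreal (h powr (s - e))) = ennreal (h powr (e - s))"
        using h powr_minus[of h "s - e"] by (simp add: inverse_ennreal)
      finally show ?case by (simp add: mult.commute)
    qed
    then have "(\<integral>\<^sup>+\<omega>. \<kappa> (t, u) \<omega> \<partial>M) \<le>
        (\<integral>\<^sup>+\<omega>. ennreal (h powr (e - s)) * inverse (ennreal (norm (X t \<omega> - X u \<omega>) powr e)) \<partial>M)"
      by (rule nn_integral_mono_AE)
    also have "\<dots> = ennreal (h powr (e - s)) * (\<integral>\<^sup>+\<omega>. inverse (ennreal (norm (X t \<omega> - X u \<omega>) powr e)) \<partial>M)"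
      by (intro nn_integral_cmult) measurable
    also have "\<dots> \<le> ennreal (h powr (e - s)) * ennreal (K1 * sqrt (incr_msq u t) powr (- e))"
      using K1(2)[OF o v0] by (intro mult_left_mono) auto
    also have "\<dots> \<le> ennreal (h powr (e - s)) * ennreal (K1 * (h powr \<beta>) powr (- e))"
      using hv h K1(1) e by (intro mult_left_mono ennreal_leI powr_mono2') auto
    also have "\<dots> = ennreal (K1 * h powr (- p))"
      using K1(1) by (simp add: ennreal_mult[symmetric] powr_powr powr_add[symmetric] p_def mult_ac)
    also have "\<dots> = ennreal K1 * inverse (ennreal (h powr p))"
      using h K1(1) by (simp add: inverse_ennreal ennreal_mult powr_minus)
    finally show ?thesis by (simp add: h_def)
  qed
  obtain K2 where K2: "0 \<le> K2" "\<And>t :: real ^ 'n. (\<integral>\<^sup>+u. inverse (ennreal (norm (t - u) powr p)) \<partial>\<mu>) \<le> ennreal K2"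
    unfolding \<mu>_def Q_def using nn_integral_inverse_norm_powr_le[OF p, of n k] by blast
  \<comment> \<open>Tonelli: the expected energy is computed by averaging the kernel over \<omega>
    first, and its finiteness makes the energy of almost every path finite.\<close>
  have "(\<integral>\<^sup>+\<omega>. (\<integral>\<^sup>+z. \<kappa> z \<omega> \<partial>(\<mu> \<Otimes>\<^sub>M \<mu>)) \<partial>M) = (\<integral>\<^sup>+z. (\<integral>\<^sup>+\<omega>. \<kappa> z \<omega> \<partial>M) \<partial>(\<mu> \<Otimes>\<^sub>M \<mu>))"
  proof -
    interpret P: pair_sigma_finite "\<mu> \<Otimes>\<^sub>M \<mu>" M
      by (intro pair_sigma_finite.intro) (simp_all add: \<mu>\<mu>.sigma_finite_measure_axioms sigma_finite_measure_axioms)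
    show ?thesis by (rule P.Fubini'[OF \<kappa>])
  qed
  also have "\<dots> \<le> (\<integral>\<^sup>+z. ennreal K1 * inverse (ennreal (norm (fst z - snd z) powr p)) \<partial>(\<mu> \<Otimes>\<^sub>M \<mu>))"
    using E\<kappa> by (intro nn_integral_mono) (auto simp: space_pair_measure sp)
  also have "\<dots> = (\<integral>\<^sup>+t. (\<integral>\<^sup>+u. ennreal K1 * inverse (ennreal (norm (t - u) powr p)) \<partial>\<mu>) \<partial>\<mu>)"
  proof -
    have "(\<lambda>z. norm (fst z - snd z)) \<in> borel_measurable (\<mu> \<Otimes>\<^sub>M \<mu>)"
      by (rule measurable_compose[OF borel_measurable_diff[OF measurable_compose[OF measurable_fst idm]
            measurable_compose[OF measurable_snd idm]] borel_measurable_norm])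
    then have "(\<lambda>z. ennreal K1 * inverse (ennreal (norm (fst z - snd z) powr p))) \<in> borel_measurable (\<mu> \<Otimes>\<^sub>M \<mu>)"
      by measurable
    from \<mu>.nn_integral_fst[OF this] show ?thesis by simp
  qed
  also have "\<dots> \<le> (\<integral>\<^sup>+t. ennreal (K1 * K2) \<partial>\<mu>)"
  proof (intro nn_integral_mono)
    fix t
    have "(\<lambda>u. norm (t - u)) \<in> borel_measurable \<mu>"
      by (rule measurable_compose[OF borel_measurable_diff[OF borel_measurable_const idm] borel_measurable_norm])
    then have "(\<lambda>u. inverse (ennreal (norm (t - u) powr p))) \<in> borel_measurable \<mu>" by measurable
    then have "(\<integral>\<^sup>+u. ennreal K1 * inverse (ennreal (norm (t - u) powr p)) \<partial>\<mu>) =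
        ennreal K1 * (\<integral>\<^sup>+u. inverse (ennreal (norm (t - u) powr p)) \<partial>\<mu>)"
      by (rule nn_integral_cmult)
    also have "\<dots> \<le> ennreal K1 * ennreal K2" by (intro mult_left_mono K2) auto
    finally show "(\<integral>\<^sup>+u. ennreal K1 * inverse (ennreal (norm (t - u) powr p)) \<partial>\<mu>) \<le> ennreal (K1 * K2)"
      using K1(1) K2(1) by (simp add: ennreal_mult)
  qed
  also have "\<dots> < \<infinity>" using fin\<mu> by (simp add: ennreal_mult_less_top)
  finally have fin: "(\<integral>\<^sup>+\<omega>. (\<integral>\<^sup>+z. \<kappa> z \<omega> \<partial>(\<mu> \<Otimes>\<^sub>M \<mu>)) \<partial>M) < \<infinity>" .
  have "(\<lambda>\<omega>. \<integral>\<^sup>+z. \<kappa> z \<omega> \<partial>(\<mu> \<Otimes>\<^sub>M \<mu>)) \<in> borel_measurable M"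
  proof -
    have "(\<lambda>(\<omega>, z). \<kappa> z \<omega>) \<in> borel_measurable (M \<Otimes>\<^sub>M (\<mu> \<Otimes>\<^sub>M \<mu>))"
      using \<kappa> by (subst measurable_split_conv) (simp add: measurable_pair_swap_iff[of _ M])
    then show ?thesis by (rule \<mu>\<mu>.borel_measurable_nn_integral)
  qed
  then have "AE \<omega> in M. (\<integral>\<^sup>+z. \<kappa> z \<omega> \<partial>(\<mu> \<Otimes>\<^sub>M \<mu>)) \<noteq> \<infinity>"
    using fin by (intro nn_integral_PInf_AE) auto
  with AE_Z AE_space show ?thesis
  proof eventually_elim
    case (elim \<omega>)
    have "\<not> hnull s ((\<lambda>t. H t \<omega>) ` space \<mu>)"
    proof (rule not_hnull_of_finite_energy)
      show "sigma_finite_measure \<mu>" "0 < emeasure \<mu> (space \<mu>)" "0 < s"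
        using pos\<mu> e by (auto simp: \<mu>.sigma_finite_measure_axioms)
      show m: "(\<lambda>t. H t \<omega>) \<in> borel_measurable \<mu>"
        using measurable_compose[OF measurable_Pair2'[OF elim(2)] H] by simp
      show "(\<lambda>(t, u). inverse (ennreal (dist (H t \<omega>) (H u \<omega>) powr s))) \<in> borel_measurable (\<mu> \<Otimes>\<^sub>M \<mu>)"
        using m unfolding case_prod_beta by measurable
      show "(\<integral>\<^sup>+(t, u). inverse (ennreal (dist (H t \<omega>) (H u \<omega>) powr s)) \<partial>(\<mu> \<Otimes>\<^sub>M \<mu>)) < \<infinity>"
        using elim(3) unfolding \<kappa>_def case_prod_beta' infinity_ennreal_def less_top[symmetric] .
    qed
    moreover have "(\<lambda>t. H t \<omega>) ` space \<mu> = (\<lambda>t. G (t, X t \<omega>)) ` Q"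
      using elim(1) by (simp add: H_def Y_def sp)
    ultimately show ?case by simp
  qed
qed

end

section \<open>Local exponents\<close>

text \<open>Moving in a positive coordinate direction never leaves the orthant, so even a boundary
  point has neighbours at every prescribed small distance.\<close>

lemma oball_shift_axis:
  fixes u :: "real ^ 'n"
  assumes "u \<in> orthant" "0 < h" "h < \<rho>"
  shows "u + h *\<^sub>R axis k 1 \<in> oball u \<rho>"
  using assms by (auto simp: oball_def orthant_def dist_norm axis_def norm_axis_1[unfolded axis_def])

lemma center_in_oball: "u \<in> orthant \<Longrightarrow> 0 < \<rho> \<Longrightarrow> u \<in> oball u \<rho>"
  by (simp add: oball_def)

lemma convex_oball: "convex (oball (u :: real ^ 'n) \<rho>)"
proof -
  have "convex (\<Inter>i. {t :: real ^ 'n. axis i 1 \<bullet> t \<ge> 0})"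
    by (intro convex_INT convex_halfspace_ge)
  also have "(\<Inter>i. {t :: real ^ 'n. axis i 1 \<bullet> t \<ge> 0}) = orthant"
    by (auto simp: orthant_def inner_axis')
  finally show ?thesis unfolding oball_def by (intro convex_Int convex_ball)
qed

lemma oball_mono: "\<rho> \<le> \<rho>' \<Longrightarrow> oball u \<rho> \<subseteq> oball u \<rho>'"
  by (auto simp: oball_def)

lemma offdiag_oball_nonempty:
  assumes "u \<in> orthant" "0 < \<rho>"
  shows "offdiag (oball u \<rho>) \<noteq> {}"
proof -
  have "(u, u + (\<rho> / 2) *\<^sub>R axis undefined 1) \<in> offdiag (oball u \<rho>)"
    using assms oball_shift_axis[of u "\<rho> / 2" \<rho>] center_in_oball[of u \<rho>]
    by (simp add: offdiag_def axis_eq_0_iff)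
  then show ?thesis by blast
qed

lemma norm_oball_le_1: "s \<in> oball u \<rho> \<Longrightarrow> t \<in> oball u \<rho> \<Longrightarrow> \<rho> \<le> 1 / 2 \<Longrightarrow> norm (t - s) \<le> 1"
  using dist_triangle2[of t s u] by (auto simp: oball_def dist_norm norm_minus_commute)

lemma local_sub_exponent_nonneg: "0 \<le> local_sub_exponent M Y u"
  unfolding local_sub_exponent_def by (intro Inf_greatest) auto

context gaussian_field_space
begin

lemma incr_ratio_eq:
  assumes "z \<in> offdiag (oball u \<rho>)"
  shows "incr_ratio M (\<lambda>t \<omega>. X t \<omega> $ i) \<alpha> z =
    ereal (incr_msq (fst z) (snd z) / norm (snd z - fst z) powr (2 * \<alpha>))"
  using assms incr_msq[of "fst z" "snd z" i]
  by (auto simp: incr_ratio_def offdiag_def oball_def split: prod.splits)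

lemma incr_msq_nonneg: "0 \<le> incr_msq s t"
  by (simp add: incr_msq_def)

lemma incr_msq_same [simp]: "incr_msq t t = 0"
  by (simp add: incr_msq_def)

lemma local_holder_exponent_coordinate:
  "local_holder_exponent M (\<lambda>t \<omega>. X t \<omega> $ i) = local_holder_exponent M (\<lambda>t \<omega>. X t \<omega> $ j)"
proof
  fix u
  have "(SUP z \<in> offdiag (oball u \<rho>). incr_ratio M (\<lambda>t \<omega>. X t \<omega> $ i) \<alpha> z) =
      (SUP z \<in> offdiag (oball u \<rho>). incr_ratio M (\<lambda>t \<omega>. X t \<omega> $ j) \<alpha> z)" for \<rho> \<alpha>
    by (intro SUP_cong refl) (simp add: incr_ratio_eq)
  then show "local_holder_exponent M (\<lambda>t \<omega>. X t \<omega> $ i) u = local_holder_exponent M (\<lambda>t \<omega>. X t \<omega> $ j) u"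
    unfolding local_holder_exponent_def by (simp only:)
qed

text \<open>An admissible order strictly above \<beta> exists, and its ratio is bounded on a small
  ball. A radius below 1/2 makes all distances at most 1, so the bound passes down to
  \<beta>.\<close>

lemma local_holder_exponent_gtD:
  assumes "0 \<le> \<beta>" "ereal \<beta> < local_holder_exponent M (\<lambda>t \<omega>. X t \<omega> $ i) u"
  obtains \<rho> C where "0 < \<rho>" "0 \<le> C"
    "\<And>s t. s \<in> oball u \<rho> \<Longrightarrow> t \<in> oball u \<rho> \<Longrightarrow> incr_msq s t \<le> C * norm (t - s) powr (2 * \<beta>)"
proof -
  define S where "S \<alpha> \<rho> = (SUP z \<in> offdiag (oball u \<rho>). incr_ratio M (\<lambda>t \<omega>. X t \<omega> $ i) \<alpha> z)" for \<alpha> \<rho>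
  have "ereal \<beta> < Sup {ereal \<alpha> |\<alpha>. 0 < \<alpha> \<and> (\<exists>L. (S \<alpha> \<longlongrightarrow> L) (at_right 0) \<and> L < \<infinity>)}"
    using assms unfolding local_holder_exponent_def S_def[abs_def] by (simp add: less_max_iff_disj)
  then obtain \<alpha> L where \<alpha>: "\<beta> < \<alpha>" and L: "(S \<alpha> \<longlongrightarrow> L) (at_right 0)" "L < \<infinity>"
    by (auto simp: less_Sup_iff)
  have "\<forall>\<^sub>F \<rho> in at_right 0. S \<alpha> \<rho> < \<infinity>" using L by (rule order_tendstoD)
  moreover have "\<forall>\<^sub>F \<rho> in at_right 0. \<rho> \<in> {0<..<(1 / 2 :: real)}"
    by (rule eventually_at_right_real) simp
  ultimately have "\<forall>\<^sub>F \<rho> in at_right 0. S \<alpha> \<rho> < \<infinity> \<and> \<rho> \<in> {0<..<1 / 2}" by (rule eventually_conj)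
  then obtain \<rho> where \<rho>: "S \<alpha> \<rho> < \<infinity>" "0 < \<rho>" "\<rho> < 1 / 2"
    using eventually_happens'[OF trivial_limit_at_right_real] by (metis (no_types, lifting) greaterThanLessThan_iff)
  define C where "C = max 0 (real_of_ereal (S \<alpha> \<rho>))"
  have "incr_msq s t \<le> C * norm (t - s) powr (2 * \<beta>)" if "s \<in> oball u \<rho>" "t \<in> oball u \<rho>" for s t
  proof (cases "s = t")
    case False
    then have h: "0 < norm (t - s)" "norm (t - s) \<le> 1" using norm_oball_le_1[OF that] \<rho> by auto
    have od: "(s, t) \<in> offdiag (oball u \<rho>)" using that False by (simp add: offdiag_def)
    then have "ereal (incr_msq s t / norm (t - s) powr (2 * \<alpha>)) \<le> S \<alpha> \<rho>"
      unfolding S_def using SUP_upper[OF od, of "incr_ratio M (\<lambda>t \<omega>. X t \<omega> $ i) \<alpha>"]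
      by (simp add: incr_ratio_eq[OF od])
    then have "incr_msq s t / norm (t - s) powr (2 * \<alpha>) \<le> C"
      using \<rho>(1) by (cases "S \<alpha> \<rho>") (auto simp: C_def)
    then have "incr_msq s t \<le> C * norm (t - s) powr (2 * \<alpha>)" using h by (simp add: field_simps)
    also have "\<dots> \<le> C * norm (t - s) powr (2 * \<beta>)"
      using h \<alpha> by (intro mult_left_mono powr_mono') (auto simp: C_def)
    finally show ?thesis .
  qed simp
  then show thesis using \<rho> that[of \<rho> C] by (simp add: C_def)
qed

text \<open>The limit in the definition is infinite, so the ratio eventually exceeds 1; this is why
  the lower bound carries no constant.\<close>

lemma local_sub_exponent_lessD:
  assumes "local_sub_exponent M (\<lambda>t \<omega>. X t \<omega> $ i) u < ereal \<beta>"
  obtains \<rho> where "0 < \<rho>"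
    "\<And>s t. s \<in> oball u \<rho> \<Longrightarrow> t \<in> oball u \<rho> \<Longrightarrow> s \<noteq> t \<Longrightarrow> norm (t - s) powr (2 * \<beta>) \<le> incr_msq s t"
proof -
  define I where "I \<alpha> \<rho> = (INF z \<in> offdiag (oball u \<rho>). incr_ratio M (\<lambda>t \<omega>. X t \<omega> $ i) \<alpha> z)" for \<alpha> \<rho>
  have "Inf {ereal \<alpha> |\<alpha>. 0 < \<alpha> \<and> (I \<alpha> \<longlongrightarrow> \<infinity>) (at_right 0)} < ereal \<beta>"
    using assms unfolding local_sub_exponent_def I_def[abs_def] by simp
  then obtain \<alpha> where \<alpha>: "\<alpha> < \<beta>" and L: "(I \<alpha> \<longlongrightarrow> \<infinity>) (at_right 0)"
    by (auto simp: Inf_less_iff)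
  have "\<forall>\<^sub>F \<rho> in at_right 0. 1 < I \<alpha> \<rho>" using L by (rule order_tendstoD) simp
  moreover have "\<forall>\<^sub>F \<rho> in at_right 0. \<rho> \<in> {0<..<(1 / 2 :: real)}"
    by (rule eventually_at_right_real) simp
  ultimately have "\<forall>\<^sub>F \<rho> in at_right 0. 1 < I \<alpha> \<rho> \<and> \<rho> \<in> {0<..<1 / 2}" by (rule eventually_conj)
  then obtain \<rho> where \<rho>: "1 < I \<alpha> \<rho>" "0 < \<rho>" "\<rho> < 1 / 2"
    using eventually_happens'[OF trivial_limit_at_right_real] by (metis (no_types, lifting) greaterThanLessThan_iff)
  have "norm (t - s) powr (2 * \<beta>) \<le> incr_msq s t" if "s \<in> oball u \<rho>" "t \<in> oball u \<rho>" "s \<noteq> t" for s t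
  proof -
    have h: "0 < norm (t - s)" "norm (t - s) \<le> 1" using norm_oball_le_1[OF that(1,2)] \<rho> that(3) by auto
    have od: "(s, t) \<in> offdiag (oball u \<rho>)" using that by (simp add: offdiag_def)
    then have "I \<alpha> \<rho> \<le> ereal (incr_msq s t / norm (t - s) powr (2 * \<alpha>))"
      unfolding I_def using INF_lower[OF od, of "incr_ratio M (\<lambda>t \<omega>. X t \<omega> $ i) \<alpha>"]
      by (simp add: incr_ratio_eq[OF od])
    then have "1 < ereal (incr_msq s t / norm (t - s) powr (2 * \<alpha>))"
      using \<rho>(1) by (rule less_le_trans[rotated])
    then have "1 < incr_msq s t / norm (t - s) powr (2 * \<alpha>)" by simp
    then have "norm (t - s) powr (2 * \<alpha>) \<le> incr_msq s t" using h by (simp add: field_simps)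
    moreover have "norm (t - s) powr (2 * \<beta>) \<le> norm (t - s) powr (2 * \<alpha>)"
      using h \<alpha> by (intro powr_mono') auto
    ultimately show ?thesis by linarith
  qed
  then show thesis using \<rho> that by blast
qed

text \<open>Otherwise two orders \<open>b1 < b2\<close> fit strictly between the exponents, and
  increments over distance \<open>h\<close> would satisfy
  \<open>h powr (2 * b1) \<le> C * h powr (2 * b2)\<close>, which fails for small
  \<open>h\<close>.\<close>

lemma local_holder_exponent_le_sub_exponent:
  assumes u: "u \<in> orthant"
  shows "local_holder_exponent M (\<lambda>t \<omega>. X t \<omega> $ i) u \<le> local_sub_exponent M (\<lambda>t \<omega>. X t \<omega> $ i) u"
proof (rule ccontr)
  assume "\<not> ?thesis"
  then have lt: "local_sub_exponent M (\<lambda>t \<omega>. X t \<omega> $ i) u < local_holder_exponent M (\<lambda>t \<omega>. X t \<omega> $ i) u"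
    by simp
  obtain b1 where b1: "local_sub_exponent M (\<lambda>t \<omega>. X t \<omega> $ i) u < ereal b1"
      "ereal b1 < local_holder_exponent M (\<lambda>t \<omega>. X t \<omega> $ i) u"
    using ereal_dense2[OF lt] by blast
  obtain b2 where b2: "ereal b1 < ereal b2" "ereal b2 < local_holder_exponent M (\<lambda>t \<omega>. X t \<omega> $ i) u"
    using ereal_dense2[OF b1(2)] by blast
  have "0 < ereal b1" using local_sub_exponent_nonneg b1(1) by (rule le_less_trans)
  then have "0 < b1" "b1 < b2" using b2 by auto
  obtain \<rho>1 where \<rho>1: "0 < \<rho>1"
    "\<And>s t. s \<in> oball u \<rho>1 \<Longrightarrow> t \<in> oball u \<rho>1 \<Longrightarrow> s \<noteq> t \<Longrightarrow> norm (t - s) powr (2 * b1) \<le> incr_msq s t"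
    using local_sub_exponent_lessD[OF b1(1)] by blast
  obtain \<rho>2 C where \<rho>2: "0 < \<rho>2" "0 \<le> C"
    "\<And>s t. s \<in> oball u \<rho>2 \<Longrightarrow> t \<in> oball u \<rho>2 \<Longrightarrow> incr_msq s t \<le> C * norm (t - s) powr (2 * b2)"
    using local_holder_exponent_gtD[OF _ b2(2)] \<open>0 < b1\<close> \<open>b1 < b2\<close> by (metis less_eq_real_def less_trans)
  define \<delta> where "\<delta> = 2 * (b2 - b1)"
  have \<delta>: "0 < \<delta>" using \<open>b1 < b2\<close> by (simp add: \<delta>_def)
  \<comment> \<open>The second term makes \<open>C * h powr \<delta>\<close> at most
    \<open>C / (C + 1) < 1\<close>.\<close>
  define h where "h = min (min \<rho>1 \<rho>2 / 2) ((1 / (C + 1)) powr (1 / \<delta>))"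
  have h: "0 < h" "h < \<rho>1" "h < \<rho>2" using \<rho>1 \<rho>2 by (auto simp: h_def min_def)
  define t where "t = u + h *\<^sub>R axis undefined 1"
  have nt: "norm (t - u) = h" "u \<noteq> t" using h by (auto simp: t_def norm_axis_1 axis_eq_0_iff)
  have "h powr (2 * b1) \<le> incr_msq u t"
    using \<rho>1(2)[of u t] nt oball_shift_axis[OF u h(1,2)] center_in_oball[OF u \<rho>1(1)] by (simp add: t_def)
  also have "\<dots> \<le> C * h powr (2 * b2)"
    using \<rho>2(3)[of u t] nt oball_shift_axis[OF u h(1,3)] center_in_oball[OF u \<rho>2(1)] by (simp add: t_def)
  also have "h powr (2 * b2) = h powr (2 * b1) * h powr \<delta>"
    by (simp add: \<delta>_def powr_add[symmetric] algebra_simps)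
  finally have "1 \<le> C * h powr \<delta>" using h by (simp add: field_simps)
  moreover have "h powr \<delta> \<le> ((1 / (C + 1)) powr (1 / \<delta>)) powr \<delta>"
    using h \<delta> by (intro powr_mono2) (auto simp: h_def)
  then have "h powr \<delta> \<le> 1 / (C + 1)" using \<delta> \<rho>2(2) by (simp add: powr_powr)
  then have "C * h powr \<delta> \<le> C * (1 / (C + 1))" using \<rho>2(2) by (rule mult_left_mono)
  moreover have "C * (1 / (C + 1)) < 1" using \<rho>2(2) by simp
  ultimately show False by linarith
qed

text \<open>Chopping a segment into \<open>m\<close> pieces multiplies the bound by \<open>m\<^sup>2 * m powr (- 2 * \<beta>)\<close>.\<close>

lemma incr_msq_eq_0:
  assumes "1 < \<beta>" "0 \<le> C"
    and msq: "\<And>s t. s \<in> oball u \<rho> \<Longrightarrow> t \<in> oball u \<rho> \<Longrightarrow> incr_msq s t \<le> C * norm (t - s) powr (2 * \<beta>)"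
    and st: "s \<in> oball u \<rho>" "t \<in> oball u \<rho>"
  shows "incr_msq s t = 0"
proof -
  define h where "h = norm (t - s)"
  have le: "incr_msq s t \<le> C * h powr (2 * \<beta>) * real m powr (2 - 2 * \<beta>)" if m: "0 < m" for m :: nat
  proof -
    define p where "p j = s + (real j / real m) *\<^sub>R (t - s)" for j
    have p: "p j \<in> oball u \<rho>" if "j \<le> m" for j
    proof -
      have "p j = (1 - real j / real m) *\<^sub>R s + (real j / real m) *\<^sub>R t"
        by (simp add: p_def algebra_simps)
      then show ?thesis
        using that m st by (auto intro!: convexD[OF convex_oball] simp: field_simps)
    qed
    then have po: "p j \<in> orthant" if "j \<le> m" for j using that by (auto simp: oball_def)
    have np: "norm (p (Suc j) - p j) = h / real m" for j
    proof -
      have "p (Suc j) - p j = (1 / real m) *\<^sub>R (t - s)"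
        by (simp add: p_def add_divide_distrib algebra_simps)
      then show ?thesis using m by (simp add: h_def)
    qed
    define D where "D j \<omega> = X (p (Suc j)) \<omega> $ undefined - X (p j) \<omega> $ undefined" for j \<omega>
    have int: "integrable M (\<lambda>\<omega>. (D j \<omega>)\<^sup>2)" if "j < m" for j
      using gaussian_rv_even_moment(1)[OF gaussian_rv_increment[OF po po], of j "Suc j" _ 1] that
      by (simp add: D_def)
    have ED: "expectation (\<lambda>\<omega>. (D j \<omega>)\<^sup>2) \<le> C * (h / real m) powr (2 * \<beta>)" if "j < m" for j
      using msq[OF p p, of j "Suc j"] that by (simp add: D_def incr_msq po np)
    have "(\<Sum>j<m. D j \<omega>) = X (p m) \<omega> $ undefined - X (p 0) \<omega> $ undefined" for \<omega>
      unfolding D_def by (rule sum_lessThan_telescope)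
    then have "X t \<omega> $ undefined - X s \<omega> $ undefined = (\<Sum>j<m. D j \<omega>)" for \<omega>
      using m by (simp add: p_def)
    \<comment> \<open>Cauchy-Schwarz, since nothing is known about the dependence between the
      pieces; this is one factor \<open>m\<close>, the number of summands is the other.\<close>
    then have pw: "(X t \<omega> $ undefined - X s \<omega> $ undefined)\<^sup>2 \<le> real m * (\<Sum>j<m. (D j \<omega>)\<^sup>2)" for \<omega>
      using sum_squared_le_sum_of_squares[of "\<lambda>j. D j \<omega>" "{..<m}"] by (simp add: mult.commute)
    have o: "s \<in> orthant" "t \<in> orthant" using st by (auto simp: oball_def)
    have "incr_msq s t \<le> expectation (\<lambda>\<omega>. real m * (\<Sum>j<m. (D j \<omega>)\<^sup>2))"
      unfolding incr_msq_def
      using gaussian_rv_even_moment(1)[OF gaussian_rv_increment[OF o], of _ 1] int pw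
      by (intro integral_mono) auto
    also have "\<dots> = real m * (\<Sum>j<m. expectation (\<lambda>\<omega>. (D j \<omega>)\<^sup>2))"
      using int by (simp add: Bochner_Integration.integral_sum)
    also have "\<dots> \<le> real m * (\<Sum>j<m. C * (h / real m) powr (2 * \<beta>))"
      using ED by (intro mult_left_mono sum_mono) auto
    also have "\<dots> = C * h powr (2 * \<beta>) * ((real m)\<^sup>2 / real m powr (2 * \<beta>))"
      by (simp add: powr_divide power2_eq_square)
    also have "(real m)\<^sup>2 / real m powr (2 * \<beta>) = real m powr (2 - 2 * \<beta>)"
      using m by (simp add: powr_diff powr_numeral)
    finally show ?thesis .
  qed
  have "(\<lambda>m. C * h powr (2 * \<beta>) * real m powr (2 - 2 * \<beta>)) \<longlonglongrightarrow> C * h powr (2 * \<beta>) * 0"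
    using assms(1) by (intro tendsto_mult_left tendsto_neg_powr filterlim_real_sequentially) auto
  then have "incr_msq s t \<le> C * h powr (2 * \<beta>) * 0"
    by (rule LIMSEQ_le_const) (use le in \<open>auto intro!: exI[of _ 1]\<close>)
  then show ?thesis using incr_msq_nonneg[of s t] by simp
qed

text \<open>All increments vanish in mean square on a ball, so the ratio is 0 for every order.
  Off-diagonal pairs exist at all radii, hence the supremum is 0 and not the value for the empty
  set.\<close>

lemma local_holder_exponent_gt_1:
  assumes u: "u \<in> orthant" and gt: "1 < local_holder_exponent M (\<lambda>t \<omega>. X t \<omega> $ i) u"
  shows "local_holder_exponent M (\<lambda>t \<omega>. X t \<omega> $ i) u = \<infinity>"
proof -
  obtain \<beta> where \<beta>: "1 < ereal \<beta>" "ereal \<beta> < local_holder_exponent M (\<lambda>t \<omega>. X t \<omega> $ i) u"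
    using ereal_dense2[OF gt] by blast
  then have "1 < \<beta>" by simp
  then obtain \<rho> C where \<rho>: "0 < \<rho>" "0 \<le> C"
    "\<And>s t. s \<in> oball u \<rho> \<Longrightarrow> t \<in> oball u \<rho> \<Longrightarrow> incr_msq s t \<le> C * norm (t - s) powr (2 * \<beta>)"
    using local_holder_exponent_gtD[OF _ \<beta>(2)] by (metis less_eq_real_def less_trans zero_less_one)
  define S where "S \<alpha> \<rho> = (SUP z \<in> offdiag (oball u \<rho>). incr_ratio M (\<lambda>t \<omega>. X t \<omega> $ i) \<alpha> z)" for \<alpha> \<rho>
  have S0: "S \<alpha> r = 0" if r: "0 < r" "r < \<rho>" for \<alpha> r
  proof -
    have "incr_ratio M (\<lambda>t \<omega>. X t \<omega> $ i) \<alpha> z = 0" if z: "z \<in> offdiag (oball u r)" for z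
    proof -
      have "fst z \<in> oball u \<rho>" "snd z \<in> oball u \<rho>"
        using z oball_mono[of r \<rho> u] r by (auto simp: offdiag_def)
      then have "incr_msq (fst z) (snd z) = 0"
        using incr_msq_eq_0[of \<beta> C u \<rho>] \<open>1 < \<beta>\<close> \<rho> by blast
      then show ?thesis by (simp add: incr_ratio_eq[OF z])
    qed
    then have "S \<alpha> r = (SUP z \<in> offdiag (oball u r). 0)" unfolding S_def by (intro SUP_cong) auto
    then show ?thesis using offdiag_oball_nonempty[OF u r(1)] by simp
  qed
  have lim: "(S \<alpha> \<longlongrightarrow> 0) (at_right 0)" for \<alpha>
  proof (rule tendsto_eventually)
    have "\<forall>\<^sub>F r in at_right 0. r \<in> {0<..<\<rho>}" using \<rho>(1) by (rule eventually_at_right_real)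
    then show "\<forall>\<^sub>F r in at_right 0. S \<alpha> r = 0" by eventually_elim (simp add: S0)
  qed
  have "Sup {ereal \<alpha> |\<alpha>. 0 < \<alpha> \<and> (\<exists>L. (S \<alpha> \<longlongrightarrow> L) (at_right 0) \<and> L < \<infinity>)} = \<infinity>"
  proof (rule ereal_top)
    fix B :: real
    have "ereal (max 1 B) \<le> Sup {ereal \<alpha> |\<alpha>. 0 < \<alpha> \<and> (\<exists>L. (S \<alpha> \<longlongrightarrow> L) (at_right 0) \<and> L < \<infinity>)}"
      using lim by (intro Sup_upper CollectI exI[of _ "max 1 B"] conjI exI[of _ "0 :: ereal"]) auto
    then show "ereal B \<le> Sup {ereal \<alpha> |\<alpha>. 0 < \<alpha> \<and> (\<exists>L. (S \<alpha> \<longlongrightarrow> L) (at_right 0) \<and> L < \<infinity>)}"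
      by (rule order_trans[rotated]) simp
  qed
  then show ?thesis unfolding local_holder_exponent_def S_def[abs_def] by simp
qed

lemma liminf_holder_gtD:
  assumes "x < liminf_holder M Y t0"
  obtains \<rho> where "0 < \<rho>" "\<And>u. u \<in> oball t0 \<rho> \<Longrightarrow> u \<noteq> t0 \<Longrightarrow> x < local_holder_exponent M Y u"
proof -
  have "\<forall>\<^sub>F u in at t0 within orthant. x < local_holder_exponent M Y u"
    using assms unfolding liminf_holder_def by (rule less_LiminfD)
  then obtain \<rho> where "0 < \<rho>" "\<And>u. u \<in> orthant \<Longrightarrow> u \<noteq> t0 \<Longrightarrow> dist u t0 < \<rho> \<Longrightarrow> x < local_holder_exponent M Y u"
    unfolding eventually_at by auto
  then show thesis by (intro that) (auto simp: oball_def dist_commute)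
qed

lemma liminf_sub_lessD:
  assumes "liminf_sub M Y t0 < x" "0 < \<rho>"
  obtains u where "u \<in> oball t0 \<rho>" "u \<noteq> t0" "local_sub_exponent M Y u < x"
proof (rule ccontr)
  assume no: "\<not> thesis"
  have "\<forall>\<^sub>F u in at t0 within orthant. x \<le> local_sub_exponent M Y u"
    unfolding eventually_at
    using that no assms(2) by (intro exI[of _ \<rho>]) (auto simp: oball_def dist_commute not_less[symmetric])
  then have "x \<le> liminf_sub M Y t0" unfolding liminf_sub_def by (rule Liminf_bounded)
  then show False using assms(1) by simp
qed

lemma liminf_holder_le_liminf_sub:
  "liminf_holder M (\<lambda>t \<omega>. X t \<omega> $ i) t0 \<le> liminf_sub M (\<lambda>t \<omega>. X t \<omega> $ i) t0"
  unfolding liminf_holder_def liminf_sub_def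
proof (rule Liminf_mono)
  show "\<forall>\<^sub>F u in at t0 within orthant.
      local_holder_exponent M (\<lambda>t \<omega>. X t \<omega> $ i) u \<le> local_sub_exponent M (\<lambda>t \<omega>. X t \<omega> $ i) u"
    unfolding eventually_at_filter by (auto intro!: always_eventually local_holder_exponent_le_sub_exponent)
qed

text \<open>If the lower limit exceeded 1, all nearby exponents would, and would then be infinite.
  This supplies the bound \<open>\<gamma> \<le> 1\<close> required by the graph coverings.\<close>

lemma liminf_holder_le_1:
  assumes "liminf_holder M (\<lambda>t \<omega>. X t \<omega> $ i) t0 < \<infinity>"
  shows "liminf_holder M (\<lambda>t \<omega>. X t \<omega> $ i) t0 \<le> 1"
proof (rule ccontr)
  assume "\<not> ?thesis"
  then have "\<forall>\<^sub>F u in at t0 within orthant. 1 < local_holder_exponent M (\<lambda>t \<omega>. X t \<omega> $ i) u"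
    unfolding liminf_holder_def by (intro less_LiminfD) simp
  moreover have "\<forall>\<^sub>F u in at t0 within orthant. u \<in> orthant"
    by (simp add: eventually_at_filter)
  ultimately have "\<forall>\<^sub>F u in at t0 within orthant. \<infinity> \<le> local_holder_exponent M (\<lambda>t \<omega>. X t \<omega> $ i) u"
    by eventually_elim (simp add: local_holder_exponent_gt_1)
  then have "\<infinity> \<le> liminf_holder M (\<lambda>t \<omega>. X t \<omega> $ i) t0"
    unfolding liminf_holder_def by (rule Liminf_bounded)
  then show False using assms by simp
qed

end

section \<open>Local dimensions\<close>

text \<open>Dimension is monotone in the set, so the limit over shrinking balls exists and is the
  infimum; bounds can be proved one radius at a time.\<close>

lemma has_local_dim_INF:
  assumes "\<And>\<rho> \<rho>'. \<rho> \<le> \<rho>' \<Longrightarrow> D (oball t0 \<rho>) \<subseteq> D (oball t0 \<rho>')"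
  shows "has_local_dim D t0 (INF \<rho>\<in>{0<..}. hausdorff_dim (D (oball t0 \<rho>)))"
  unfolding has_local_dim_def
proof (rule order_tendstoI)
  let ?L = "INF \<rho>\<in>{0<..}. hausdorff_dim (D (oball t0 \<rho>))"
  fix a assume a: "a < ?L"
  have "\<forall>\<^sub>F \<rho> in at_right 0. \<rho> \<in> {0<..<(1::real)}" by (rule eventually_at_right_real) simp
  then show "\<forall>\<^sub>F \<rho> in at_right 0. a < hausdorff_dim (D (oball t0 \<rho>))"
  proof eventually_elim
    case (elim \<rho>)
    then have "?L \<le> hausdorff_dim (D (oball t0 \<rho>))" by (intro INF_lower) simp
    then show ?case using a by (rule less_le_trans[rotated])
  qed
next
  let ?L = "INF \<rho>\<in>{0<..}. hausdorff_dim (D (oball t0 \<rho>))"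
  fix a assume "?L < a"
  then obtain r where r: "0 < r" "hausdorff_dim (D (oball t0 r)) < a" by (auto simp: INF_less_iff)
  have "\<forall>\<^sub>F \<rho> in at_right 0. \<rho> \<in> {0<..<r}" using r(1) by (rule eventually_at_right_real)
  then show "\<forall>\<^sub>F \<rho> in at_right 0. hausdorff_dim (D (oball t0 \<rho>)) < a"
  proof eventually_elim
    case (elim \<rho>)
    then have "hausdorff_dim (D (oball t0 \<rho>)) \<le> hausdorff_dim (D (oball t0 r))"
      using assms[of \<rho> r] by (intro hausdorff_dim_mono) simp
    then show ?case using r(2) by (rule le_less_trans)
  qed
qed

text \<open>Reduces bounds with extended real exponents to rational ones, for which a common null
  set exists.\<close>

lemma ereal_le_of_rat_below:
  assumes "\<And>q :: rat. ereal (of_rat q) < y \<Longrightarrow> ereal (of_rat q) \<le> (x :: ereal)"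
  shows "y \<le> x"
proof (rule ccontr)
  assume "\<not> y \<le> x"
  then obtain q :: rat where "x < ereal (of_rat q)" "ereal (of_rat q) < y"
    using ereal_dense3[of x y] by (auto simp: not_le)
  then show False using assms[of q] by simp
qed

lemma ereal_le_of_rat_above:
  assumes "\<And>q :: rat. y < ereal (of_rat q) \<Longrightarrow> (x :: ereal) \<le> ereal (of_rat q)"
  shows "x \<le> y"
proof (rule ccontr)
  assume "\<not> x \<le> y"
  then obtain q :: rat where "y < ereal (of_rat q)" "ereal (of_rat q) < x"
    using ereal_dense3[of y x] by (auto simp: not_le)
  then show False using assms[of q] by simp
qed

section \<open>Cubes with uniform increment bounds and regular paths\<close>

context gaussian_field_space
begin

definition holder_domain :: "(real ^ 'n) set" where
  "holder_domain = {t \<in> orthant. \<forall>i. 0 < local_holder_exponent M (\<lambda>t \<omega>. X t \<omega> $ i) t}"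

lemma mem_holder_domain_iff:
  "t \<in> holder_domain \<longleftrightarrow> t \<in> orthant \<and> 0 < local_holder_exponent M (\<lambda>t \<omega>. X t \<omega> $ i) t"
proof -
  have "0 < local_holder_exponent M (\<lambda>t \<omega>. X t \<omega> $ j) t"
    if "0 < local_holder_exponent M (\<lambda>t \<omega>. X t \<omega> $ i) t" for j
    using that by (simp only: local_holder_exponent_coordinate[of j i])
  then show ?thesis by (auto simp: holder_domain_def)
qed

text \<open>The constant is existential, so the exceptional null sets are indexed only by the cube
  and the exponents, a countable family.\<close>

definition upper_cube :: "real \<Rightarrow> nat \<Rightarrow> int ^ 'n \<Rightarrow> bool" where
  "upper_cube \<beta> n k \<longleftrightarrow> dyadic_cube n k \<subseteq> holder_domain \<and>
     (\<exists>C\<ge>0. \<forall>s\<in>dyadic_cube n k. \<forall>t\<in>dyadic_cube n k. incr_msq s t \<le> C * norm (t - s) powr (2 * \<beta>))"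

definition lower_cube :: "real \<Rightarrow> nat \<Rightarrow> int ^ 'n \<Rightarrow> bool" where
  "lower_cube \<beta> n k \<longleftrightarrow> dyadic_cube n k \<subseteq> holder_domain \<and>
     (\<forall>s\<in>dyadic_cube n k. \<forall>t\<in>dyadic_cube n k. s \<noteq> t \<longrightarrow> norm (t - s) powr (2 * \<beta>) \<le> incr_msq s t)"

text \<open>The properties are quantified over cubes and rationals only and the cube conditions do
  not involve \<omega>, so the whole conjunction is a countable intersection of almost sure
  events.\<close>

definition regular_path :: "'w \<Rightarrow> bool" where
  "regular_path \<omega> \<longleftrightarrow>
     (\<forall>n k (\<beta>::rat) (\<gamma>::rat). upper_cube (of_rat \<beta>) n k \<longrightarrow> 0 < \<gamma> \<longrightarrow> \<gamma> < \<beta> \<longrightarrow>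
        dyadic_holder_on (dyadic_cube n k) (of_rat \<gamma>) (\<lambda>t. X t \<omega>)) \<and>
     (\<forall>n k (\<beta>::rat) (e::rat) (s::rat). lower_cube (of_rat \<beta>) n k \<longrightarrow> 0 < \<beta> \<longrightarrow> 0 < e \<longrightarrow>
        of_rat e < real CARD('d) \<longrightarrow> e \<le> s \<longrightarrow> of_rat s - of_rat e * (1 - of_rat \<beta>) < real CARD('n) \<longrightarrow>
        \<not> hnull (of_rat s) ((\<lambda>t. (t, X t \<omega>)) ` dyadic_cube n k)) \<and>
     (\<forall>n k (\<beta>::rat) (s::rat). lower_cube (of_rat \<beta>) n k \<longrightarrow> 0 < \<beta> \<longrightarrow> 0 < s \<longrightarrow>
        of_rat s < real CARD('d) \<longrightarrow> of_rat \<beta> * of_rat s < real CARD('n) \<longrightarrow>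
        \<not> hnull (of_rat s) ((\<lambda>t. X t \<omega>) ` dyadic_cube n k))"

lemma AE_regular_path:
  assumes "continuous_version M X"
  shows "AE \<omega> in M. regular_path \<omega>"
proof -
  have cont: "AE \<omega> in M. continuous_on (dyadic_cube n k) (\<lambda>t. X t \<omega>)"
    if "dyadic_cube n k \<subseteq> holder_domain" for n k
    using assms unfolding continuous_version_def holder_domain_def[symmetric]
    by (rule eventually_mono) (rule continuous_on_subset[OF _ that])
  have sub: "dyadic_cube n k \<subseteq> orthant" if "dyadic_cube n k \<subseteq> holder_domain" for n k
    using that by (auto simp: holder_domain_def)
  have 1: "AE \<omega> in M. dyadic_holder_on (dyadic_cube n k) (of_rat \<gamma>) (\<lambda>t. X t \<omega>)"
    if uc: "upper_cube (of_rat \<beta>) n k" and \<gamma>: "0 < \<gamma>" "\<gamma> < \<beta>" for n k and \<beta> \<gamma> :: rat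
  proof -
    obtain C where C: "0 \<le> C" "\<And>s t. s \<in> dyadic_cube n k \<Longrightarrow> t \<in> dyadic_cube n k \<Longrightarrow>
        incr_msq s t \<le> C * norm (t - s) powr (2 * of_rat \<beta>)"
      using uc unfolding upper_cube_def by blast
    have d: "dyadic_cube n k \<subseteq> holder_domain" using uc unfolding upper_cube_def by blast
    show ?thesis
      by (rule AE_dyadic_holder_on[OF sub[OF d] C(1) C(2) _ _ cont[OF d]])
        (use \<gamma> in \<open>auto simp: of_rat_less\<close>)
  qed
  have 2: "AE \<omega> in M. \<not> hnull (of_rat s) ((\<lambda>t. (t, X t \<omega>)) ` dyadic_cube n k)"
    if lc: "lower_cube (of_rat \<beta>) n k" and b: "0 < \<beta>" and e: "0 < e" "of_rat e < real CARD('d)" "e \<le> s"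
      "of_rat s - of_rat e * (1 - of_rat \<beta>) < real CARD('n)" for n k and \<beta> e s :: rat
  proof -
    have d: "dyadic_cube n k \<subseteq> holder_domain" using lc unfolding lower_cube_def by blast
    have "AE \<omega> in M. \<not> hnull (of_rat s) ((\<lambda>t. (\<lambda>z. z) (t, X t \<omega>)) ` dyadic_cube n k)"
    proof (rule AE_not_hnull_image[OF sub[OF d] _ _ cont[OF d]])
      show "norm (t - s) powr (2 * of_rat \<beta>) \<le> incr_msq s t"
        if "s \<in> dyadic_cube n k" "t \<in> dyadic_cube n k" "s \<noteq> t" for s t
        using lc that unfolding lower_cube_def by blast
      fix t u :: "real ^ 'n" and x y :: "real ^ 'd"
      define m where "m = dist (t, x) (u, y)"
      have m: "norm (x - y) \<le> m" "norm (t - u) \<le> m"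
        using dist_snd_le[of "(t, x)" "(u, y)"] dist_fst_le[of "(t, x)" "(u, y)"] by (auto simp: m_def dist_norm)
      \<comment> \<open>The product distance dominates both factors and the exponents
        \<open>e\<close> and \<open>s - e\<close>, both nonnegative, add up to
        \<open>s\<close>.\<close>
      have "norm (x - y) powr of_rat e * norm (t - u) powr (of_rat s - of_rat e) \<le>
          m powr of_rat e * m powr (of_rat s - of_rat e)"
        using m e by (intro mult_mono powr_mono2) (auto simp: of_rat_less_eq)
      also have "\<dots> = m powr of_rat s" by (simp add: powr_add[symmetric])
      finally show "norm (x - y) powr of_rat e * norm (t - u) powr (of_rat s - of_rat e) \<le>
          dist ((\<lambda>z. z) (t, x)) ((\<lambda>z. z) (u, y)) powr of_rat s" by (simp add: m_def)
    qed (use b e in \<open>auto simp: of_rat_less_eq\<close>)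
    then show ?thesis by simp
  qed
  have 3: "AE \<omega> in M. \<not> hnull (of_rat s) ((\<lambda>t. X t \<omega>) ` dyadic_cube n k)"
    if lc: "lower_cube (of_rat \<beta>) n k" and b: "0 < \<beta>" and s: "0 < s" "of_rat s < real CARD('d)"
      "of_rat \<beta> * of_rat s < real CARD('n)" for n k and \<beta> s :: rat
  proof -
    have d: "dyadic_cube n k \<subseteq> holder_domain" using lc unfolding lower_cube_def by blast
    have "AE \<omega> in M. \<not> hnull (of_rat s) ((\<lambda>t. snd (t, X t \<omega>)) ` dyadic_cube n k)"
    \<comment> \<open>With \<open>e = s\<close> nothing is charged to time: the projection forgets
      it, and the condition on the orders becomes \<open>\<beta> * s < N\<close>.\<close>
    proof (rule AE_not_hnull_image[OF sub[OF d] _ _ cont[OF d], where e = "of_rat s"])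
      show "norm (t - s) powr (2 * of_rat \<beta>) \<le> incr_msq s t"
        if "s \<in> dyadic_cube n k" "t \<in> dyadic_cube n k" "s \<noteq> t" for s t
        using lc that unfolding lower_cube_def by blast
      show "norm (x - y) powr of_rat s * norm (t - u) powr (of_rat s - of_rat s) \<le>
          dist (snd (t, x)) (snd (u, y)) powr of_rat s" for t u :: "real ^ 'n" and x y :: "real ^ 'd"
        by (simp add: dist_norm)
      show "snd \<in> borel_measurable borel"
        by (intro borel_measurable_continuous_onI continuous_intros)
    qed (use b s in \<open>auto simp: algebra_simps\<close>)
    then show ?thesis by simp
  qed
  show ?thesis
    unfolding regular_path_def using 1 2 3 by (simp add: AE_all_countable)
qed

lemma dyadic_cubes_cover:
  assumes "0 < \<beta>" "ereal \<beta> < liminf_holder M (\<lambda>t \<omega>. X t \<omega> $ i) t0"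
  obtains \<rho> where "0 < \<rho>"
    "oball t0 \<rho> - {t0} \<subseteq> (\<Union>z\<in>{(n, k). upper_cube \<beta> n k}. dyadic_cube (fst z) (snd z))"
proof -
  obtain \<rho> where \<rho>: "0 < \<rho>"
    "\<And>u. u \<in> oball t0 \<rho> \<Longrightarrow> u \<noteq> t0 \<Longrightarrow> ereal \<beta> < local_holder_exponent M (\<lambda>t \<omega>. X t \<omega> $ i) u"
    using liminf_holder_gtD[OF assms(2)] by blast
  have "\<exists>n k. upper_cube \<beta> n k \<and> u \<in> dyadic_cube n k" if u: "u \<in> oball t0 \<rho>" "u \<noteq> t0" for u
  proof -
    have uo: "u \<in> orthant" using u by (simp add: oball_def)
    obtain r C where r: "0 < r" "0 \<le> C"
      "\<And>s t. s \<in> oball u r \<Longrightarrow> t \<in> oball u r \<Longrightarrow> incr_msq s t \<le> C * norm (t - s) powr (2 * \<beta>)"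
      using local_holder_exponent_gtD[OF _ \<rho>(2)[OF u]] assms(1) by (metis less_imp_le)
    \<comment> \<open>Besides the increment bound, the cube must stay in the ball and avoid
      \<open>t0\<close>, where the exponent may vanish and continuity is not guaranteed.\<close>
    define r' where "r' = min r (min (\<rho> - dist t0 u) (dist t0 u))"
    have r': "0 < r'" using r u by (auto simp: r'_def oball_def)
    obtain n k where nk: "u \<in> dyadic_cube n k" "dyadic_cube n k \<subseteq> oball u r'"
      using exists_dyadic_cube[OF uo r'] by blast
    have "t \<in> holder_domain" if "t \<in> dyadic_cube n k" for t
    proof -
      have t: "t \<in> oball u r'" using nk that by blast
      then have "dist u t < \<rho> - dist t0 u" "dist u t < dist t0 u" "t \<in> orthant"
        by (auto simp: oball_def r'_def)
      then have "t \<in> oball t0 \<rho>" "t \<noteq> t0" "t \<in> orthant"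
        using dist_triangle[of t0 t u] by (auto simp: oball_def dist_commute)
      then have "0 < local_holder_exponent M (\<lambda>t \<omega>. X t \<omega> $ i) t"
        using \<rho>(2)[of t] assms(1) by (metis ereal_less(2) less_trans)
      then show ?thesis
        using \<open>t \<in> orthant\<close> by (simp add: mem_holder_domain_iff[where i = i])
    qed
    moreover have "dyadic_cube n k \<subseteq> oball u r" using nk oball_mono[of r' r u] by (auto simp: r'_def)
    ultimately have "upper_cube \<beta> n k" unfolding upper_cube_def using r by blast
    then show ?thesis using nk by blast
  qed
  then have "oball t0 \<rho> - {t0} \<subseteq> (\<Union>z\<in>{(n, k). upper_cube \<beta> n k}. dyadic_cube (fst z) (snd z))"
    by fastforce
  with \<rho>(1) show thesis by (rule that)
qed

text \<open>One nearby point with a small sub-exponent is enough, since dimension is monotone;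
  positivity of the lower Hoelder limit puts its cube inside the domain of continuity.\<close>

lemma exists_lower_cube:
  assumes "0 < liminf_holder M (\<lambda>t \<omega>. X t \<omega> $ i) t0"
    and "liminf_sub M (\<lambda>t \<omega>. X t \<omega> $ i) t0 < ereal \<beta>" "0 < \<rho>"
  obtains n k where "lower_cube \<beta> n k" "dyadic_cube n k \<subseteq> oball t0 \<rho>"
proof -
  obtain \<rho>1 where \<rho>1: "0 < \<rho>1"
    "\<And>u. u \<in> oball t0 \<rho>1 \<Longrightarrow> u \<noteq> t0 \<Longrightarrow> 0 < local_holder_exponent M (\<lambda>t \<omega>. X t \<omega> $ i) u"
    using liminf_holder_gtD[OF assms(1)] by blast
  define \<rho>2 where "\<rho>2 = min \<rho> \<rho>1"
  have "0 < \<rho>2" using \<rho>1 assms(3) by (simp add: \<rho>2_def)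
  then obtain u where u: "u \<in> oball t0 \<rho>2" "u \<noteq> t0" "local_sub_exponent M (\<lambda>t \<omega>. X t \<omega> $ i) u < ereal \<beta>"
    using liminf_sub_lessD[OF assms(2)] by blast
  have uo: "u \<in> orthant" using u by (simp add: oball_def)
  obtain r where r: "0 < r"
    "\<And>s t. s \<in> oball u r \<Longrightarrow> t \<in> oball u r \<Longrightarrow> s \<noteq> t \<Longrightarrow> norm (t - s) powr (2 * \<beta>) \<le> incr_msq s t"
    using local_sub_exponent_lessD[OF u(3)] by blast
  define r' where "r' = min r (min (\<rho>2 - dist t0 u) (dist t0 u))"
  have r': "0 < r'" using r u by (auto simp: r'_def oball_def)
  obtain n k where nk: "u \<in> dyadic_cube n k" "dyadic_cube n k \<subseteq> oball u r'"
    using exists_dyadic_cube[OF uo r'] by blast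
  have t2: "t \<in> oball t0 \<rho>2 \<and> t \<noteq> t0" if "t \<in> dyadic_cube n k" for t
  proof -
    have t: "t \<in> oball u r'" using nk that by blast
    then have "dist u t < \<rho>2 - dist t0 u" "dist u t < dist t0 u" "t \<in> orthant"
      by (auto simp: oball_def r'_def)
    then show ?thesis
      using dist_triangle[of t0 t u] by (auto simp: oball_def dist_commute)
  qed
  have "t \<in> holder_domain" if "t \<in> dyadic_cube n k" for t
  proof -
    have "t \<in> oball t0 \<rho>1" "t \<noteq> t0" using t2[OF that] oball_mono[of \<rho>2 \<rho>1 t0] by (auto simp: \<rho>2_def)
    then have "0 < local_holder_exponent M (\<lambda>t \<omega>. X t \<omega> $ i) t" "t \<in> orthant"
      using \<rho>1(2)[of t] by (auto simp: oball_def)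
    then show ?thesis
      by (simp add: mem_holder_domain_iff[where i = i])
  qed
  moreover have "dyadic_cube n k \<subseteq> oball u r" using nk oball_mono[of r' r u] by (auto simp: r'_def)
  ultimately have "lower_cube \<beta> n k" unfolding lower_cube_def using r by blast
  moreover have "dyadic_cube n k \<subseteq> oball t0 \<rho>"
    using t2 oball_mono[of \<rho>2 \<rho> t0] by (auto simp: \<rho>2_def)
  ultimately show thesis by (rule that)
qed

end

section \<open>Dimension bounds near a point for a regular path\<close>

context gaussian_field_space
begin

lemma range_over_eq_snd_graph_over: "range_over X \<omega> A = snd ` graph_over X \<omega> A"
  by (auto simp: range_over_def graph_over_def image_image)

lemma hausdorff_dim_range_le_graph:
  "hausdorff_dim (range_over X \<omega> A) \<le> hausdorff_dim (graph_over X \<omega> A)"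
  unfolding range_over_eq_snd_graph_over by (intro hausdorff_dim_image_contraction dist_snd_le)

text \<open>The cubes miss the centre, whose image is one point and hence null.\<close>

lemma hnull_oball_image:
  fixes F :: "real ^ 'n \<Rightarrow> 'e::metric_space"
  assumes cov: "oball t0 \<rho> - {t0} \<subseteq> (\<Union>z\<in>{(n, k). upper_cube \<beta> n k}. dyadic_cube (fst z) (snd z))"
    and "\<And>n k. upper_cube \<beta> n k \<Longrightarrow> hnull s (F ` dyadic_cube n k)"
  shows "hnull s (F ` oball t0 \<rho>)"
proof -
  let ?I = "{(n, k). upper_cube \<beta> n k}"
  have "hnull s (\<Union>z\<in>?I. F ` dyadic_cube (fst z) (snd z))"
    using assms(2) by (intro hnull_countable_UN) auto
  then have "hnull s (\<Union>b. if b then {F t0} else (\<Union>z\<in>?I. F ` dyadic_cube (fst z) (snd z)))"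
    by (intro hnull_countable_UN) auto
  then show ?thesis
  proof (rule hnull_subset)
    show "F ` oball t0 \<rho> \<subseteq> (\<Union>b. if b then {F t0} else (\<Union>z\<in>?I. F ` dyadic_cube (fst z) (snd z)))"
    proof
      fix y assume "y \<in> F ` oball t0 \<rho>"
      then obtain t where t: "t \<in> oball t0 \<rho>" "y = F t" by blast
      show "y \<in> (\<Union>b. if b then {F t0} else (\<Union>z\<in>?I. F ` dyadic_cube (fst z) (snd z)))"
      proof (cases "t = t0")
        case True
        then show ?thesis using t by (intro UN_I[of True]) auto
      next
        case False
        then have "y \<in> (\<Union>z\<in>?I. F ` dyadic_cube (fst z) (snd z))" using t cov by blast
        then show ?thesis by (intro UN_I[of False]) auto
      qed
    qed
  qed
qed

lemma range_dim_le:
  assumes reg: "regular_path \<omega>" and \<gamma>: "0 < \<gamma>" "ereal (of_rat \<gamma>) < liminf_holder M (\<lambda>t \<omega>. X t \<omega> $ i) t0"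
    and s: "0 < s" "real CARD('n) < of_rat \<gamma> * s"
  shows "\<exists>\<rho>>0. hausdorff_dim (range_over X \<omega> (oball t0 \<rho>)) \<le> ereal s"
proof -
  \<comment> \<open>The path order is strictly below the moment order, so a second rational is
    inserted between \<gamma> and the lower limit.\<close>
  obtain \<beta> :: rat where \<beta>: "ereal (of_rat \<gamma>) < ereal (of_rat \<beta>)"
      "ereal (of_rat \<beta>) < liminf_holder M (\<lambda>t \<omega>. X t \<omega> $ i) t0"
    using ereal_dense3[OF \<gamma>(2)] by blast
  then have "\<gamma> < \<beta>" by (simp add: of_rat_less)
  then have "0 < (of_rat \<beta> :: real)" using \<gamma>(1) by simp
  then obtain \<rho> where \<rho>: "0 < \<rho>"
    "oball t0 \<rho> - {t0} \<subseteq> (\<Union>z\<in>{(n, k). upper_cube (of_rat \<beta>) n k}. dyadic_cube (fst z) (snd z))"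
    using dyadic_cubes_cover[OF _ \<beta>(2)] by blast
  have "hnull s ((\<lambda>t. X t \<omega>) ` oball t0 \<rho>)"
  proof (rule hnull_oball_image[OF \<rho>(2)])
    fix n k assume "upper_cube (of_rat \<beta>) n k"
    then have "dyadic_holder_on (dyadic_cube n k) (of_rat \<gamma>) (\<lambda>t. X t \<omega>)"
      using reg \<gamma>(1) \<open>\<gamma> < \<beta>\<close> unfolding regular_path_def by blast
    then show "hnull s ((\<lambda>t. X t \<omega>) ` dyadic_cube n k)"
      using s by (rule hnull_dyadic_holder_image)
  qed
  then show ?thesis using \<rho>(1) s by (auto simp: range_over_def intro: hausdorff_dim_le)
qed

lemma graph_dim_le:
  assumes reg: "regular_path \<omega>" and \<gamma>: "0 < \<gamma>" "ereal (of_rat \<gamma>) < liminf_holder M (\<lambda>t \<omega>. X t \<omega> $ i) t0"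
    and \<gamma>1: "\<gamma> \<le> 1" and s: "0 < s"
    and alt: "real CARD('n) < of_rat \<gamma> * s \<or> real CARD('n) + real CARD('d) * (1 - of_rat \<gamma>) < s"
  shows "\<exists>\<rho>>0. hausdorff_dim (graph_over X \<omega> (oball t0 \<rho>)) \<le> ereal s"
proof -
  obtain \<beta> :: rat where \<beta>: "ereal (of_rat \<gamma>) < ereal (of_rat \<beta>)"
      "ereal (of_rat \<beta>) < liminf_holder M (\<lambda>t \<omega>. X t \<omega> $ i) t0"
    using ereal_dense3[OF \<gamma>(2)] by blast
  then have "\<gamma> < \<beta>" by (simp add: of_rat_less)
  then have "0 < (of_rat \<beta> :: real)" using \<gamma>(1) by simp
  then obtain \<rho> where \<rho>: "0 < \<rho>"
    "oball t0 \<rho> - {t0} \<subseteq> (\<Union>z\<in>{(n, k). upper_cube (of_rat \<beta>) n k}. dyadic_cube (fst z) (snd z))"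
    using dyadic_cubes_cover[OF _ \<beta>(2)] by blast
  have "hnull s ((\<lambda>t. (t, X t \<omega>)) ` oball t0 \<rho>)"
  proof (rule hnull_oball_image[OF \<rho>(2)])
    fix n k assume "upper_cube (of_rat \<beta>) n k"
    then have h: "dyadic_holder_on (dyadic_cube n k) (of_rat \<gamma>) (\<lambda>t. X t \<omega>)"
      using reg \<gamma>(1) \<open>\<gamma> < \<beta>\<close> unfolding regular_path_def by blast
    have 1: "(of_rat \<gamma> :: real) \<le> 1" using \<gamma>1 by simp
    from alt show "hnull s ((\<lambda>t. (t, X t \<omega>)) ` dyadic_cube n k)"
    proof
      assume "real CARD('n) < of_rat \<gamma> * s"
      with dyadic_holder_on_graph[OF h 1] s show ?thesis by (rule hnull_dyadic_holder_image)
    next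
      assume "real CARD('n) + real CARD('d) * (1 - of_rat \<gamma>) < s"
      with h 1 show ?thesis by (rule hnull_dyadic_holder_graph)
    qed
  qed
  then show ?thesis using \<rho>(1) s by (auto simp: graph_over_def intro: hausdorff_dim_le)
qed

lemma graph_dim_ge:
  assumes reg: "regular_path \<omega>" and pos: "0 < liminf_holder M (\<lambda>t \<omega>. X t \<omega> $ i) t0"
    and \<beta>: "0 < \<beta>" "liminf_sub M (\<lambda>t \<omega>. X t \<omega> $ i) t0 < ereal (of_rat \<beta>)" and \<rho>: "0 < \<rho>"
    and e: "0 < e" "of_rat e < real CARD('d)" "e \<le> s" "of_rat s - of_rat e * (1 - of_rat \<beta>) < real CARD('n)"
  shows "ereal (of_rat s) \<le> hausdorff_dim (graph_over X \<omega> (oball t0 \<rho>))"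
proof -
  obtain n k where nk: "lower_cube (of_rat \<beta>) n k" "dyadic_cube n k \<subseteq> oball t0 \<rho>"
    using exists_lower_cube[OF pos \<beta>(2) \<rho>] by blast
  have "\<not> hnull (of_rat s) ((\<lambda>t. (t, X t \<omega>)) ` dyadic_cube n k)"
    using reg nk(1) \<beta>(1) e unfolding regular_path_def by blast
  then have "\<not> hnull (of_rat s) (graph_over X \<omega> (oball t0 \<rho>))"
    using hnull_subset[OF _ image_mono[OF nk(2)]] unfolding graph_over_def by (rule contrapos_nn)
  then show ?thesis using e by (intro le_hausdorff_dim) auto
qed

lemma range_dim_ge:
  assumes reg: "regular_path \<omega>" and pos: "0 < liminf_holder M (\<lambda>t \<omega>. X t \<omega> $ i) t0"
    and \<beta>: "0 < \<beta>" "liminf_sub M (\<lambda>t \<omega>. X t \<omega> $ i) t0 < ereal (of_rat \<beta>)" and \<rho>: "0 < \<rho>"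
    and s: "0 < s" "of_rat s < real CARD('d)" "of_rat \<beta> * of_rat s < real CARD('n)"
  shows "ereal (of_rat s) \<le> hausdorff_dim (range_over X \<omega> (oball t0 \<rho>))"
proof -
  obtain n k where nk: "lower_cube (of_rat \<beta>) n k" "dyadic_cube n k \<subseteq> oball t0 \<rho>"
    using exists_lower_cube[OF pos \<beta>(2) \<rho>] by blast
  have "\<not> hnull (of_rat s) ((\<lambda>t. X t \<omega>) ` dyadic_cube n k)"
    using reg nk(1) \<beta>(1) s unfolding regular_path_def by blast
  then have "\<not> hnull (of_rat s) (range_over X \<omega> (oball t0 \<rho>))"
    using hnull_subset[OF _ image_mono[OF nk(2)]] unfolding range_over_def by (rule contrapos_nn)
  then show ?thesis using s by (intro le_hausdorff_dim) auto
qed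

lemma INF_range_dim_le:
  assumes reg: "regular_path \<omega>" and pos: "0 < liminf_holder M (\<lambda>t \<omega>. X t \<omega> $ i) t0"
  shows "(INF \<rho>\<in>{0<..}. hausdorff_dim (range_over X \<omega> (oball t0 \<rho>))) \<le>
    ereal (real CARD('n)) / liminf_holder M (\<lambda>t \<omega>. X t \<omega> $ i) t0" (is "?L \<le> _ / ?a")
proof (rule ereal_le_of_rat_above)
  fix q :: rat assume q: "ereal (real CARD('n)) / ?a < ereal (of_rat q)"
  have "0 \<le> ereal (real CARD('n)) / ?a" using pos by (intro zero_le_divide_ereal) auto
  then have "0 < ereal (of_rat q)" using q by (rule le_less_trans)
  then have q0: "0 < (of_rat q :: real)" by simp
  have "ereal (real CARD('n) / of_rat q) < ?a"
  \<comment> \<open>An infinite lower limit exceeds every real, so only the finite case needs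
    computation.\<close>
  proof (cases ?a)
    case (real a)
    then have a: "0 < a" using pos by simp
    then have "real CARD('n) / a < of_rat q" using q real by simp
    then show ?thesis using q0 a real by (simp add: field_simps)
  qed (use pos in auto)
  then obtain \<gamma> :: rat where \<gamma>: "ereal (real CARD('n) / of_rat q) < ereal (of_rat \<gamma>)" "ereal (of_rat \<gamma>) < ?a"
    using ereal_dense3 by blast
  then have N: "real CARD('n) < of_rat \<gamma> * of_rat q" using q0 by (simp add: field_simps)
  have "0 \<le> real CARD('n) / of_rat q" using q0 by simp
  then have "0 < (of_rat \<gamma> :: real)" using \<gamma>(1) unfolding less_ereal.simps by (rule le_less_trans)
  then have "0 < \<gamma>" by simp
  then obtain \<rho> where "0 < \<rho>" "hausdorff_dim (range_over X \<omega> (oball t0 \<rho>)) \<le> ereal (of_rat q)"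
    using range_dim_le[OF reg _ \<gamma>(2) q0 N] by blast
  then show "?L \<le> ereal (of_rat q)" by (intro INF_lower2[of \<rho>]) auto
qed

lemma INF_graph_dim_le:
  assumes reg: "regular_path \<omega>" and a: "liminf_holder M (\<lambda>t \<omega>. X t \<omega> $ i) t0 = ereal a" "0 < a" "a \<le> 1"
  shows "(INF \<rho>\<in>{0<..}. hausdorff_dim (graph_over X \<omega> (oball t0 \<rho>))) \<le>
    ereal (min (real CARD('n) / a) (real CARD('n) + real CARD('d) * (1 - a)))" (is "?L \<le> _")
proof (rule ereal_le_of_rat_above)
  fix q :: rat
  assume "ereal (min (real CARD('n) / a) (real CARD('n) + real CARD('d) * (1 - a))) < ereal (of_rat q)"
  then consider (1) "real CARD('n) / a < of_rat q" | (2) "real CARD('n) + real CARD('d) * (1 - a) < of_rat q"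
    by (auto simp: min_less_iff_disj)
  \<comment> \<open>Both covering bounds are brought to one form: every order \<gamma> above a
    threshold \<open>c < a\<close> is good enough for one of them.\<close>
  then obtain c where q0: "0 < (of_rat q :: real)" and c: "0 \<le> c" "c < a"
    and alt: "\<And>\<gamma>. c < \<gamma> \<Longrightarrow> real CARD('n) < \<gamma> * of_rat q \<or> real CARD('n) + real CARD('d) * (1 - \<gamma>) < of_rat q"
  proof cases
    case 1
    have "0 < real CARD('n) / a" using a by simp
    then have q0: "0 < (of_rat q :: real)" using 1 by linarith
    show thesis
      using 1 q0 a by (intro that[of "real CARD('n) / of_rat q"]) (auto simp: field_simps)
  next
    case 2
    have "0 \<le> real CARD('d) * (1 - a)" "0 < real CARD('n)" using a by auto
    then have q0: "0 < (of_rat q :: real)" using 2 by linarith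
    \<comment> \<open>Solves \<open>N + d * (1 - \<gamma>) = q\<close> for \<gamma>, truncated at 0
      so that larger orders are positive.\<close>
    define c where "c = max 0 (1 - (of_rat q - real CARD('n)) / real CARD('d))"
    show thesis
    proof (rule that[of c])
      show "c < a" using 2 a by (auto simp: c_def field_simps)
      fix \<gamma> assume "c < \<gamma>"
      then have "1 - (of_rat q - real CARD('n)) / real CARD('d) < \<gamma>" by (simp add: c_def)
      then show "real CARD('n) < \<gamma> * of_rat q \<or> real CARD('n) + real CARD('d) * (1 - \<gamma>) < of_rat q"
        by (simp add: field_simps)
    qed (use q0 in \<open>auto simp: c_def\<close>)
  qed
  obtain \<gamma> :: rat where \<gamma>: "c < of_rat \<gamma>" "of_rat \<gamma> < a" using of_rat_dense[OF c(2)] by blast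
  have "0 < (of_rat \<gamma> :: real)" "(of_rat \<gamma> :: real) \<le> 1" using \<gamma> c a by linarith+
  then have "0 < \<gamma>" "\<gamma> \<le> 1" by simp_all
  then obtain \<rho> where "0 < \<rho>" "hausdorff_dim (graph_over X \<omega> (oball t0 \<rho>)) \<le> ereal (of_rat q)"
    using graph_dim_le[OF reg, of \<gamma> i t0 "of_rat q"] \<gamma> q0 a alt[OF \<gamma>(1)] by auto
  then show "?L \<le> ereal (of_rat q)" by (intro INF_lower2[of \<rho>]) auto
qed

lemma INF_range_dim_ge:
  assumes reg: "regular_path \<omega>" and pos: "0 < liminf_holder M (\<lambda>t \<omega>. X t \<omega> $ i) t0"
    and b: "liminf_sub M (\<lambda>t \<omega>. X t \<omega> $ i) t0 = ereal b" "0 < b"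
  shows "ereal (min (real CARD('n) / b) (real CARD('d))) \<le>
    (INF \<rho>\<in>{0<..}. hausdorff_dim (range_over X \<omega> (oball t0 \<rho>)))"
proof (intro INF_greatest)
  fix \<rho> :: real assume "\<rho> \<in> {0<..}"
  then have \<rho>: "0 < \<rho>" by simp
  show "ereal (min (real CARD('n) / b) (real CARD('d))) \<le> hausdorff_dim (range_over X \<omega> (oball t0 \<rho>))"
  proof (rule ereal_le_of_rat_below)
    fix q :: rat assume "ereal (of_rat q) < ereal (min (real CARD('n) / b) (real CARD('d)))"
    then have q: "of_rat q < real CARD('n) / b" "of_rat q < real CARD('d)" by auto
    show "ereal (of_rat q) \<le> hausdorff_dim (range_over X \<omega> (oball t0 \<rho>))"
    proof (cases "0 < q")
      case True
      then have q0: "0 < (of_rat q :: real)" by simp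
      \<comment> \<open>This gap leaves room for a rational \<beta> above \<open>b\<close> that
        still satisfies \<open>\<beta> * q < N\<close>.\<close>
      then have "b < real CARD('n) / of_rat q" using q b by (simp add: field_simps)
      then obtain \<beta> :: rat where \<beta>: "b < of_rat \<beta>" "of_rat \<beta> < real CARD('n) / of_rat q"
        using of_rat_dense by blast
      have "0 < (of_rat \<beta> :: real)" using \<beta> b by linarith
      then have "0 < \<beta>" by simp
      then show ?thesis
        using \<beta> b q0 q True by (intro range_dim_ge[OF reg pos _ _ \<rho>]) (auto simp: field_simps)
    next
      case False
      then have "ereal (of_rat q) \<le> 0" by simp
      then show ?thesis using hausdorff_dim_nonneg by (rule order_trans)
    qed
  qed
qed

lemma INF_graph_dim_ge:
  assumes reg: "regular_path \<omega>" and pos: "0 < liminf_holder M (\<lambda>t \<omega>. X t \<omega> $ i) t0"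
    and b: "liminf_sub M (\<lambda>t \<omega>. X t \<omega> $ i) t0 = ereal b" "0 < b" and N: "real CARD('d) * b < real CARD('n)"
  shows "ereal (real CARD('n) + real CARD('d) * (1 - b)) \<le>
    (INF \<rho>\<in>{0<..}. hausdorff_dim (graph_over X \<omega> (oball t0 \<rho>)))"
proof (intro INF_greatest)
  define N d where "N = real CARD('n)" and "d = real CARD('d)"
  have d: "0 < d" and N0: "0 < N" by (simp_all add: d_def N_def)
  fix \<rho> :: real assume "\<rho> \<in> {0<..}"
  then have \<rho>: "0 < \<rho>" by simp
  show "ereal (real CARD('n) + real CARD('d) * (1 - b)) \<le> hausdorff_dim (graph_over X \<omega> (oball t0 \<rho>))"
  proof (rule ereal_le_of_rat_below)
    fix q :: rat assume "ereal (of_rat q) < ereal (real CARD('n) + real CARD('d) * (1 - b))"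
    then have q: "of_rat q < N + d * (1 - b)" by (simp add: N_def d_def)
    have "\<exists>s \<beta> e :: rat. q \<le> s \<and> b < of_rat \<beta> \<and> 0 < e \<and> of_rat e < d \<and> e \<le> s \<and>
        of_rat s - of_rat e * (1 - of_rat \<beta>) < N"
    proof (cases "b < 1")
      case True
      \<comment> \<open>This is the hypothesis \<open>d * b < N\<close> rearranged; it allows
        \<open>s > d\<close>, so that \<open>e\<close> may approach \<open>d\<close> and still
        satisfy \<open>e \<le> s\<close>.\<close>
      have "d < N + d * (1 - b)" using N by (simp add: N_def d_def algebra_simps)
      then have "max d (of_rat q) < N + d * (1 - b)" using q by simp
      then obtain s :: rat where s: "max d (of_rat q) < of_rat s" "of_rat s < N + d * (1 - b)"
        using of_rat_dense by blast
      \<comment> \<open>The slack: one half pays for replacing \<open>b\<close> by \<beta>, the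
        other for replacing \<open>d\<close> by \<open>e\<close>.\<close>
      define \<eta> where "\<eta> = N + d * (1 - b) - of_rat s"
      have \<eta>: "0 < \<eta>" using s by (simp add: \<eta>_def)
      have "b < min 1 (b + \<eta> / (2 * d))" using True \<eta> d by simp
      then obtain \<beta> :: rat where \<beta>: "b < of_rat \<beta>" "of_rat \<beta> < min 1 (b + \<eta> / (2 * d))"
        using of_rat_dense by blast
      have "max 0 (d - \<eta> / 2) < d" using d \<eta> by simp
      then obtain e :: rat where e: "max 0 (d - \<eta> / 2) < of_rat e" "of_rat e < d"
        using of_rat_dense by blast
      have b0: "0 \<le> 1 - (of_rat \<beta> :: real)" "1 - (of_rat \<beta> :: real) \<le> 1" using \<beta> b by linarith+
      have "(of_rat \<beta> - b) * d < \<eta> / (2 * d) * d" using \<beta> d by (intro mult_strict_right_mono) auto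
      then have 1: "of_rat \<beta> * d - b * d < \<eta> / 2" using d by (simp add: algebra_simps)
      have "(d - of_rat e) * (1 - of_rat \<beta>) \<le> d - of_rat e"
        using mult_left_mono[OF b0(2), of "d - of_rat e"] e(2) by simp
      also have "\<dots> < \<eta> / 2" using e(1) by linarith
      finally have 2: "(d - of_rat e) * (1 - of_rat \<beta>) < \<eta> / 2" .
      have "of_rat s - of_rat e * (1 - of_rat \<beta>) < N"
        using 1 2 unfolding \<eta>_def by (simp add: algebra_simps)
      moreover have "0 < (of_rat e :: real)" "(of_rat e :: real) \<le> of_rat s" "(of_rat q :: real) \<le> of_rat s"
        using e s by auto
      then have "0 < e" "e \<le> s" "q \<le> s" by (simp_all add: of_rat_less_eq)
      ultimately show ?thesis using \<beta>(1) e(2) by (intro exI[of _ s] exI[of _ \<beta>] exI[of _ e] conjI)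
    next
      case False
      \<comment> \<open>For \<open>b \<ge> 1\<close> the target does not exceed \<open>N\<close>, so
        some \<open>s < N\<close> suffices and a very small \<open>e\<close> makes the spatial loss
        harmless.\<close>
      have "d * (1 - b) \<le> 0" using False d by (simp add: mult_nonneg_nonpos)
      then have max_less: "max 0 (of_rat q) < N" using q N0 by simp
      obtain s :: rat where s: "max 0 (of_rat q) < (of_rat s :: real)" "of_rat s < N"
        using of_rat_dense[OF max_less] by blast
      obtain \<beta> :: rat where \<beta>: "b < of_rat \<beta>" "of_rat \<beta> < b + 1" using of_rat_dense[of b "b + 1"] by auto
      have \<beta>0: "0 < (of_rat \<beta> :: real)" using \<beta> b by linarith
      have "0 < min (min d (of_rat s)) ((N - of_rat s) / of_rat \<beta>)" using d s \<beta>0 by simp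
      then obtain e :: rat where e: "0 < (of_rat e :: real)" "of_rat e < min (min d (of_rat s)) ((N - of_rat s) / of_rat \<beta>)"
        using of_rat_dense by blast
      then have "of_rat e * of_rat \<beta> < N - of_rat s" using \<beta>0 by (simp add: field_simps)
      then have "of_rat s - of_rat e * (1 - of_rat \<beta>) < N"
        using e(1) unfolding right_diff_distrib mult_1_right by linarith
      moreover have "(of_rat e :: real) \<le> of_rat s" "(of_rat q :: real) \<le> of_rat s" "of_rat e < d"
        using e s by auto
      then have "e \<le> s" "q \<le> s" by (simp_all add: of_rat_less_eq)
      moreover have "0 < e" "of_rat e < d" using e d s by simp_all
      ultimately show ?thesis using \<beta>(1) by (intro exI[of _ s] exI[of _ \<beta>] exI[of _ e] conjI)
    qed
    then obtain s \<beta> e :: rat where w: "q \<le> s" "b < of_rat \<beta>" "0 < e" "of_rat e < d" "e \<le> s"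
        "of_rat s - of_rat e * (1 - of_rat \<beta>) < N"
      by blast
    have "0 < (of_rat \<beta> :: real)" using w(2) b by linarith
    then have "0 < \<beta>" by simp
    then have "ereal (of_rat s) \<le> hausdorff_dim (graph_over X \<omega> (oball t0 \<rho>))"
      using w b by (intro graph_dim_ge[OF reg pos _ _ \<rho>, of \<beta> e]) (auto simp: N_def d_def)
    moreover have "ereal (of_rat q) \<le> ereal (of_rat s)" using w(1) by (simp add: of_rat_less_eq)
    ultimately show "ereal (of_rat q) \<le> hausdorff_dim (graph_over X \<omega> (oball t0 \<rho>))"
      by (rule order_trans[rotated])
  qed
qed

end

text \<open>If \<open>a_til t0\<close> is infinite, then \<open>N + d * (1 - a_til t0)\<close> is
  \<open>-\<infinity>\<close> while dimensions are nonnegative; hence the finiteness condition on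
  the upper graph bound in case (1). In case (2) finiteness follows from
  \<open>a_til t0 \<le> a_sub t0\<close>.\<close>

theorem theorem2p3:
  fixes M :: "'w measure"
    and X :: "real ^ 'n \<Rightarrow> 'w \<Rightarrow> real ^ 'd"
    and i :: 'd
    and a_til a_sub :: "real ^ 'n \<Rightarrow> ereal"
    and N d :: ereal
  assumes "prob_space M"
    and "gaussian_field M X"
    and "continuous_version M X"
  defines "N \<equiv> ereal (real CARD('n))"
    and "d \<equiv> ereal (real CARD('d))"
    and "a_til \<equiv> liminf_holder M (\<lambda>t \<omega>. X t \<omega> $ i)"
    and "a_sub \<equiv> liminf_sub M (\<lambda>t \<omega>. X t \<omega> $ i)"
  shows "AE \<omega> in M. \<forall>t0 \<in> {t \<in> orthant. 0 < a_til t}.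
    (N \<le> d * a_sub t0 \<longrightarrow>
      (\<exists>L. has_local_dim (graph_over X \<omega>) t0 L \<and> N / a_sub t0 \<le> L \<and>
           (a_til t0 < \<infinity> \<longrightarrow> L \<le> min (N / a_til t0) (N + d * (1 - a_til t0)))) \<and>
      (\<exists>L. has_local_dim (range_over X \<omega>) t0 L \<and> N / a_sub t0 \<le> L \<and>
           L \<le> min (N / a_til t0) d)) \<and>
    (N > d * a_sub t0 \<longrightarrow>
      (\<exists>L. has_local_dim (graph_over X \<omega>) t0 L \<and> N + d * (1 - a_sub t0) \<le> L \<and>
           L \<le> min (N / a_til t0) (N + d * (1 - a_til t0))) \<and>
      has_local_dim (range_over X \<omega>) t0 d)"
proof -
  interpret gaussian_field_space M X
    using assms(1,2) by (simp add: gaussian_field_space_def gaussian_field_space_axioms_def)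
  have "AE \<omega> in M. regular_path \<omega>" by (rule AE_regular_path[OF assms(3)])
  then show ?thesis
  proof (eventually_elim, intro ballI)
    fix \<omega> t0 assume reg: "regular_path \<omega>" and "t0 \<in> {t \<in> orthant. 0 < a_til t}"
    then have pos: "0 < a_til t0" by simp
    note pos' = pos[unfolded a_til_def]
    define Lg where "Lg = (INF \<rho>\<in>{0<..}. hausdorff_dim (graph_over X \<omega> (oball t0 \<rho>)))"
    define Lr where "Lr = (INF \<rho>\<in>{0<..}. hausdorff_dim (range_over X \<omega> (oball t0 \<rho>)))"
    have hg: "has_local_dim (graph_over X \<omega>) t0 Lg"
      unfolding Lg_def graph_over_def by (intro has_local_dim_INF image_mono oball_mono)
    have hr: "has_local_dim (range_over X \<omega>) t0 Lr"
      unfolding Lr_def range_over_def by (intro has_local_dim_INF image_mono oball_mono)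
    have Lrg: "Lr \<le> Lg" unfolding Lr_def Lg_def by (intro INF_mono' hausdorff_dim_range_le_graph)
    have Lr0: "0 \<le> Lr" unfolding Lr_def by (intro INF_greatest hausdorff_dim_nonneg)
    have Lrd: "Lr \<le> d" unfolding Lr_def d_def by (intro INF_lower2[of 1] hausdorff_dim_le_DIM) simp
    have Lra: "Lr \<le> N / a_til t0" unfolding Lr_def N_def a_til_def by (rule INF_range_dim_le[OF reg pos'])
    have sub: "a_til t0 \<le> a_sub t0" unfolding a_til_def a_sub_def by (rule liminf_holder_le_liminf_sub)
    have Lga: "Lg \<le> min (N / a_til t0) (N + d * (1 - a_til t0))" if fin: "a_til t0 < \<infinity>"
    proof -
      obtain a where a: "a_til t0 = ereal a" "0 < a" using fin pos by (cases "a_til t0") auto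
      have "a \<le> 1" using liminf_holder_le_1[of i t0] fin a by (simp add: a_til_def)
      then have "Lg \<le> ereal (min (real CARD('n) / a) (real CARD('n) + real CARD('d) * (1 - a)))"
        unfolding Lg_def using a by (intro INF_graph_dim_le[OF reg]) (auto simp: a_til_def)
      then show ?thesis using a by (simp add: N_def d_def one_ereal_def min_def split: if_splits)
    qed
    have lower: "N / a_sub t0 \<le> Lr" if "N \<le> d * a_sub t0"
    proof (cases "a_sub t0")
      case (real b)
      have "0 < ereal b" using less_le_trans[OF pos sub] by (simp only: real)
      then have b: "0 < b" by simp
      then have "min (real CARD('n) / b) (real CARD('d)) = real CARD('n) / b"
        using that real by (simp add: N_def d_def field_simps)
      moreover have "ereal (min (real CARD('n) / b) (real CARD('d))) \<le> Lr"
        unfolding Lr_def using real b by (intro INF_range_dim_ge[OF reg pos']) (auto simp: a_sub_def)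
      ultimately show ?thesis using b real by (simp add: N_def)
    \<comment> \<open>For \<open>a_sub t0 = \<infinity>\<close> the quotient is 0 and nonnegativity
      of the dimension suffices.\<close>
    qed (use Lr0 pos sub in auto)
    have case2: "N + d * (1 - a_sub t0) \<le> Lg \<and> a_til t0 < \<infinity> \<and> Lr = d" if lt: "d * a_sub t0 < N"
    proof -
      obtain b where real: "a_sub t0 = ereal b"
        using lt pos sub by (cases "a_sub t0") (auto simp: N_def d_def)
      have "0 < ereal b" using less_le_trans[OF pos sub] by (simp only: real)
      then have b: "0 < b" by simp
      have lt': "real CARD('d) * b < real CARD('n)" using lt real by (simp add: N_def d_def)
      then have "min (real CARD('n) / b) (real CARD('d)) = real CARD('d)"
        using b by (simp add: field_simps)
      moreover have "ereal (min (real CARD('n) / b) (real CARD('d))) \<le> Lr"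
        unfolding Lr_def using real b by (intro INF_range_dim_ge[OF reg pos']) (auto simp: a_sub_def)
      ultimately have "Lr = d" using Lrd by (simp add: d_def antisym)
      moreover have "ereal (real CARD('n) + real CARD('d) * (1 - b)) \<le> Lg"
        unfolding Lg_def using real b lt' by (intro INF_graph_dim_ge[OF reg pos']) (auto simp: a_sub_def)
      then have "N + d * (1 - a_sub t0) \<le> Lg" using real by (simp add: N_def d_def one_ereal_def)
      moreover have "a_til t0 < \<infinity>" using sub real by auto
      ultimately show ?thesis by blast
    qed
    show "(N \<le> d * a_sub t0 \<longrightarrow>
      (\<exists>L. has_local_dim (graph_over X \<omega>) t0 L \<and> N / a_sub t0 \<le> L \<and>
           (a_til t0 < \<infinity> \<longrightarrow> L \<le> min (N / a_til t0) (N + d * (1 - a_til t0)))) \<and>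
      (\<exists>L. has_local_dim (range_over X \<omega>) t0 L \<and> N / a_sub t0 \<le> L \<and>
           L \<le> min (N / a_til t0) d)) \<and>
    (N > d * a_sub t0 \<longrightarrow>
      (\<exists>L. has_local_dim (graph_over X \<omega>) t0 L \<and> N + d * (1 - a_sub t0) \<le> L \<and>
           L \<le> min (N / a_til t0) (N + d * (1 - a_til t0))) \<and>
      has_local_dim (range_over X \<omega>) t0 d)"
    proof (intro conjI impI)
      assume "N \<le> d * a_sub t0"
      then have l: "N / a_sub t0 \<le> Lr" by (rule lower)
      show "\<exists>L. has_local_dim (graph_over X \<omega>) t0 L \<and> N / a_sub t0 \<le> L \<and>
           (a_til t0 < \<infinity> \<longrightarrow> L \<le> min (N / a_til t0) (N + d * (1 - a_til t0)))"
        using hg order_trans[OF l Lrg] Lga by blast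
      show "\<exists>L. has_local_dim (range_over X \<omega>) t0 L \<and> N / a_sub t0 \<le> L \<and> L \<le> min (N / a_til t0) d"
        using hr l Lra Lrd by (intro exI[of _ Lr]) simp
    next
      assume "d * a_sub t0 < N"
      note c = case2[OF this]
      show "\<exists>L. has_local_dim (graph_over X \<omega>) t0 L \<and> N + d * (1 - a_sub t0) \<le> L \<and>
           L \<le> min (N / a_til t0) (N + d * (1 - a_til t0))"
        using hg c Lga by blast
      show "has_local_dim (range_over X \<omega>) t0 d" using hr c by simp
    qed
  qed
qed

end
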